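(* The category $Dbl$ of double categories and strict double functors, equipped with the product $\otimes^{st}_{o\text{-}l}$, is biclosed monoidal.
   Context: Double categories are strict; their cells are objects, horizontal 1-cells (1h-cells), vertical 1-cells (1v-cells) and 2-cells (squares). For 1h-cells $gf$ means $f$ followed by $g$; for 1v-cells $\frac{u}{v}$ means $u$ followed by $v$; $[\omega|\omega']$ and $\frac{\omega}{\omega'}$ are horizontal (left to right) and vertical (top to bottom) pasting of 2-cells; $1_A$, $1^A$ are identity 1h-/1v-cells. A vertically globular 2-cell (identity vertical sides) with top $x$ and bottom $y$ is written $x\Rightarrow y$; a horizontally globular one has identity horizontal sides. In pastings a 1-cell stands for its identity 2-cell. A horizontal oplax transformation $\alpha:F\to G$ of strict double functors has 1h-cells $\alpha(A):F(A)\to G(A)$; for each 1v-cell $u:A\to A'$ a 2-cell $\alpha^u$ with top $\alpha(A)$, bottom $\alpha(A')$, left $F(u)$, right $G(u)$; for each 1h-cell $f:A\to B$ a 2-cell $\delta_{\alpha,f}:\alpha(B)F(f)\Rightarrow G(f)\alpha(A)$; such that $\delta_{\alpha,gf}=\frac{[F(f)|\delta_{\alpha,g}]}{[\delta_{\alpha,f}|G(g)]}$, $\delta_{\alpha,1_A}$ is an identity, $\alpha^{\frac uv}=\frac{\alpha^u}{\alpha^v}$, $\alpha^{1^A}$ is an identity, and for each 2-cell $a$ with top $f$, bottom $g$, left $u$, right $v$: $\frac{[F(a)|\alpha^v]}{\delta_{\alpha,g}}=\frac{\delta_{\alpha,f}}{[\alpha^u|G(a)]}$. A vertical lax transformation $\alpha_0:F\to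 F'$ has 1v-cells $\alpha_0(A):F(A)\to F'(A)$; for each 1h-cell $f:A\to B$ a 2-cell $(\alpha_0)_f$ with top $F(f)$, bottom $F'(f)$, left $\alpha_0(A)$, right $\alpha_0(B)$; for each 1v-cell $u:A\to\tilde A$ a horizontally globular 2-cell $\alpha_0^u$ with left side $\frac{\alpha_0(A)}{F'(u)}$ and right side $\frac{F(u)}{\alpha_0(\tilde A)}$; such that $(\alpha_0)_{gf}=[(\alpha_0)_f|(\alpha_0)_g]$, $(\alpha_0)_{1_A}$ is an identity, $\alpha_0^{\frac{u}{u'}}=\left[\frac{\alpha_0^u}{F'(u')}\Big|\frac{F(u)}{\alpha_0^{u'}}\right]$, $\alpha_0^{1^A}$ is an identity, and for each 2-cell $a$ with top $f$, bottom $g$, left $u$, right $v$: $\left[\alpha_0^u\Big|\frac{F(a)}{(\alpha_0)_g}\right]=\left[\frac{(\alpha_0)_f}{F'(a)}\Big|\alpha_0^v\right]$. A modification $\Theta$ with top $\alpha:F\to G$, bottom $\beta:F'\to G'$, left $\alpha_0:F\to F'$, right $\beta_0:G\to G'$ is a family of 2-cells $\Theta_A$ with the corresponding boundary components such that $\frac{[(\alpha_0)_f|\Theta_B]}{\delta_{\beta,f}}=\frac{\delta_{\alpha,f}}{[\Theta_A|(\beta_0)_f]}$ and $\left[\alpha_0^u\Big|\frac{\alpha^u}{\Theta_{\tilde A}}\right]=\left[\frac{\Theta_A}{\beta^u}\Big|\beta_0^u\right]$. $Dbl_{hop}(\mathcal B,\mathcal C)$ is the double category of strict double functors, horizontal oplax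 transformations (1h-cells), vertical lax transformations (1v-cells) and modifications. A quasi-functor $H:\mathcal A\times\mathcal B\to\mathcal C$ of type $(st,o\text{-}l)$ is the data of a strict double functor $H^t:\mathcal A\to Dbl_{hop}(\mathcal B,\mathcal C)$ unpacked in $\mathcal C$: strict double functors $H(A,-)=H^t(A)$ and $H(-,B)$ (evaluation of $H^t$ at $B$), and structure 2-cells $(K,k)=\delta_{H^t(K),k}$, $(K,u)=H^t(K)^u$, $(U,k)=H^t(U)_k$, $(U,u)=H^t(U)^u$ for 1h-cells $K,k$ and 1v-cells $U,u$ of $\mathcal A,\mathcal B$. $\mathcal A\otimes^{st}_{o\text{-}l}\mathcal B$ is the double category presented by generators: objects $A\otimes B$; cells $A\otimes y$ and $x\otimes B$ for all 1h-, 1v- and 2-cells $y$ of $\mathcal B$, $x$ of $\mathcal A$; and 2-cells $K\otimes k$, $K\otimes u$, $U\otimes k$, $U\otimes u$ with the boundaries of the structure 2-cells $(K,k),(K,u),(U,k),(U,u)$; subject to exactly the relations making $J:\mathcal A\times\mathcal B\to\mathcal A\otimes\mathcal B$, $J(A,-)=A\otimes -$, $J(-,B)=-\otimes B$, with these structure 2-cells, a quasi-functor of type $(st,o\text{-}l)$. It is extended to strict double functors in the evident way. A monoidal category is biclosed if both functors $-\otimes\mathcal B$ and $\mathcal B\otimes -$ have right adjoints for every object $\mathcal B$. *)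

theory Defs
  imports Main "HOL-Library.FuncSet"
begin

section \<open>Strict double categories and strict double functors\<close>

datatype kind = Ob | Hor | Ver | Sq

text \<open>
  All four kinds of cells are drawn from one type; the four carriers need not be disjoint.
  Compositions are written in diagrammatic order: \<open>hcmp f g\<close> is \<open>f\<close> followed by \<open>g\<close>,
  \<open>hpst a b\<close> is the pasting \<open>[a|b]\<close> and \<open>vpst a b\<close> is \<open>a\<close> on top of \<open>b\<close>.
  \<open>idv f\<close> is the identity 2-cell of a 1h-cell \<open>f\<close> (a unit for \<open>vpst\<close>) and
  \<open>idh u\<close> is the identity 2-cell of a 1v-cell \<open>u\<close> (a unit for \<open>hpst\<close>).
\<close>

record 'a dblcat =
  cells :: "kind \<Rightarrow> 'a set"
  hsrc :: "'a \<Rightarrow> 'a"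
  htgt :: "'a \<Rightarrow> 'a"
  vsrc :: "'a \<Rightarrow> 'a"
  vtgt :: "'a \<Rightarrow> 'a"
  tp :: "'a \<Rightarrow> 'a"
  bt :: "'a \<Rightarrow> 'a"
  lf :: "'a \<Rightarrow> 'a"
  rt :: "'a \<Rightarrow> 'a"
  hone :: "'a \<Rightarrow> 'a"
  vone :: "'a \<Rightarrow> 'a"
  hcmp :: "'a \<Rightarrow> 'a \<Rightarrow> 'a"
  vcmp :: "'a \<Rightarrow> 'a \<Rightarrow> 'a"
  idh :: "'a \<Rightarrow> 'a"
  idv :: "'a \<Rightarrow> 'a"
  hpst :: "'a \<Rightarrow> 'a \<Rightarrow> 'a"
  vpst :: "'a \<Rightarrow> 'a \<Rightarrow> 'a"

definition category_on ::
  "'a set \<Rightarrow> 'a set \<Rightarrow> ('a \<Rightarrow> 'a) \<Rightarrow> ('a \<Rightarrow> 'a) \<Rightarrow> ('a \<Rightarrow> 'a) \<Rightarrow> ('a \<Rightarrow> 'a \<Rightarrow> 'a) \<Rightarrow> bool" where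
  "category_on X M src tgt one cmp \<longleftrightarrow>
     (\<forall>f\<in>M. src f \<in> X \<and> tgt f \<in> X) \<and>
     (\<forall>x\<in>X. one x \<in> M \<and> src (one x) = x \<and> tgt (one x) = x) \<and>
     (\<forall>f\<in>M. \<forall>g\<in>M. tgt f = src g \<longrightarrow>
        cmp f g \<in> M \<and> src (cmp f g) = src f \<and> tgt (cmp f g) = tgt g) \<and>
     (\<forall>f\<in>M. cmp (one (src f)) f = f \<and> cmp f (one (tgt f)) = f) \<and>
     (\<forall>f\<in>M. \<forall>g\<in>M. \<forall>h\<in>M. tgt f = src g \<and> tgt g = src h \<longrightarrow>
        cmp (cmp f g) h = cmp f (cmp g h))"

definition double_category :: "'a dblcat \<Rightarrow> bool" where
  "double_category C \<longleftrightarrow>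
     category_on (cells C Ob) (cells C Hor) (hsrc C) (htgt C) (hone C) (hcmp C) \<and>
     category_on (cells C Ob) (cells C Ver) (vsrc C) (vtgt C) (vone C) (vcmp C) \<and>
     category_on (cells C Ver) (cells C Sq) (lf C) (rt C) (idh C) (hpst C) \<and>
     category_on (cells C Hor) (cells C Sq) (tp C) (bt C) (idv C) (vpst C) \<and>
     (\<forall>a\<in>cells C Sq.
        hsrc C (tp C a) = vsrc C (lf C a) \<and> htgt C (tp C a) = vsrc C (rt C a) \<and>
        hsrc C (bt C a) = vtgt C (lf C a) \<and> htgt C (bt C a) = vtgt C (rt C a)) \<and>
     (\<forall>u\<in>cells C Ver. tp C (idh C u) = hone C (vsrc C u) \<and> bt C (idh C u) = hone C (vtgt C u)) \<and>
     (\<forall>f\<in>cells C Hor. lf C (idv C f) = vone C (hsrc C f) \<and> rt C (idv C f) = vone C (htgt C f)) \<and>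
     (\<forall>x\<in>cells C Ob. idh C (vone C x) = idv C (hone C x)) \<and>
     (\<forall>a\<in>cells C Sq. \<forall>b\<in>cells C Sq. rt C a = lf C b \<longrightarrow>
        tp C (hpst C a b) = hcmp C (tp C a) (tp C b) \<and>
        bt C (hpst C a b) = hcmp C (bt C a) (bt C b)) \<and>
     (\<forall>a\<in>cells C Sq. \<forall>b\<in>cells C Sq. bt C a = tp C b \<longrightarrow>
        lf C (vpst C a b) = vcmp C (lf C a) (lf C b) \<and>
        rt C (vpst C a b) = vcmp C (rt C a) (rt C b)) \<and>
     (\<forall>f\<in>cells C Hor. \<forall>g\<in>cells C Hor. htgt C f = hsrc C g \<longrightarrow>
        idv C (hcmp C f g) = hpst C (idv C f) (idv C g)) \<and>
     (\<forall>u\<in>cells C Ver. \<forall>v\<in>cells C Ver. vtgt C u = vsrc C v \<longrightarrow>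
        idh C (vcmp C u v) = vpst C (idh C u) (idh C v)) \<and>
     (\<forall>a\<in>cells C Sq. \<forall>b\<in>cells C Sq. \<forall>c\<in>cells C Sq. \<forall>d\<in>cells C Sq.
        rt C a = lf C b \<and> rt C c = lf C d \<and> bt C a = tp C c \<and> bt C b = tp C d \<longrightarrow>
        vpst C (hpst C a b) (hpst C c d) = hpst C (vpst C a c) (vpst C b d))"

definition vop :: "'a dblcat \<Rightarrow> 'a dblcat" where
  "vop C = C\<lparr>vsrc := vtgt C, vtgt := vsrc C, tp := bt C, bt := tp C,
             vcmp := (\<lambda>u v. vcmp C v u), vpst := (\<lambda>a b. vpst C b a)\<rparr>"

definition unit_dbl :: "unit dblcat" where
  "unit_dbl = \<lparr>cells = (\<lambda>_. UNIV), hsrc = id, htgt = id, vsrc = id, vtgt = id,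
     tp = id, bt = id, lf = id, rt = id, hone = id, vone = id, hcmp = (\<lambda>_ _. ()),
     vcmp = (\<lambda>_ _. ()), idh = id, idv = id, hpst = (\<lambda>_ _. ()), vpst = (\<lambda>_ _. ())\<rparr>"

type_synonym ('a, 'b) dblfun = "kind \<Rightarrow> 'a \<Rightarrow> 'b"

text \<open>
  Strict double functors are extensional (\<open>undefined\<close> off the carriers), so that equality of
  functions is equality of double functors.
\<close>

definition Dbl :: "'a dblcat \<Rightarrow> 'b dblcat \<Rightarrow> ('a, 'b) dblfun set" where
  "Dbl A B = {F.
     (\<forall>k. F k \<in> cells A k \<rightarrow>\<^sub>E cells B k) \<and>
     (\<forall>f\<in>cells A Hor. hsrc B (F Hor f) = F Ob (hsrc A f) \<and> htgt B (F Hor f) = F Ob (htgt A f)) \<and>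
     (\<forall>u\<in>cells A Ver. vsrc B (F Ver u) = F Ob (vsrc A u) \<and> vtgt B (F Ver u) = F Ob (vtgt A u)) \<and>
     (\<forall>a\<in>cells A Sq.
        tp B (F Sq a) = F Hor (tp A a) \<and> bt B (F Sq a) = F Hor (bt A a) \<and>
        lf B (F Sq a) = F Ver (lf A a) \<and> rt B (F Sq a) = F Ver (rt A a)) \<and>
     (\<forall>x\<in>cells A Ob. F Hor (hone A x) = hone B (F Ob x) \<and> F Ver (vone A x) = vone B (F Ob x)) \<and>
     (\<forall>f\<in>cells A Hor. F Sq (idv A f) = idv B (F Hor f)) \<and>
     (\<forall>u\<in>cells A Ver. F Sq (idh A u) = idh B (F Ver u)) \<and>
     (\<forall>f\<in>cells A Hor. \<forall>g\<in>cells A Hor. htgt A f = hsrc A g \<longrightarrow>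
        F Hor (hcmp A f g) = hcmp B (F Hor f) (F Hor g)) \<and>
     (\<forall>u\<in>cells A Ver. \<forall>v\<in>cells A Ver. vtgt A u = vsrc A v \<longrightarrow>
        F Ver (vcmp A u v) = vcmp B (F Ver u) (F Ver v)) \<and>
     (\<forall>a\<in>cells A Sq. \<forall>b\<in>cells A Sq. rt A a = lf A b \<longrightarrow>
        F Sq (hpst A a b) = hpst B (F Sq a) (F Sq b)) \<and>
     (\<forall>a\<in>cells A Sq. \<forall>b\<in>cells A Sq. bt A a = tp A b \<longrightarrow>
        F Sq (vpst A a b) = vpst B (F Sq a) (F Sq b))}"

definition dbl_id :: "'a dblcat \<Rightarrow> ('a, 'a) dblfun" where
  "dbl_id A = (\<lambda>k. \<lambda>x\<in>cells A k. x)"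

text \<open>\<open>dbl_comp A G F\<close> is the composite \<open>F\<close> followed by \<open>G\<close>, where \<open>A\<close> is the domain of \<open>F\<close>.\<close>

definition dbl_comp :: "'a dblcat \<Rightarrow> ('b, 'c) dblfun \<Rightarrow> ('a, 'b) dblfun \<Rightarrow> ('a, 'c) dblfun" where
  "dbl_comp A G F = (\<lambda>k. compose (cells A k) (G k) (F k))"

definition dbl_iso :: "'a dblcat \<Rightarrow> 'b dblcat \<Rightarrow> ('a, 'b) dblfun \<Rightarrow> bool" where
  "dbl_iso A B F \<longleftrightarrow> F \<in> Dbl A B \<and>
     (\<exists>G\<in>Dbl B A. dbl_comp A G F = dbl_id A \<and> dbl_comp B F G = dbl_id B)"


section \<open>Double categories presented by generators and relations\<close>

datatype 'g tm =
    Gen 'g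
  | HOne "'g tm" | VOne "'g tm"
  | HCmp "'g tm" "'g tm" | VCmp "'g tm" "'g tm"
  | IdH "'g tm" | IdV "'g tm"
  | HPst "'g tm" "'g tm" | VPst "'g tm" "'g tm"

text \<open>The boundary of a generator is a term, so it may be a composite of generators.\<close>

record 'g presentation =
  pgen :: "kind \<Rightarrow> 'g set"
  phsrc :: "'g \<Rightarrow> 'g tm"
  phtgt :: "'g \<Rightarrow> 'g tm"
  pvsrc :: "'g \<Rightarrow> 'g tm"
  pvtgt :: "'g \<Rightarrow> 'g tm"
  ptp :: "'g \<Rightarrow> 'g tm"
  pbt :: "'g \<Rightarrow> 'g tm"
  plf :: "'g \<Rightarrow> 'g tm"
  prt :: "'g \<Rightarrow> 'g tm"
  prel :: "kind \<Rightarrow> 'g tm \<Rightarrow> 'g tm \<Rightarrow> bool"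

fun tm_hsrc :: "'g presentation \<Rightarrow> 'g tm \<Rightarrow> 'g tm" where
  "tm_hsrc P (Gen g) = phsrc P g"
| "tm_hsrc P (HOne x) = x"
| "tm_hsrc P (HCmp f g) = tm_hsrc P f"
| "tm_hsrc P _ = undefined"

fun tm_htgt :: "'g presentation \<Rightarrow> 'g tm \<Rightarrow> 'g tm" where
  "tm_htgt P (Gen g) = phtgt P g"
| "tm_htgt P (HOne x) = x"
| "tm_htgt P (HCmp f g) = tm_htgt P g"
| "tm_htgt P _ = undefined"

fun tm_vsrc :: "'g presentation \<Rightarrow> 'g tm \<Rightarrow> 'g tm" where
  "tm_vsrc P (Gen g) = pvsrc P g"
| "tm_vsrc P (VOne x) = x"
| "tm_vsrc P (VCmp u v) = tm_vsrc P u"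
| "tm_vsrc P _ = undefined"

fun tm_vtgt :: "'g presentation \<Rightarrow> 'g tm \<Rightarrow> 'g tm" where
  "tm_vtgt P (Gen g) = pvtgt P g"
| "tm_vtgt P (VOne x) = x"
| "tm_vtgt P (VCmp u v) = tm_vtgt P v"
| "tm_vtgt P _ = undefined"

fun tm_tp :: "'g presentation \<Rightarrow> 'g tm \<Rightarrow> 'g tm" where
  "tm_tp P (Gen g) = ptp P g"
| "tm_tp P (IdV f) = f"
| "tm_tp P (IdH u) = HOne (tm_vsrc P u)"
| "tm_tp P (HPst a b) = HCmp (tm_tp P a) (tm_tp P b)"
| "tm_tp P (VPst a b) = tm_tp P a"
| "tm_tp P _ = undefined"

fun tm_bt :: "'g presentation \<Rightarrow> 'g tm \<Rightarrow> 'g tm" where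
  "tm_bt P (Gen g) = pbt P g"
| "tm_bt P (IdV f) = f"
| "tm_bt P (IdH u) = HOne (tm_vtgt P u)"
| "tm_bt P (HPst a b) = HCmp (tm_bt P a) (tm_bt P b)"
| "tm_bt P (VPst a b) = tm_bt P b"
| "tm_bt P _ = undefined"

fun tm_lf :: "'g presentation \<Rightarrow> 'g tm \<Rightarrow> 'g tm" where
  "tm_lf P (Gen g) = plf P g"
| "tm_lf P (IdV f) = VOne (tm_hsrc P f)"
| "tm_lf P (IdH u) = u"
| "tm_lf P (HPst a b) = tm_lf P a"
| "tm_lf P (VPst a b) = VCmp (tm_lf P a) (tm_lf P b)"
| "tm_lf P _ = undefined"

fun tm_rt :: "'g presentation \<Rightarrow> 'g tm \<Rightarrow> 'g tm" where
  "tm_rt P (Gen g) = prt P g"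
| "tm_rt P (IdV f) = VOne (tm_htgt P f)"
| "tm_rt P (IdH u) = u"
| "tm_rt P (HPst a b) = tm_rt P b"
| "tm_rt P (VPst a b) = VCmp (tm_rt P a) (tm_rt P b)"
| "tm_rt P _ = undefined"

text \<open>
  \<open>pcong P k s t\<close>: \<open>s\<close> and \<open>t\<close> are well-formed terms of kind \<open>k\<close> that are equal in the double
  category presented by \<open>P\<close>. It is a partial equivalence relation, and \<open>pcong P k t t\<close> says
  that \<open>t\<close> is a well-formed term of kind \<open>k\<close>. Composability is only required up to
  \<open>pcong\<close> on the cells of lower dimension.
\<close>

inductive pcong :: "'g presentation \<Rightarrow> kind \<Rightarrow> 'g tm \<Rightarrow> 'g tm \<Rightarrow> bool" for P where
  gen: "g \<in> pgen P k \<Longrightarrow> pcong P k (Gen g) (Gen g)"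
| rel: "prel P k s t \<Longrightarrow> pcong P k s s \<Longrightarrow> pcong P k t t \<Longrightarrow> pcong P k s t"
| sym: "pcong P k s t \<Longrightarrow> pcong P k t s"
| trans: "pcong P k s t \<Longrightarrow> pcong P k t r \<Longrightarrow> pcong P k s r"
| hone: "pcong P Ob x y \<Longrightarrow> pcong P Hor (HOne x) (HOne y)"
| vone: "pcong P Ob x y \<Longrightarrow> pcong P Ver (VOne x) (VOne y)"
| hcmp: "pcong P Hor f f' \<Longrightarrow> pcong P Hor g g' \<Longrightarrow> pcong P Ob (tm_htgt P f) (tm_hsrc P g)
    \<Longrightarrow> pcong P Hor (HCmp f g) (HCmp f' g')"
| vcmp: "pcong P Ver u u' \<Longrightarrow> pcong P Ver v v' \<Longrightarrow> pcong P Ob (tm_vtgt P u) (tm_vsrc P v)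
    \<Longrightarrow> pcong P Ver (VCmp u v) (VCmp u' v')"
| idh: "pcong P Ver u v \<Longrightarrow> pcong P Sq (IdH u) (IdH v)"
| idv: "pcong P Hor f g \<Longrightarrow> pcong P Sq (IdV f) (IdV g)"
| hpst: "pcong P Sq a a' \<Longrightarrow> pcong P Sq b b' \<Longrightarrow> pcong P Ver (tm_rt P a) (tm_lf P b)
    \<Longrightarrow> pcong P Sq (HPst a b) (HPst a' b')"
| vpst: "pcong P Sq a a' \<Longrightarrow> pcong P Sq b b' \<Longrightarrow> pcong P Hor (tm_bt P a) (tm_tp P b)
    \<Longrightarrow> pcong P Sq (VPst a b) (VPst a' b')"
| hcmp_unit_left: "pcong P Hor f f \<Longrightarrow> pcong P Hor (HCmp (HOne (tm_hsrc P f)) f) f"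
| hcmp_unit_right: "pcong P Hor f f \<Longrightarrow> pcong P Hor (HCmp f (HOne (tm_htgt P f))) f"
| hcmp_assoc: "pcong P Hor (HCmp (HCmp f g) h) (HCmp (HCmp f g) h)
    \<Longrightarrow> pcong P Hor (HCmp (HCmp f g) h) (HCmp f (HCmp g h))"
| vcmp_unit_left: "pcong P Ver u u \<Longrightarrow> pcong P Ver (VCmp (VOne (tm_vsrc P u)) u) u"
| vcmp_unit_right: "pcong P Ver u u \<Longrightarrow> pcong P Ver (VCmp u (VOne (tm_vtgt P u))) u"
| vcmp_assoc: "pcong P Ver (VCmp (VCmp u v) w) (VCmp (VCmp u v) w)
    \<Longrightarrow> pcong P Ver (VCmp (VCmp u v) w) (VCmp u (VCmp v w))"
| hpst_unit_left: "pcong P Sq a a \<Longrightarrow> pcong P Sq (HPst (IdH (tm_lf P a)) a) a"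
| hpst_unit_right: "pcong P Sq a a \<Longrightarrow> pcong P Sq (HPst a (IdH (tm_rt P a))) a"
| hpst_assoc: "pcong P Sq (HPst (HPst a b) c) (HPst (HPst a b) c)
    \<Longrightarrow> pcong P Sq (HPst (HPst a b) c) (HPst a (HPst b c))"
| vpst_unit_left: "pcong P Sq a a \<Longrightarrow> pcong P Sq (VPst (IdV (tm_tp P a)) a) a"
| vpst_unit_right: "pcong P Sq a a \<Longrightarrow> pcong P Sq (VPst a (IdV (tm_bt P a))) a"
| vpst_assoc: "pcong P Sq (VPst (VPst a b) c) (VPst (VPst a b) c)
    \<Longrightarrow> pcong P Sq (VPst (VPst a b) c) (VPst a (VPst b c))"
| id_one: "pcong P Ob x x \<Longrightarrow> pcong P Sq (IdH (VOne x)) (IdV (HOne x))"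
| idv_hcmp: "pcong P Hor (HCmp f g) (HCmp f g)
    \<Longrightarrow> pcong P Sq (IdV (HCmp f g)) (HPst (IdV f) (IdV g))"
| idh_vcmp: "pcong P Ver (VCmp u v) (VCmp u v)
    \<Longrightarrow> pcong P Sq (IdH (VCmp u v)) (VPst (IdH u) (IdH v))"
| interchange:
    "pcong P Sq (VPst (HPst a b) (HPst c d)) (VPst (HPst a b) (HPst c d))
    \<Longrightarrow> pcong P Sq (HPst (VPst a c) (VPst b d)) (HPst (VPst a c) (VPst b d))
    \<Longrightarrow> pcong P Sq (VPst (HPst a b) (HPst c d)) (HPst (VPst a c) (VPst b d))"

definition pclass :: "'g presentation \<Rightarrow> kind \<Rightarrow> 'g tm \<Rightarrow> 'g tm set" where
  "pclass P k t = {s. pcong P k t s}"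

definition rep :: "'g tm set \<Rightarrow> 'g tm" where
  "rep X = (SOME t. t \<in> X)"

definition presented :: "'g presentation \<Rightarrow> 'g tm set dblcat" where
  "presented P = \<lparr>
     cells = (\<lambda>k. {pclass P k t | t. pcong P k t t}),
     hsrc = (\<lambda>X. pclass P Ob (tm_hsrc P (rep X))),
     htgt = (\<lambda>X. pclass P Ob (tm_htgt P (rep X))),
     vsrc = (\<lambda>X. pclass P Ob (tm_vsrc P (rep X))),
     vtgt = (\<lambda>X. pclass P Ob (tm_vtgt P (rep X))),
     tp = (\<lambda>X. pclass P Hor (tm_tp P (rep X))),
     bt = (\<lambda>X. pclass P Hor (tm_bt P (rep X))),
     lf = (\<lambda>X. pclass P Ver (tm_lf P (rep X))),
     rt = (\<lambda>X. pclass P Ver (tm_rt P (rep X))),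
     hone = (\<lambda>X. pclass P Hor (HOne (rep X))),
     vone = (\<lambda>X. pclass P Ver (VOne (rep X))),
     hcmp = (\<lambda>X Y. pclass P Hor (HCmp (rep X) (rep Y))),
     vcmp = (\<lambda>X Y. pclass P Ver (VCmp (rep X) (rep Y))),
     idh = (\<lambda>X. pclass P Sq (IdH (rep X))),
     idv = (\<lambda>X. pclass P Sq (IdV (rep X))),
     hpst = (\<lambda>X Y. pclass P Sq (HPst (rep X) (rep Y))),
     vpst = (\<lambda>X Y. pclass P Sq (VPst (rep X) (rep Y)))\<rparr>"


section \<open>The tensor product of type (st, o-l)\<close>

fun dim :: "kind \<Rightarrow> nat" where
  "dim Ob = 0" | "dim Hor = 1" | "dim Ver = 1" | "dim Sq = 2"

fun join :: "kind \<Rightarrow> kind \<Rightarrow> kind" where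
  "join Ob k = k"
| "join k Ob = k"
| "join _ _ = Sq"

text \<open>
  \<open>TG k x l y\<close> is the generator \<open>x \<otimes> y\<close> for a cell \<open>x\<close> of kind \<open>k\<close> and a cell \<open>y\<close> of kind \<open>l\<close>
  with \<open>dim k + dim l \<le> 2\<close>; it is a cell of kind \<open>join k l\<close>.
\<close>

datatype ('a, 'b) tgen = TG kind 'a kind 'b

abbreviation tg :: "kind \<Rightarrow> 'a \<Rightarrow> kind \<Rightarrow> 'b \<Rightarrow> ('a, 'b) tgen tm" where
  "tg k x l y \<equiv> Gen (TG k x l y)"

fun t_hsrc :: "'a dblcat \<Rightarrow> 'b dblcat \<Rightarrow> ('a, 'b) tgen \<Rightarrow> ('a, 'b) tgen tm" where
  "t_hsrc A B (TG Hor K Ob b) = tg Ob (hsrc A K) Ob b"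
| "t_hsrc A B (TG Ob a Hor k) = tg Ob a Ob (hsrc B k)"
| "t_hsrc A B _ = undefined"

fun t_htgt :: "'a dblcat \<Rightarrow> 'b dblcat \<Rightarrow> ('a, 'b) tgen \<Rightarrow> ('a, 'b) tgen tm" where
  "t_htgt A B (TG Hor K Ob b) = tg Ob (htgt A K) Ob b"
| "t_htgt A B (TG Ob a Hor k) = tg Ob a Ob (htgt B k)"
| "t_htgt A B _ = undefined"

fun t_vsrc :: "'a dblcat \<Rightarrow> 'b dblcat \<Rightarrow> ('a, 'b) tgen \<Rightarrow> ('a, 'b) tgen tm" where
  "t_vsrc A B (TG Ver U Ob b) = tg Ob (vsrc A U) Ob b"
| "t_vsrc A B (TG Ob a Ver u) = tg Ob a Ob (vsrc B u)"
| "t_vsrc A B _ = undefined"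

fun t_vtgt :: "'a dblcat \<Rightarrow> 'b dblcat \<Rightarrow> ('a, 'b) tgen \<Rightarrow> ('a, 'b) tgen tm" where
  "t_vtgt A B (TG Ver U Ob b) = tg Ob (vtgt A U) Ob b"
| "t_vtgt A B (TG Ob a Ver u) = tg Ob a Ob (vtgt B u)"
| "t_vtgt A B _ = undefined"

fun t_tp :: "'a dblcat \<Rightarrow> 'b dblcat \<Rightarrow> ('a, 'b) tgen \<Rightarrow> ('a, 'b) tgen tm" where
  "t_tp A B (TG Sq x Ob b) = tg Hor (tp A x) Ob b"
| "t_tp A B (TG Ob a Sq y) = tg Ob a Hor (tp B y)"
| "t_tp A B (TG Hor K Hor k) = HCmp (tg Ob (hsrc A K) Hor k) (tg Hor K Ob (htgt B k))"
| "t_tp A B (TG Hor K Ver u) = tg Hor K Ob (vsrc B u)"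
| "t_tp A B (TG Ver U Hor k) = tg Ob (vsrc A U) Hor k"
| "t_tp A B (TG Ver U Ver u) = HOne (tg Ob (vsrc A U) Ob (vsrc B u))"
| "t_tp A B _ = undefined"

fun t_bt :: "'a dblcat \<Rightarrow> 'b dblcat \<Rightarrow> ('a, 'b) tgen \<Rightarrow> ('a, 'b) tgen tm" where
  "t_bt A B (TG Sq x Ob b) = tg Hor (bt A x) Ob b"
| "t_bt A B (TG Ob a Sq y) = tg Ob a Hor (bt B y)"
| "t_bt A B (TG Hor K Hor k) = HCmp (tg Hor K Ob (hsrc B k)) (tg Ob (htgt A K) Hor k)"
| "t_bt A B (TG Hor K Ver u) = tg Hor K Ob (vtgt B u)"
| "t_bt A B (TG Ver U Hor k) = tg Ob (vtgt A U) Hor k"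
| "t_bt A B (TG Ver U Ver u) = HOne (tg Ob (vtgt A U) Ob (vtgt B u))"
| "t_bt A B _ = undefined"

fun t_lf :: "'a dblcat \<Rightarrow> 'b dblcat \<Rightarrow> ('a, 'b) tgen \<Rightarrow> ('a, 'b) tgen tm" where
  "t_lf A B (TG Sq x Ob b) = tg Ver (lf A x) Ob b"
| "t_lf A B (TG Ob a Sq y) = tg Ob a Ver (lf B y)"
| "t_lf A B (TG Hor K Hor k) = VOne (tg Ob (hsrc A K) Ob (hsrc B k))"
| "t_lf A B (TG Hor K Ver u) = tg Ob (hsrc A K) Ver u"
| "t_lf A B (TG Ver U Hor k) = tg Ver U Ob (hsrc B k)"
| "t_lf A B (TG Ver U Ver u) = VCmp (tg Ver U Ob (vsrc B u)) (tg Ob (vtgt A U) Ver u)"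
| "t_lf A B _ = undefined"

fun t_rt :: "'a dblcat \<Rightarrow> 'b dblcat \<Rightarrow> ('a, 'b) tgen \<Rightarrow> ('a, 'b) tgen tm" where
  "t_rt A B (TG Sq x Ob b) = tg Ver (rt A x) Ob b"
| "t_rt A B (TG Ob a Sq y) = tg Ob a Ver (rt B y)"
| "t_rt A B (TG Hor K Hor k) = VOne (tg Ob (htgt A K) Ob (htgt B k))"
| "t_rt A B (TG Hor K Ver u) = tg Ob (htgt A K) Ver u"
| "t_rt A B (TG Ver U Hor k) = tg Ver U Ob (htgt B k)"
| "t_rt A B (TG Ver U Ver u) = VCmp (tg Ob (vsrc A U) Ver u) (tg Ver U Ob (vtgt B u))"
| "t_rt A B _ = undefined"

text \<open>
  The relations make \<open>\<otimes>\<close> a quasi-functor of type (st, o-l). In this order: \<open>a \<otimes> -\<close> and \<open>- \<otimes> b\<close> are strict double functors; \<open>K \<otimes> -\<close> is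
  a horizontal oplax transformation; \<open>U \<otimes> -\<close> is a vertical lax transformation; \<open>x \<otimes> -\<close> is a
  modification for every 2-cell \<open>x\<close>; and the assignments of \<open>K \<otimes> -\<close> to \<open>K\<close> and of \<open>U \<otimes> -\<close> to
  \<open>U\<close> preserve identities and composition (with respect to the compositions of transformations
  spelled out in \<open>htr_cmp\<close> and \<open>vtr_cmp\<close> below).
\<close>

inductive t_rel ::
  "'a dblcat \<Rightarrow> 'b dblcat \<Rightarrow> kind \<Rightarrow> ('a, 'b) tgen tm \<Rightarrow> ('a, 'b) tgen tm \<Rightarrow> bool" for A B where
  R_hcmp: "\<lbrakk>a \<in> cells A Ob; k \<in> cells B Hor; l \<in> cells B Hor; htgt B k = hsrc B l\<rbrakk> \<Longrightarrow>
    t_rel A B Hor (tg Ob a Hor (hcmp B k l)) (HCmp (tg Ob a Hor k) (tg Ob a Hor l))"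
| R_hone: "\<lbrakk>a \<in> cells A Ob; b \<in> cells B Ob\<rbrakk> \<Longrightarrow>
    t_rel A B Hor (tg Ob a Hor (hone B b)) (HOne (tg Ob a Ob b))"
| R_vcmp: "\<lbrakk>a \<in> cells A Ob; u \<in> cells B Ver; v \<in> cells B Ver; vtgt B u = vsrc B v\<rbrakk> \<Longrightarrow>
    t_rel A B Ver (tg Ob a Ver (vcmp B u v)) (VCmp (tg Ob a Ver u) (tg Ob a Ver v))"
| R_vone: "\<lbrakk>a \<in> cells A Ob; b \<in> cells B Ob\<rbrakk> \<Longrightarrow>
    t_rel A B Ver (tg Ob a Ver (vone B b)) (VOne (tg Ob a Ob b))"
| R_hpst: "\<lbrakk>a \<in> cells A Ob; y \<in> cells B Sq; z \<in> cells B Sq; rt B y = lf B z\<rbrakk> \<Longrightarrow>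
    t_rel A B Sq (tg Ob a Sq (hpst B y z)) (HPst (tg Ob a Sq y) (tg Ob a Sq z))"
| R_vpst: "\<lbrakk>a \<in> cells A Ob; y \<in> cells B Sq; z \<in> cells B Sq; bt B y = tp B z\<rbrakk> \<Longrightarrow>
    t_rel A B Sq (tg Ob a Sq (vpst B y z)) (VPst (tg Ob a Sq y) (tg Ob a Sq z))"
| R_idh: "\<lbrakk>a \<in> cells A Ob; u \<in> cells B Ver\<rbrakk> \<Longrightarrow>
    t_rel A B Sq (tg Ob a Sq (idh B u)) (IdH (tg Ob a Ver u))"
| R_idv: "\<lbrakk>a \<in> cells A Ob; k \<in> cells B Hor\<rbrakk> \<Longrightarrow>
    t_rel A B Sq (tg Ob a Sq (idv B k)) (IdV (tg Ob a Hor k))"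

| L_hcmp: "\<lbrakk>b \<in> cells B Ob; K \<in> cells A Hor; L \<in> cells A Hor; htgt A K = hsrc A L\<rbrakk> \<Longrightarrow>
    t_rel A B Hor (tg Hor (hcmp A K L) Ob b) (HCmp (tg Hor K Ob b) (tg Hor L Ob b))"
| L_hone: "\<lbrakk>a \<in> cells A Ob; b \<in> cells B Ob\<rbrakk> \<Longrightarrow>
    t_rel A B Hor (tg Hor (hone A a) Ob b) (HOne (tg Ob a Ob b))"
| L_vcmp: "\<lbrakk>b \<in> cells B Ob; U \<in> cells A Ver; V \<in> cells A Ver; vtgt A U = vsrc A V\<rbrakk> \<Longrightarrow>
    t_rel A B Ver (tg Ver (vcmp A U V) Ob b) (VCmp (tg Ver U Ob b) (tg Ver V Ob b))"
| L_vone: "\<lbrakk>a \<in> cells A Ob; b \<in> cells B Ob\<rbrakk> \<Longrightarrow>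
    t_rel A B Ver (tg Ver (vone A a) Ob b) (VOne (tg Ob a Ob b))"
| L_hpst: "\<lbrakk>b \<in> cells B Ob; x \<in> cells A Sq; z \<in> cells A Sq; rt A x = lf A z\<rbrakk> \<Longrightarrow>
    t_rel A B Sq (tg Sq (hpst A x z) Ob b) (HPst (tg Sq x Ob b) (tg Sq z Ob b))"
| L_vpst: "\<lbrakk>b \<in> cells B Ob; x \<in> cells A Sq; z \<in> cells A Sq; bt A x = tp A z\<rbrakk> \<Longrightarrow>
    t_rel A B Sq (tg Sq (vpst A x z) Ob b) (VPst (tg Sq x Ob b) (tg Sq z Ob b))"
| L_idh: "\<lbrakk>b \<in> cells B Ob; U \<in> cells A Ver\<rbrakk> \<Longrightarrow>
    t_rel A B Sq (tg Sq (idh A U) Ob b) (IdH (tg Ver U Ob b))"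
| L_idv: "\<lbrakk>b \<in> cells B Ob; K \<in> cells A Hor\<rbrakk> \<Longrightarrow>
    t_rel A B Sq (tg Sq (idv A K) Ob b) (IdV (tg Hor K Ob b))"

| HH_hcmp: "\<lbrakk>K \<in> cells A Hor; k \<in> cells B Hor; l \<in> cells B Hor; htgt B k = hsrc B l\<rbrakk> \<Longrightarrow>
    t_rel A B Sq (tg Hor K Hor (hcmp B k l))
      (VPst (HPst (IdV (tg Ob (hsrc A K) Hor k)) (tg Hor K Hor l))
            (HPst (tg Hor K Hor k) (IdV (tg Ob (htgt A K) Hor l))))"
| HH_hone: "\<lbrakk>K \<in> cells A Hor; b \<in> cells B Ob\<rbrakk> \<Longrightarrow>
    t_rel A B Sq (tg Hor K Hor (hone B b)) (IdV (tg Hor K Ob b))"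
| HV_vcmp: "\<lbrakk>K \<in> cells A Hor; u \<in> cells B Ver; v \<in> cells B Ver; vtgt B u = vsrc B v\<rbrakk> \<Longrightarrow>
    t_rel A B Sq (tg Hor K Ver (vcmp B u v)) (VPst (tg Hor K Ver u) (tg Hor K Ver v))"
| HV_vone: "\<lbrakk>K \<in> cells A Hor; b \<in> cells B Ob\<rbrakk> \<Longrightarrow>
    t_rel A B Sq (tg Hor K Ver (vone B b)) (IdV (tg Hor K Ob b))"
| H_natural: "\<lbrakk>K \<in> cells A Hor; y \<in> cells B Sq\<rbrakk> \<Longrightarrow>
    t_rel A B Sq
      (VPst (HPst (tg Ob (hsrc A K) Sq y) (tg Hor K Ver (rt B y))) (tg Hor K Hor (bt B y)))
      (VPst (tg Hor K Hor (tp B y)) (HPst (tg Hor K Ver (lf B y)) (tg Ob (htgt A K) Sq y)))"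

| VH_hcmp: "\<lbrakk>U \<in> cells A Ver; k \<in> cells B Hor; l \<in> cells B Hor; htgt B k = hsrc B l\<rbrakk> \<Longrightarrow>
    t_rel A B Sq (tg Ver U Hor (hcmp B k l)) (HPst (tg Ver U Hor k) (tg Ver U Hor l))"
| VH_hone: "\<lbrakk>U \<in> cells A Ver; b \<in> cells B Ob\<rbrakk> \<Longrightarrow>
    t_rel A B Sq (tg Ver U Hor (hone B b)) (IdH (tg Ver U Ob b))"
| VV_vcmp: "\<lbrakk>U \<in> cells A Ver; u \<in> cells B Ver; v \<in> cells B Ver; vtgt B u = vsrc B v\<rbrakk> \<Longrightarrow>
    t_rel A B Sq (tg Ver U Ver (vcmp B u v))
      (HPst (VPst (tg Ver U Ver u) (IdH (tg Ob (vtgt A U) Ver v)))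
            (VPst (IdH (tg Ob (vsrc A U) Ver u)) (tg Ver U Ver v)))"
| VV_vone: "\<lbrakk>U \<in> cells A Ver; b \<in> cells B Ob\<rbrakk> \<Longrightarrow>
    t_rel A B Sq (tg Ver U Ver (vone B b)) (IdH (tg Ver U Ob b))"
| V_natural: "\<lbrakk>U \<in> cells A Ver; y \<in> cells B Sq\<rbrakk> \<Longrightarrow>
    t_rel A B Sq
      (HPst (tg Ver U Ver (lf B y)) (VPst (tg Ob (vsrc A U) Sq y) (tg Ver U Hor (bt B y))))
      (HPst (VPst (tg Ver U Hor (tp B y)) (tg Ob (vtgt A U) Sq y)) (tg Ver U Ver (rt B y)))"

| modif_hor: "\<lbrakk>x \<in> cells A Sq; k \<in> cells B Hor\<rbrakk> \<Longrightarrow>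
    t_rel A B Sq
      (VPst (HPst (tg Ver (lf A x) Hor k) (tg Sq x Ob (htgt B k))) (tg Hor (bt A x) Hor k))
      (VPst (tg Hor (tp A x) Hor k) (HPst (tg Sq x Ob (hsrc B k)) (tg Ver (rt A x) Hor k)))"
| modif_ver: "\<lbrakk>x \<in> cells A Sq; u \<in> cells B Ver\<rbrakk> \<Longrightarrow>
    t_rel A B Sq
      (HPst (tg Ver (lf A x) Ver u) (VPst (tg Hor (tp A x) Ver u) (tg Sq x Ob (vtgt B u))))
      (HPst (VPst (tg Sq x Ob (vsrc B u)) (tg Hor (bt A x) Ver u)) (tg Ver (rt A x) Ver u))"

| hcmp_HH: "\<lbrakk>K \<in> cells A Hor; L \<in> cells A Hor; htgt A K = hsrc A L; k \<in> cells B Hor\<rbrakk> \<Longrightarrow>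
    t_rel A B Sq (tg Hor (hcmp A K L) Hor k)
      (VPst (HPst (tg Hor K Hor k) (IdV (tg Hor L Ob (htgt B k))))
            (HPst (IdV (tg Hor K Ob (hsrc B k))) (tg Hor L Hor k)))"
| hone_HH: "\<lbrakk>a \<in> cells A Ob; k \<in> cells B Hor\<rbrakk> \<Longrightarrow>
    t_rel A B Sq (tg Hor (hone A a) Hor k) (IdV (tg Ob a Hor k))"
| hcmp_HV: "\<lbrakk>K \<in> cells A Hor; L \<in> cells A Hor; htgt A K = hsrc A L; u \<in> cells B Ver\<rbrakk> \<Longrightarrow>
    t_rel A B Sq (tg Hor (hcmp A K L) Ver u) (HPst (tg Hor K Ver u) (tg Hor L Ver u))"
| hone_HV: "\<lbrakk>a \<in> cells A Ob; u \<in> cells B Ver\<rbrakk> \<Longrightarrow>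
    t_rel A B Sq (tg Hor (hone A a) Ver u) (IdH (tg Ob a Ver u))"
| vcmp_VH: "\<lbrakk>U \<in> cells A Ver; V \<in> cells A Ver; vtgt A U = vsrc A V; k \<in> cells B Hor\<rbrakk> \<Longrightarrow>
    t_rel A B Sq (tg Ver (vcmp A U V) Hor k) (VPst (tg Ver U Hor k) (tg Ver V Hor k))"
| vone_VH: "\<lbrakk>a \<in> cells A Ob; k \<in> cells B Hor\<rbrakk> \<Longrightarrow>
    t_rel A B Sq (tg Ver (vone A a) Hor k) (IdV (tg Ob a Hor k))"
| vcmp_VV: "\<lbrakk>U \<in> cells A Ver; V \<in> cells A Ver; vtgt A U = vsrc A V; u \<in> cells B Ver\<rbrakk> \<Longrightarrow>
    t_rel A B Sq (tg Ver (vcmp A U V) Ver u)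
      (HPst (VPst (IdH (tg Ver U Ob (vsrc B u))) (tg Ver V Ver u))
            (VPst (tg Ver U Ver u) (IdH (tg Ver V Ob (vtgt B u)))))"
| vone_VV: "\<lbrakk>a \<in> cells A Ob; u \<in> cells B Ver\<rbrakk> \<Longrightarrow>
    t_rel A B Sq (tg Ver (vone A a) Ver u) (IdH (tg Ob a Ver u))"

definition tensor_pres :: "'a dblcat \<Rightarrow> 'b dblcat \<Rightarrow> ('a, 'b) tgen presentation" where
  "tensor_pres A B = \<lparr>
     pgen = (\<lambda>m. {TG k x l y | k x l y.
       x \<in> cells A k \<and> y \<in> cells B l \<and> dim k + dim l \<le> 2 \<and> m = join k l}),
     phsrc = t_hsrc A B, phtgt = t_htgt A B, pvsrc = t_vsrc A B, pvtgt = t_vtgt A B,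
     ptp = t_tp A B, pbt = t_bt A B, plf = t_lf A B, prt = t_rt A B,
     prel = t_rel A B\<rparr>"

type_synonym ('a, 'b) tcell = "('a, 'b) tgen tm set"

definition tensor :: "'a dblcat \<Rightarrow> 'b dblcat \<Rightarrow> ('a, 'b) tcell dblcat"  (infixl "\<otimes>" 70) where
  "A \<otimes> B = presented (tensor_pres A B)"

text \<open>The cell \<open>x \<otimes> y\<close> of \<open>A \<otimes> B\<close>, for \<open>x\<close> of kind \<open>k\<close> and \<open>y\<close> of kind \<open>l\<close>.\<close>

definition tcell :: "'a dblcat \<Rightarrow> 'b dblcat \<Rightarrow> kind \<Rightarrow> 'a \<Rightarrow> kind \<Rightarrow> 'b \<Rightarrow> ('a, 'b) tcell" where
  "tcell A B k x l y = pclass (tensor_pres A B) (join k l) (tg k x l y)"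

text \<open>
  The action on double functors and the structure isomorphisms are the unique strict double
  functors with the evident values on generators.
\<close>

definition tensor_map ::
  "'a dblcat \<Rightarrow> 'a1 dblcat \<Rightarrow> 'b dblcat \<Rightarrow> 'b1 dblcat \<Rightarrow> ('a, 'a1) dblfun \<Rightarrow> ('b, 'b1) dblfun
    \<Rightarrow> (('a, 'b) tcell, ('a1, 'b1) tcell) dblfun" where
  "tensor_map A A' B B' F G = (THE H. H \<in> Dbl (A \<otimes> B) (A' \<otimes> B') \<and>
     (\<forall>k l. dim k + dim l \<le> 2 \<longrightarrow> (\<forall>x\<in>cells A k. \<forall>y\<in>cells B l.
        H (join k l) (tcell A B k x l y) = tcell A' B' k (F k x) l (G l y))))"

definition dbl_assoc ::
  "'a dblcat \<Rightarrow> 'b dblcat \<Rightarrow> 'c dblcat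
    \<Rightarrow> ((('a, 'b) tcell, 'c) tcell, ('a, ('b, 'c) tcell) tcell) dblfun" where
  "dbl_assoc A B C = (THE H. H \<in> Dbl (A \<otimes> B \<otimes> C) (A \<otimes> (B \<otimes> C)) \<and>
     (\<forall>k l m. dim k + dim l + dim m \<le> 2 \<longrightarrow>
        (\<forall>x\<in>cells A k. \<forall>y\<in>cells B l. \<forall>z\<in>cells C m.
          H (join (join k l) m) (tcell (A \<otimes> B) C (join k l) (tcell A B k x l y) m z)
          = tcell A (B \<otimes> C) k x (join l m) (tcell B C l y m z))))"

definition dbl_lunit :: "'a dblcat \<Rightarrow> ((unit, 'a) tcell, 'a) dblfun" where
  "dbl_lunit A = (THE H. H \<in> Dbl (unit_dbl \<otimes> A) A \<and>
     (\<forall>k. \<forall>x\<in>cells A k. H k (tcell unit_dbl A Ob () k x) = x))"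

definition dbl_runit :: "'a dblcat \<Rightarrow> (('a, unit) tcell, 'a) dblfun" where
  "dbl_runit A = (THE H. H \<in> Dbl (A \<otimes> unit_dbl) A \<and>
     (\<forall>k. \<forall>x\<in>cells A k. H k (tcell A unit_dbl k x Ob ()) = x))"


section \<open>The double category \<open>Dbl\<^sub>h\<^sub>o\<^sub>p(B, C)\<close>\<close>

text \<open>
  A transformation \<open>\<alpha>\<close> has a cell \<open>tmap \<alpha> k x\<close> of the codomain for each object (\<open>k = Ob\<close>), each
  1h-cell (\<open>k = Hor\<close>) and each 1v-cell (\<open>k = Ver\<close>) \<open>x\<close> of the domain. For a horizontal oplax
  transformation these are \<open>\<alpha>(x)\<close>, \<open>\<delta>\<^sub>\<alpha>\<^sub>,\<^sub>x\<close> and \<open>\<alpha>\<^sup>x\<close>; for a vertical lax transformation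
  \<open>\<alpha>\<^sub>0(x)\<close>, \<open>(\<alpha>\<^sub>0)\<^sub>x\<close> and \<open>\<alpha>\<^sub>0\<^sup>x\<close>. There is no component at 2-cells.
\<close>

record ('b, 'c) transf =
  tsrc :: "('b, 'c) dblfun"
  ttgt :: "('b, 'c) dblfun"
  tmap :: "kind \<Rightarrow> 'b \<Rightarrow> 'c"

record ('b, 'c) modif =
  mtp :: "('b, 'c) transf"
  mbt :: "('b, 'c) transf"
  mlf :: "('b, 'c) transf"
  mrt :: "('b, 'c) transf"
  mmap :: "'b \<Rightarrow> 'c"

definition tdom :: "'b dblcat \<Rightarrow> kind \<Rightarrow> 'b set" where
  "tdom B k = (if k = Sq then {} else cells B k)"

definition hoplax :: "'b dblcat \<Rightarrow> 'c dblcat \<Rightarrow> ('b, 'c) transf \<Rightarrow> bool" where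
  "hoplax B C \<alpha> \<longleftrightarrow> (let F = tsrc \<alpha>; G = ttgt \<alpha>; c = tmap \<alpha> Ob; d = tmap \<alpha> Hor; s = tmap \<alpha> Ver in
     F \<in> Dbl B C \<and> G \<in> Dbl B C \<and> (\<forall>k. tmap \<alpha> k \<in> extensional (tdom B k)) \<and>
     (\<forall>b\<in>cells B Ob. c b \<in> cells C Hor \<and> hsrc C (c b) = F Ob b \<and> htgt C (c b) = G Ob b) \<and>
     (\<forall>u\<in>cells B Ver. s u \<in> cells C Sq \<and>
        tp C (s u) = c (vsrc B u) \<and> bt C (s u) = c (vtgt B u) \<and>
        lf C (s u) = F Ver u \<and> rt C (s u) = G Ver u) \<and>
     (\<forall>f\<in>cells B Hor. d f \<in> cells C Sq \<and>
        tp C (d f) = hcmp C (F Hor f) (c (htgt B f)) \<and>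
        bt C (d f) = hcmp C (c (hsrc B f)) (G Hor f) \<and>
        lf C (d f) = vone C (F Ob (hsrc B f)) \<and> rt C (d f) = vone C (G Ob (htgt B f))) \<and>
     (\<forall>f\<in>cells B Hor. \<forall>g\<in>cells B Hor. htgt B f = hsrc B g \<longrightarrow>
        d (hcmp B f g) = vpst C (hpst C (idv C (F Hor f)) (d g)) (hpst C (d f) (idv C (G Hor g)))) \<and>
     (\<forall>b\<in>cells B Ob. d (hone B b) = idv C (c b)) \<and>
     (\<forall>u\<in>cells B Ver. \<forall>v\<in>cells B Ver. vtgt B u = vsrc B v \<longrightarrow>
        s (vcmp B u v) = vpst C (s u) (s v)) \<and>
     (\<forall>b\<in>cells B Ob. s (vone B b) = idv C (c b)) \<and>
     (\<forall>y\<in>cells B Sq.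
        vpst C (hpst C (F Sq y) (s (rt B y))) (d (bt B y))
        = vpst C (d (tp B y)) (hpst C (s (lf B y)) (G Sq y))))"

definition vlax :: "'b dblcat \<Rightarrow> 'c dblcat \<Rightarrow> ('b, 'c) transf \<Rightarrow> bool" where
  "vlax B C \<alpha> \<longleftrightarrow> (let F = tsrc \<alpha>; F' = ttgt \<alpha>; c = tmap \<alpha> Ob; t = tmap \<alpha> Hor; e = tmap \<alpha> Ver in
     F \<in> Dbl B C \<and> F' \<in> Dbl B C \<and> (\<forall>k. tmap \<alpha> k \<in> extensional (tdom B k)) \<and>
     (\<forall>b\<in>cells B Ob. c b \<in> cells C Ver \<and> vsrc C (c b) = F Ob b \<and> vtgt C (c b) = F' Ob b) \<and>
     (\<forall>f\<in>cells B Hor. t f \<in> cells C Sq \<and>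
        tp C (t f) = F Hor f \<and> bt C (t f) = F' Hor f \<and>
        lf C (t f) = c (hsrc B f) \<and> rt C (t f) = c (htgt B f)) \<and>
     (\<forall>u\<in>cells B Ver. e u \<in> cells C Sq \<and>
        tp C (e u) = hone C (F Ob (vsrc B u)) \<and> bt C (e u) = hone C (F' Ob (vtgt B u)) \<and>
        lf C (e u) = vcmp C (c (vsrc B u)) (F' Ver u) \<and>
        rt C (e u) = vcmp C (F Ver u) (c (vtgt B u))) \<and>
     (\<forall>f\<in>cells B Hor. \<forall>g\<in>cells B Hor. htgt B f = hsrc B g \<longrightarrow>
        t (hcmp B f g) = hpst C (t f) (t g)) \<and>
     (\<forall>b\<in>cells B Ob. t (hone B b) = idh C (c b)) \<and>
     (\<forall>u\<in>cells B Ver. \<forall>v\<in>cells B Ver. vtgt B u = vsrc B v \<longrightarrow>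
        e (vcmp B u v) = hpst C (vpst C (e u) (idh C (F' Ver v))) (vpst C (idh C (F Ver u)) (e v))) \<and>
     (\<forall>b\<in>cells B Ob. e (vone B b) = idh C (c b)) \<and>
     (\<forall>y\<in>cells B Sq.
        hpst C (e (lf B y)) (vpst C (F Sq y) (t (bt B y)))
        = hpst C (vpst C (t (tp B y)) (F' Sq y)) (e (rt B y))))"

definition modification :: "'b dblcat \<Rightarrow> 'c dblcat \<Rightarrow> ('b, 'c) modif \<Rightarrow> bool" where
  "modification B C \<Theta> \<longleftrightarrow>
    (let \<alpha> = mtp \<Theta>; \<beta> = mbt \<Theta>; \<alpha>0 = mlf \<Theta>; \<beta>0 = mrt \<Theta>; m = mmap \<Theta> in
     hoplax B C \<alpha> \<and> hoplax B C \<beta> \<and> vlax B C \<alpha>0 \<and> vlax B C \<beta>0 \<and>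
     tsrc \<alpha> = tsrc \<alpha>0 \<and> ttgt \<alpha> = tsrc \<beta>0 \<and> tsrc \<beta> = ttgt \<alpha>0 \<and> ttgt \<beta> = ttgt \<beta>0 \<and>
     m \<in> extensional (cells B Ob) \<and>
     (\<forall>b\<in>cells B Ob. m b \<in> cells C Sq \<and>
        tp C (m b) = tmap \<alpha> Ob b \<and> bt C (m b) = tmap \<beta> Ob b \<and>
        lf C (m b) = tmap \<alpha>0 Ob b \<and> rt C (m b) = tmap \<beta>0 Ob b) \<and>
     (\<forall>f\<in>cells B Hor.
        vpst C (hpst C (tmap \<alpha>0 Hor f) (m (htgt B f))) (tmap \<beta> Hor f)
        = vpst C (tmap \<alpha> Hor f) (hpst C (m (hsrc B f)) (tmap \<beta>0 Hor f))) \<and>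
     (\<forall>u\<in>cells B Ver.
        hpst C (tmap \<alpha>0 Ver u) (vpst C (tmap \<alpha> Ver u) (m (vtgt B u)))
        = hpst C (vpst C (m (vsrc B u)) (tmap \<beta> Ver u)) (tmap \<beta>0 Ver u)))"

definition htr_one :: "'b dblcat \<Rightarrow> 'c dblcat \<Rightarrow> ('b, 'c) dblfun \<Rightarrow> ('b, 'c) transf" where
  "htr_one B C F = \<lparr>tsrc = F, ttgt = F, tmap = (\<lambda>k. \<lambda>x\<in>tdom B k.
     (case k of Ob \<Rightarrow> hone C (F Ob x) | Hor \<Rightarrow> idv C (F Hor x) | Ver \<Rightarrow> idh C (F Ver x)))\<rparr>"

definition vtr_one :: "'b dblcat \<Rightarrow> 'c dblcat \<Rightarrow> ('b, 'c) dblfun \<Rightarrow> ('b, 'c) transf" where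
  "vtr_one B C F = \<lparr>tsrc = F, ttgt = F, tmap = (\<lambda>k. \<lambda>x\<in>tdom B k.
     (case k of Ob \<Rightarrow> vone C (F Ob x) | Hor \<Rightarrow> idv C (F Hor x) | Ver \<Rightarrow> idh C (F Ver x)))\<rparr>"

definition htr_cmp ::
  "'b dblcat \<Rightarrow> 'c dblcat \<Rightarrow> ('b, 'c) transf \<Rightarrow> ('b, 'c) transf \<Rightarrow> ('b, 'c) transf" where
  "htr_cmp B C \<alpha> \<beta> = \<lparr>tsrc = tsrc \<alpha>, ttgt = ttgt \<beta>, tmap = (\<lambda>k. \<lambda>x\<in>tdom B k.
     (case k of
        Ob \<Rightarrow> hcmp C (tmap \<alpha> Ob x) (tmap \<beta> Ob x)
      | Hor \<Rightarrow> vpst C (hpst C (tmap \<alpha> Hor x) (idv C (tmap \<beta> Ob (htgt B x))))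
                      (hpst C (idv C (tmap \<alpha> Ob (hsrc B x))) (tmap \<beta> Hor x))
      | Ver \<Rightarrow> hpst C (tmap \<alpha> Ver x) (tmap \<beta> Ver x)))\<rparr>"

definition vtr_cmp ::
  "'b dblcat \<Rightarrow> 'c dblcat \<Rightarrow> ('b, 'c) transf \<Rightarrow> ('b, 'c) transf \<Rightarrow> ('b, 'c) transf" where
  "vtr_cmp B C \<alpha> \<beta> = \<lparr>tsrc = tsrc \<alpha>, ttgt = ttgt \<beta>, tmap = (\<lambda>k. \<lambda>x\<in>tdom B k.
     (case k of
        Ob \<Rightarrow> vcmp C (tmap \<alpha> Ob x) (tmap \<beta> Ob x)
      | Hor \<Rightarrow> vpst C (tmap \<alpha> Hor x) (tmap \<beta> Hor x)
      | Ver \<Rightarrow> hpst C (vpst C (idh C (tmap \<alpha> Ob (vsrc B x))) (tmap \<beta> Ver x))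
                      (vpst C (tmap \<alpha> Ver x) (idh C (tmap \<beta> Ob (vtgt B x))))))\<rparr>"

datatype ('b, 'c) hopcell =
    FunC (the_fun: "('b, 'c) dblfun")
  | HTrC (the_htr: "('b, 'c) transf")
  | VTrC (the_vtr: "('b, 'c) transf")
  | ModC (the_mod: "('b, 'c) modif")

definition Dbl_hop :: "'b dblcat \<Rightarrow> 'c dblcat \<Rightarrow> ('b, 'c) hopcell dblcat" where
  "Dbl_hop B C = \<lparr>
     cells = (\<lambda>k. case k of
        Ob \<Rightarrow> FunC ` Dbl B C
      | Hor \<Rightarrow> HTrC ` {\<alpha>. hoplax B C \<alpha>}
      | Ver \<Rightarrow> VTrC ` {\<alpha>. vlax B C \<alpha>}
      | Sq \<Rightarrow> ModC ` {\<Theta>. modification B C \<Theta>}),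
     hsrc = (\<lambda>X. FunC (tsrc (the_htr X))),
     htgt = (\<lambda>X. FunC (ttgt (the_htr X))),
     vsrc = (\<lambda>X. FunC (tsrc (the_vtr X))),
     vtgt = (\<lambda>X. FunC (ttgt (the_vtr X))),
     tp = (\<lambda>X. HTrC (mtp (the_mod X))),
     bt = (\<lambda>X. HTrC (mbt (the_mod X))),
     lf = (\<lambda>X. VTrC (mlf (the_mod X))),
     rt = (\<lambda>X. VTrC (mrt (the_mod X))),
     hone = (\<lambda>X. HTrC (htr_one B C (the_fun X))),
     vone = (\<lambda>X. VTrC (vtr_one B C (the_fun X))),
     hcmp = (\<lambda>X Y. HTrC (htr_cmp B C (the_htr X) (the_htr Y))),
     vcmp = (\<lambda>X Y. VTrC (vtr_cmp B C (the_vtr X) (the_vtr Y))),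
     idh = (\<lambda>X. let \<alpha> = the_vtr X in ModC
        \<lparr>mtp = htr_one B C (tsrc \<alpha>), mbt = htr_one B C (ttgt \<alpha>), mlf = \<alpha>, mrt = \<alpha>,
         mmap = (\<lambda>b\<in>cells B Ob. idh C (tmap \<alpha> Ob b))\<rparr>),
     idv = (\<lambda>X. let \<alpha> = the_htr X in ModC
        \<lparr>mtp = \<alpha>, mbt = \<alpha>, mlf = vtr_one B C (tsrc \<alpha>), mrt = vtr_one B C (ttgt \<alpha>),
         mmap = (\<lambda>b\<in>cells B Ob. idv C (tmap \<alpha> Ob b))\<rparr>),
     hpst = (\<lambda>X Y. let \<Theta> = the_mod X; \<Psi> = the_mod Y in ModC
        \<lparr>mtp = htr_cmp B C (mtp \<Theta>) (mtp \<Psi>), mbt = htr_cmp B C (mbt \<Theta>) (mbt \<Psi>),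
         mlf = mlf \<Theta>, mrt = mrt \<Psi>,
         mmap = (\<lambda>b\<in>cells B Ob. hpst C (mmap \<Theta> b) (mmap \<Psi> b))\<rparr>),
     vpst = (\<lambda>X Y. let \<Theta> = the_mod X; \<Psi> = the_mod Y in ModC
        \<lparr>mtp = mtp \<Theta>, mbt = mbt \<Psi>,
         mlf = vtr_cmp B C (mlf \<Theta>) (mlf \<Psi>), mrt = vtr_cmp B C (mrt \<Theta>) (mrt \<Psi>),
         mmap = (\<lambda>b\<in>cells B Ob. vpst C (mmap \<Theta> b) (mmap \<Psi> b))\<rparr>)\<rparr>"

text \<open>
  Post-composition with a double functor \<open>Q : C \<rightarrow> C'\<close>. The kind \<open>m\<close> is \<open>Hor\<close> for horizontal and
  \<open>Ver\<close> for vertical transformations, so that \<open>join m k\<close> is the kind of the component at a cell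
  of kind \<open>k\<close>.
\<close>

definition transf_push ::
  "kind \<Rightarrow> 'b dblcat \<Rightarrow> ('c, 'c1) dblfun \<Rightarrow> ('b, 'c) transf \<Rightarrow> ('b, 'c1) transf" where
  "transf_push m B Q \<alpha> = \<lparr>tsrc = dbl_comp B Q (tsrc \<alpha>), ttgt = dbl_comp B Q (ttgt \<alpha>),
     tmap = (\<lambda>k. \<lambda>x\<in>tdom B k. Q (join m k) (tmap \<alpha> k x))\<rparr>"

definition Dbl_hop_map ::
  "'b dblcat \<Rightarrow> 'c dblcat \<Rightarrow> ('c, 'c1) dblfun \<Rightarrow> (('b, 'c) hopcell, ('b, 'c1) hopcell) dblfun" where
  "Dbl_hop_map B C Q = (\<lambda>k. \<lambda>X\<in>cells (Dbl_hop B C) k.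
     (case X of
        FunC F \<Rightarrow> FunC (dbl_comp B Q F)
      | HTrC \<alpha> \<Rightarrow> HTrC (transf_push Hor B Q \<alpha>)
      | VTrC \<alpha> \<Rightarrow> VTrC (transf_push Ver B Q \<alpha>)
      | ModC \<Theta> \<Rightarrow> ModC
          \<lparr>mtp = transf_push Hor B Q (mtp \<Theta>), mbt = transf_push Hor B Q (mbt \<Theta>),
           mlf = transf_push Ver B Q (mlf \<Theta>), mrt = transf_push Ver B Q (mrt \<Theta>),
           mmap = (\<lambda>b\<in>cells B Ob. Q Sq (mmap \<Theta> b))\<rparr>))"

text \<open>
  The right adjoint of \<open>B \<otimes> -\<close>. Reversing the vertical direction turns horizontal oplax into
  horizontal lax and vertical lax into vertical oplax transformations, so this is the double
  category of strict double functors, horizontal lax transformations, vertical oplax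
  transformations and modifications.
\<close>

definition Dbl_hlx :: "'b dblcat \<Rightarrow> 'c dblcat \<Rightarrow> ('b, 'c) hopcell dblcat" where
  "Dbl_hlx B C = vop (Dbl_hop (vop B) (vop C))"

definition Dbl_hlx_map ::
  "'b dblcat \<Rightarrow> 'c dblcat \<Rightarrow> ('c, 'c1) dblfun \<Rightarrow> (('b, 'c) hopcell, ('b, 'c1) hopcell) dblfun" where
  "Dbl_hlx_map B C Q = Dbl_hop_map (vop B) (vop C) Q"


section \<open>The adjunction bijections\<close>

text \<open>
  Here \<open>\<phi> k x l y\<close> is the value of a double functor at the generator pairing \<open>x\<close> of kind \<open>k\<close> from
  \<open>X\<close> with \<open>y\<close> of kind \<open>l\<close> from \<open>B\<close>; \<open>transpose\<close> collects these values, for fixed \<open>x\<close>, into a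
  double functor, a transformation or a modification.
\<close>

definition slice_fun ::
  "'b dblcat \<Rightarrow> (kind \<Rightarrow> 'x \<Rightarrow> kind \<Rightarrow> 'b \<Rightarrow> 'c) \<Rightarrow> 'x \<Rightarrow> ('b, 'c) dblfun" where
  "slice_fun B \<phi> x = (\<lambda>l. \<lambda>y\<in>cells B l. \<phi> Ob x l y)"

definition slice_htr ::
  "'x dblcat \<Rightarrow> 'b dblcat \<Rightarrow> (kind \<Rightarrow> 'x \<Rightarrow> kind \<Rightarrow> 'b \<Rightarrow> 'c) \<Rightarrow> 'x \<Rightarrow> ('b, 'c) transf" where
  "slice_htr X B \<phi> x = \<lparr>tsrc = slice_fun B \<phi> (hsrc X x), ttgt = slice_fun B \<phi> (htgt X x),
     tmap = (\<lambda>l. \<lambda>y\<in>tdom B l. \<phi> Hor x l y)\<rparr>"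

definition slice_vtr ::
  "'x dblcat \<Rightarrow> 'b dblcat \<Rightarrow> (kind \<Rightarrow> 'x \<Rightarrow> kind \<Rightarrow> 'b \<Rightarrow> 'c) \<Rightarrow> 'x \<Rightarrow> ('b, 'c) transf" where
  "slice_vtr X B \<phi> x = \<lparr>tsrc = slice_fun B \<phi> (vsrc X x), ttgt = slice_fun B \<phi> (vtgt X x),
     tmap = (\<lambda>l. \<lambda>y\<in>tdom B l. \<phi> Ver x l y)\<rparr>"

definition transpose ::
  "'x dblcat \<Rightarrow> 'b dblcat \<Rightarrow> (kind \<Rightarrow> 'x \<Rightarrow> kind \<Rightarrow> 'b \<Rightarrow> 'c) \<Rightarrow> ('x, ('b, 'c) hopcell) dblfun" where
  "transpose X B \<phi> = (\<lambda>k. \<lambda>x\<in>cells X k.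
     (case k of
        Ob \<Rightarrow> FunC (slice_fun B \<phi> x)
      | Hor \<Rightarrow> HTrC (slice_htr X B \<phi> x)
      | Ver \<Rightarrow> VTrC (slice_vtr X B \<phi> x)
      | Sq \<Rightarrow> ModC \<lparr>mtp = slice_htr X B \<phi> (tp X x), mbt = slice_htr X B \<phi> (bt X x),
                    mlf = slice_vtr X B \<phi> (lf X x), mrt = slice_vtr X B \<phi> (rt X x),
                    mmap = (\<lambda>b\<in>cells B Ob. \<phi> Sq x Ob b)\<rparr>))"

text \<open>
  \<open>hop_transpose A B\<close> sends \<open>A \<otimes> B \<rightarrow> C\<close> to \<open>A \<rightarrow> Dbl_hop B C\<close>, and \<open>hlx_transpose A B\<close> sends
  \<open>B \<otimes> A \<rightarrow> C\<close> to \<open>A \<rightarrow> Dbl_hlx B C\<close>.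
\<close>

definition hop_transpose ::
  "'a dblcat \<Rightarrow> 'b dblcat \<Rightarrow> (('a, 'b) tcell, 'c) dblfun \<Rightarrow> ('a, ('b, 'c) hopcell) dblfun" where
  "hop_transpose A B H = transpose A B (\<lambda>k x l y. H (join k l) (tcell A B k x l y))"

definition hlx_transpose ::
  "'a dblcat \<Rightarrow> 'b dblcat \<Rightarrow> (('b, 'a) tcell, 'c) dblfun \<Rightarrow> ('a, ('b, 'c) hopcell) dblfun" where
  "hlx_transpose A B H = transpose (vop A) (vop B) (\<lambda>k x l y. H (join l k) (tcell B A l y k x))"

end

theory Submission
  imports Defs
begin

text \<open>
  A strict double functor out of \<open>A \<otimes> B\<close> is the same as a model of its presentation, that is, a
  quasi-functor, and a quasi-functor is literally the same data as a strict double functor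
  \<open>A \<rightarrow> Dbl_hop B C\<close>; this is the first adjunction. Reversing the vertical direction and exchanging
  the two arguments sends quasi-functors to quasi-functors, which gives the second adjunction.
  For associativity, a quasi-functor on \<open>A\<close> and \<open>B \<otimes> C\<close> is sliced into a quasi-functor on \<open>A\<close> and \<open>B\<close>
  with values in \<open>Dbl_hop C X\<close>: the eight kinds of cubes \<open>x \<otimes> y \<otimes> z\<close> of 1-cells are the naturality
  axioms for \<open>x\<close> at the square \<open>y \<otimes> z\<close> on one side and the modification axioms for the square
  \<open>x \<otimes> y\<close> at \<open>z\<close> on the other. The inverse is the image of this construction under the vertical
  duality. All remaining equations hold because they hold on generators.
\<close>

section \<open>Rewriting in double categories\<close>

text \<open>The obstacle is that composability in a presentation is itself tested up to derivable
  equality, so the classes of terms have boundaries only once every relation between squares is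
  known to join parallel squares. For the tensor product the two boundaries of such a relation agree
  only modulo the relations between 1-cells. The presentation is therefore taken first without its
  relations between squares. The double category that it presents serves as a test object in which
  boundaries are computed, and the full presentation inherits the result, because derivable equality
  of objects and 1-cells never passes through squares.

  A quarter turn \<open>rot\<close> exchanges horizontal oplax with vertical lax transformations, so
  the calculations with composites are made for one of the two only.

  Coherence stays finite because the cells x \<otimes> y \<otimes> z of total dimension at most two
  generate a triple tensor product; cubes occur as equations and never as cells.\<close>

named_theorems dc

text \<open>The unit laws carry the premise \<open>x = src f\<close> or \<open>x = tgt f\<close>
  instead of the boundary itself, so that they also rewrite when the object of the unit is written
  in another form.\<close>

lemma category_onD:
  assumes "category_on X M src tgt one cmp"
  shows "f \<in> M \<Longrightarrow> src f \<in> X" "f \<in> M \<Longrightarrow> tgt f \<in> X"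
    "x \<in> X \<Longrightarrow> one x \<in> M" "x \<in> X \<Longrightarrow> src (one x) = x" "x \<in> X \<Longrightarrow> tgt (one x) = x"
    "\<lbrakk>f \<in> M; g \<in> M; tgt f = src g\<rbrakk> \<Longrightarrow> cmp f g \<in> M"
    "\<lbrakk>f \<in> M; g \<in> M; tgt f = src g\<rbrakk> \<Longrightarrow> src (cmp f g) = src f"
    "\<lbrakk>f \<in> M; g \<in> M; tgt f = src g\<rbrakk> \<Longrightarrow> tgt (cmp f g) = tgt g"
    "\<lbrakk>f \<in> M; x = src f\<rbrakk> \<Longrightarrow> cmp (one x) f = f" "\<lbrakk>f \<in> M; x = tgt f\<rbrakk> \<Longrightarrow> cmp f (one x) = f"
    "\<lbrakk>f \<in> M; g \<in> M; h \<in> M; tgt f = src g; tgt g = src h\<rbrakk> \<Longrightarrow> cmp (cmp f g) h = cmp f (cmp g h)"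
  using assms unfolding category_on_def by simp_all

lemma double_category_cats:
  assumes "double_category C"
  shows "category_on (cells C Ob) (cells C Hor) (hsrc C) (htgt C) (hone C) (hcmp C)"
    "category_on (cells C Ob) (cells C Ver) (vsrc C) (vtgt C) (vone C) (vcmp C)"
    "category_on (cells C Ver) (cells C Sq) (lf C) (rt C) (idh C) (hpst C)"
    "category_on (cells C Hor) (cells C Sq) (tp C) (bt C) (idv C) (vpst C)"
  using assms unfolding double_category_def by simp_all

lemmas dc_hor [dc] = category_onD[OF double_category_cats(1)]
lemmas dc_ver [dc] = category_onD[OF double_category_cats(2)]
lemmas dc_hpst [dc] = category_onD[OF double_category_cats(3)]
lemmas dc_vpst [dc] = category_onD[OF double_category_cats(4)]

lemma dc_corners [dc]:
  assumes "double_category C"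
  shows "a \<in> cells C Sq \<Longrightarrow> hsrc C (tp C a) = vsrc C (lf C a)"
    "a \<in> cells C Sq \<Longrightarrow> htgt C (tp C a) = vsrc C (rt C a)"
    "a \<in> cells C Sq \<Longrightarrow> hsrc C (bt C a) = vtgt C (lf C a)"
    "a \<in> cells C Sq \<Longrightarrow> htgt C (bt C a) = vtgt C (rt C a)"
    "u \<in> cells C Ver \<Longrightarrow> tp C (idh C u) = hone C (vsrc C u)"
    "u \<in> cells C Ver \<Longrightarrow> bt C (idh C u) = hone C (vtgt C u)"
    "f \<in> cells C Hor \<Longrightarrow> lf C (idv C f) = vone C (hsrc C f)"
    "f \<in> cells C Hor \<Longrightarrow> rt C (idv C f) = vone C (htgt C f)"
    "x \<in> cells C Ob \<Longrightarrow> idh C (vone C x) = idv C (hone C x)"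
    "\<lbrakk>a \<in> cells C Sq; b \<in> cells C Sq; rt C a = lf C b\<rbrakk> \<Longrightarrow> tp C (hpst C a b) = hcmp C (tp C a) (tp C b)"
    "\<lbrakk>a \<in> cells C Sq; b \<in> cells C Sq; rt C a = lf C b\<rbrakk> \<Longrightarrow> bt C (hpst C a b) = hcmp C (bt C a) (bt C b)"
    "\<lbrakk>a \<in> cells C Sq; b \<in> cells C Sq; bt C a = tp C b\<rbrakk> \<Longrightarrow> lf C (vpst C a b) = vcmp C (lf C a) (lf C b)"
    "\<lbrakk>a \<in> cells C Sq; b \<in> cells C Sq; bt C a = tp C b\<rbrakk> \<Longrightarrow> rt C (vpst C a b) = vcmp C (rt C a) (rt C b)"
    "\<lbrakk>f \<in> cells C Hor; g \<in> cells C Hor; htgt C f = hsrc C g\<rbrakk>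
      \<Longrightarrow> idv C (hcmp C f g) = hpst C (idv C f) (idv C g)"
    "\<lbrakk>u \<in> cells C Ver; v \<in> cells C Ver; vtgt C u = vsrc C v\<rbrakk>
      \<Longrightarrow> idh C (vcmp C u v) = vpst C (idh C u) (idh C v)"
  using assms unfolding double_category_def category_on_def by simp_all

text \<open>The corner equations rewrite horizontal into vertical endpoints, so composability of the
  vertical sides cannot be reached from \<open>bt C a = tp C b\<close> by rewriting. The form
  \<open>... = True\<close> lets the left-hand side bind both \<open>a\<close> and
  \<open>b\<close>.\<close>

lemma dc_vcmp_sq [dc]:
  assumes "double_category C" "a \<in> cells C Sq" "b \<in> cells C Sq" "bt C a = tp C b"
  shows "(vtgt C (lf C a) = vsrc C (lf C b)) = True" "(vtgt C (rt C a) = vsrc C (rt C b)) = True"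
  using dc_corners(1-4)[OF assms(1)] assms by metis+

text \<open>Rewriting turns \<open>idh C (vone C x)\<close> into \<open>idv C (hone C x)\<close>, so
  the unit laws of \<open>hpst\<close> are needed for this normal form too.\<close>

lemma dc_hpst_unit [dc]:
  assumes "double_category C" "x \<in> cells C Ob" "a \<in> cells C Sq"
  shows "lf C a = vone C x \<Longrightarrow> hpst C (idv C (hone C x)) a = a"
    "rt C a = vone C x \<Longrightarrow> hpst C a (idv C (hone C x)) = a"
  using dc_hpst(9)[OF assms(1,3), of "vone C x"] dc_hpst(10)[OF assms(1,3), of "vone C x"]
    dc_corners(9)[OF assms(1,2)] by auto

text \<open>Identities of composite 1-cells are rewritten into pastings of identities; these are the
  unit laws for the expanded form.\<close>

lemma dc_cmp_unit [dc]:
  assumes "double_category C" "a \<in> cells C Sq"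
  shows "\<lbrakk>f \<in> cells C Hor; g \<in> cells C Hor; htgt C f = hsrc C g; tp C a = hcmp C f g\<rbrakk> \<Longrightarrow>
      vpst C (hpst C (idv C f) (idv C g)) a = a"
    "\<lbrakk>f \<in> cells C Hor; g \<in> cells C Hor; htgt C f = hsrc C g; bt C a = hcmp C f g\<rbrakk> \<Longrightarrow>
      vpst C a (hpst C (idv C f) (idv C g)) = a"
    "\<lbrakk>u \<in> cells C Ver; v \<in> cells C Ver; vtgt C u = vsrc C v; lf C a = vcmp C u v\<rbrakk> \<Longrightarrow>
      hpst C (vpst C (idh C u) (idh C v)) a = a"
    "\<lbrakk>u \<in> cells C Ver; v \<in> cells C Ver; vtgt C u = vsrc C v; rt C a = vcmp C u v\<rbrakk> \<Longrightarrow>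
      hpst C a (vpst C (idh C u) (idh C v)) = a"
  using dc_vpst(9,10)[OF assms] dc_hpst(9,10)[OF assms] dc_corners(14,15)[OF assms(1)] by metis+

text \<open>Kept out of \<open>dc\<close>: neither side is a normal form that suits all later
  calculations.\<close>

lemma dc_interchange:
  assumes "double_category C"
    "a \<in> cells C Sq" "b \<in> cells C Sq" "c \<in> cells C Sq" "d \<in> cells C Sq"
    "rt C a = lf C b" "rt C c = lf C d" "bt C a = tp C c" "bt C b = tp C d"
  shows "vpst C (hpst C a b) (hpst C c d) = hpst C (vpst C a c) (vpst C b d)"
  using assms unfolding double_category_def by simp

section \<open>Strict double functors\<close>

lemma Dbl_cell: "F \<in> Dbl A B \<Longrightarrow> x \<in> cells A k \<Longrightarrow> F k x \<in> cells B k"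
  unfolding Dbl_def by auto

lemma Dbl_ext: "F \<in> Dbl A B \<Longrightarrow> F k \<in> extensional (cells A k)"
  unfolding Dbl_def by (auto simp: PiE_def)

lemma Dbl_simps:
  assumes "F \<in> Dbl A B"
  shows "f \<in> cells A Hor \<Longrightarrow> hsrc B (F Hor f) = F Ob (hsrc A f)"
    "f \<in> cells A Hor \<Longrightarrow> htgt B (F Hor f) = F Ob (htgt A f)"
    "u \<in> cells A Ver \<Longrightarrow> vsrc B (F Ver u) = F Ob (vsrc A u)"
    "u \<in> cells A Ver \<Longrightarrow> vtgt B (F Ver u) = F Ob (vtgt A u)"
    "a \<in> cells A Sq \<Longrightarrow> tp B (F Sq a) = F Hor (tp A a)"
    "a \<in> cells A Sq \<Longrightarrow> bt B (F Sq a) = F Hor (bt A a)"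
    "a \<in> cells A Sq \<Longrightarrow> lf B (F Sq a) = F Ver (lf A a)"
    "a \<in> cells A Sq \<Longrightarrow> rt B (F Sq a) = F Ver (rt A a)"
    "x \<in> cells A Ob \<Longrightarrow> F Hor (hone A x) = hone B (F Ob x)"
    "x \<in> cells A Ob \<Longrightarrow> F Ver (vone A x) = vone B (F Ob x)"
    "f \<in> cells A Hor \<Longrightarrow> F Sq (idv A f) = idv B (F Hor f)"
    "u \<in> cells A Ver \<Longrightarrow> F Sq (idh A u) = idh B (F Ver u)"
    "\<lbrakk>f \<in> cells A Hor; g \<in> cells A Hor; htgt A f = hsrc A g\<rbrakk>
      \<Longrightarrow> F Hor (hcmp A f g) = hcmp B (F Hor f) (F Hor g)"
    "\<lbrakk>u \<in> cells A Ver; v \<in> cells A Ver; vtgt A u = vsrc A v\<rbrakk>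
      \<Longrightarrow> F Ver (vcmp A u v) = vcmp B (F Ver u) (F Ver v)"
    "\<lbrakk>a \<in> cells A Sq; b \<in> cells A Sq; rt A a = lf A b\<rbrakk>
      \<Longrightarrow> F Sq (hpst A a b) = hpst B (F Sq a) (F Sq b)"
    "\<lbrakk>a \<in> cells A Sq; b \<in> cells A Sq; bt A a = tp A b\<rbrakk>
      \<Longrightarrow> F Sq (vpst A a b) = vpst B (F Sq a) (F Sq b)"
  using assms unfolding Dbl_def by simp_all

lemma DblI:
  assumes "\<And>k x. x \<in> cells A k \<Longrightarrow> F k x \<in> cells B k"
    "\<And>k. F k \<in> extensional (cells A k)"
    "\<And>f. f \<in> cells A Hor \<Longrightarrow> hsrc B (F Hor f) = F Ob (hsrc A f) \<and> htgt B (F Hor f) = F Ob (htgt A f)"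
    "\<And>u. u \<in> cells A Ver \<Longrightarrow> vsrc B (F Ver u) = F Ob (vsrc A u) \<and> vtgt B (F Ver u) = F Ob (vtgt A u)"
    "\<And>a. a \<in> cells A Sq \<Longrightarrow> tp B (F Sq a) = F Hor (tp A a) \<and> bt B (F Sq a) = F Hor (bt A a)"
    "\<And>a. a \<in> cells A Sq \<Longrightarrow> lf B (F Sq a) = F Ver (lf A a) \<and> rt B (F Sq a) = F Ver (rt A a)"
    "\<And>x. x \<in> cells A Ob \<Longrightarrow> F Hor (hone A x) = hone B (F Ob x) \<and> F Ver (vone A x) = vone B (F Ob x)"
    "\<And>f. f \<in> cells A Hor \<Longrightarrow> F Sq (idv A f) = idv B (F Hor f)"
    "\<And>u. u \<in> cells A Ver \<Longrightarrow> F Sq (idh A u) = idh B (F Ver u)"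
    "\<And>f g. \<lbrakk>f \<in> cells A Hor; g \<in> cells A Hor; htgt A f = hsrc A g\<rbrakk>
      \<Longrightarrow> F Hor (hcmp A f g) = hcmp B (F Hor f) (F Hor g)"
    "\<And>u v. \<lbrakk>u \<in> cells A Ver; v \<in> cells A Ver; vtgt A u = vsrc A v\<rbrakk>
      \<Longrightarrow> F Ver (vcmp A u v) = vcmp B (F Ver u) (F Ver v)"
    "\<And>a b. \<lbrakk>a \<in> cells A Sq; b \<in> cells A Sq; rt A a = lf A b\<rbrakk>
      \<Longrightarrow> F Sq (hpst A a b) = hpst B (F Sq a) (F Sq b)"
    "\<And>a b. \<lbrakk>a \<in> cells A Sq; b \<in> cells A Sq; bt A a = tp A b\<rbrakk>
      \<Longrightarrow> F Sq (vpst A a b) = vpst B (F Sq a) (F Sq b)"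
  shows "F \<in> Dbl A B"
  unfolding Dbl_def using assms by (simp add: PiE_def)

lemma Dbl_eqI:
  assumes "F \<in> Dbl A B" "G \<in> Dbl A B'" "\<And>k x. x \<in> cells A k \<Longrightarrow> F k x = G k x"
  shows "F = G"
  using extensionalityI[OF Dbl_ext[OF assms(1)] Dbl_ext[OF assms(2)]] assms(3) by blast

lemma dblfun_eqI:
  assumes "\<And>k. F k \<in> extensional (cells A k)" "\<And>k. G k \<in> extensional (cells A k)"
    "\<And>k x. x \<in> cells A k \<Longrightarrow> F k x = G k x"
  shows "F = G"
  using extensionalityI[OF assms(1,2)] assms(3) by blast

lemma dbl_id_app [simp]: "x \<in> cells A k \<Longrightarrow> dbl_id A k x = x"
  by (simp add: dbl_id_def)

lemma dbl_comp_app [simp]: "x \<in> cells A k \<Longrightarrow> dbl_comp A G F k x = G k (F k x)"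
  by (simp add: dbl_comp_def compose_def)

lemma dbl_comp_ext: "dbl_comp A G F k \<in> extensional (cells A k)"
  by (simp add: dbl_comp_def compose_def)

lemma Dbl_id [intro]: "double_category A \<Longrightarrow> dbl_id A \<in> Dbl A A"
  by (rule DblI) (simp_all add: dc, simp add: dbl_id_def)

lemma Dbl_comp:
  assumes "double_category A" "F \<in> Dbl A B" "G \<in> Dbl B C"
  shows "dbl_comp A G F \<in> Dbl A C"
  using assms(1) Dbl_cell[OF assms(2)] Dbl_cell[OF assms(3)]
  by (intro DblI) (simp_all add: dc Dbl_simps[OF assms(2)] Dbl_simps[OF assms(3)] dbl_comp_ext)

lemma dbl_comp_id:
  assumes "F \<in> Dbl A B"
  shows "dbl_comp A F (dbl_id A) = F" "dbl_comp A (dbl_id B) F = F"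
  using Dbl_cell[OF assms] by (auto intro!: dblfun_eqI[OF dbl_comp_ext Dbl_ext[OF assms]])

lemma dbl_comp_assoc:
  assumes "F \<in> Dbl A B"
  shows "dbl_comp A H (dbl_comp A G F) = dbl_comp A (dbl_comp B H G) F"
  using Dbl_cell[OF assms] by (auto intro!: dblfun_eqI[OF dbl_comp_ext dbl_comp_ext])

section \<open>Dualities\<close>

lemma vop_simps [simp]:
  "cells (vop C) = cells C" "hsrc (vop C) = hsrc C" "htgt (vop C) = htgt C"
  "vsrc (vop C) = vtgt C" "vtgt (vop C) = vsrc C" "tp (vop C) = bt C" "bt (vop C) = tp C"
  "lf (vop C) = lf C" "rt (vop C) = rt C" "hone (vop C) = hone C" "vone (vop C) = vone C"
  "hcmp (vop C) = hcmp C" "vcmp (vop C) u v = vcmp C v u" "idh (vop C) = idh C"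
  "idv (vop C) = idv C" "hpst (vop C) = hpst C" "vpst (vop C) a b = vpst C b a"
  by (simp_all add: vop_def)

lemma vop_vop [simp]: "vop (vop C) = C"
  by (simp add: vop_def)

lemma double_category_vop: "double_category C \<Longrightarrow> double_category (vop C)"
  unfolding double_category_def[of "vop C"] category_on_def vop_simps
  by (simp add: dc dc_interchange)

lemma double_category_vop_iff [simp]: "double_category (vop C) \<longleftrightarrow> double_category C"
  using double_category_vop[of C] double_category_vop[of "vop C"] by auto

lemma Dbl_vop_vop [simp]: "Dbl (vop A) (vop B) = Dbl A B"
  unfolding Dbl_def by auto

lemma Dbl_vop: "Dbl (vop A) B = Dbl A (vop B)"
  using Dbl_vop_vop[of A "vop B"] by simp

lemma dbl_comp_vop [simp]: "dbl_comp (vop A) = dbl_comp A"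
  by (simp add: dbl_comp_def fun_eq_iff)

lemma dbl_id_vop [simp]: "dbl_id (vop A) = dbl_id A"
  by (simp add: dbl_id_def fun_eq_iff)

lemma vop_unit [simp]: "vop unit_dbl = unit_dbl"
  by (simp add: vop_def unit_dbl_def)

fun krot :: "kind \<Rightarrow> kind" where
  "krot Ob = Ob" | "krot Hor = Ver" | "krot Ver = Hor" | "krot Sq = Sq"

lemma krot_krot [simp]: "krot (krot k) = k"
  by (cases k) simp_all

text \<open>The quarter turn that interchanges horizontal oplax and vertical lax transformations.\<close>

definition rot :: "'a dblcat \<Rightarrow> 'a dblcat" where
  "rot C = \<lparr>cells = (\<lambda>k. cells C (krot k)), hsrc = vsrc C, htgt = vtgt C, vsrc = htgt C, vtgt = hsrc C,
     tp = rt C, bt = lf C, lf = tp C, rt = bt C, hone = vone C, vone = hone C, hcmp = vcmp C,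
     vcmp = (\<lambda>u v. hcmp C v u), idh = idv C, idv = idh C, hpst = vpst C,
     vpst = (\<lambda>a b. hpst C b a)\<rparr>"

lemma rot_simps [simp]:
  "cells (rot C) k = cells C (krot k)" "hsrc (rot C) = vsrc C" "htgt (rot C) = vtgt C"
  "vsrc (rot C) = htgt C" "vtgt (rot C) = hsrc C" "tp (rot C) = rt C" "bt (rot C) = lf C"
  "lf (rot C) = tp C" "rt (rot C) = bt C" "hone (rot C) = vone C" "vone (rot C) = hone C"
  "hcmp (rot C) = vcmp C" "vcmp (rot C) u v = hcmp C v u" "idh (rot C) = idv C"
  "idv (rot C) = idh C" "hpst (rot C) = vpst C" "vpst (rot C) a b = hpst C b a"
  by (simp_all add: rot_def)

lemma double_category_rot: "double_category C \<Longrightarrow> double_category (rot C)"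
  unfolding double_category_def[of "rot C"] category_on_def rot_simps krot.simps
  by (simp add: dc dc_interchange)

definition frot :: "('a, 'b) dblfun \<Rightarrow> ('a, 'b) dblfun" where
  "frot F = (\<lambda>k. F (krot k))"

lemma frot_simps [simp]: "frot F k = F (krot k)" "frot (frot F) = F"
  by (simp_all add: frot_def)

lemma Dbl_rot: "F \<in> Dbl A B \<Longrightarrow> frot F \<in> Dbl (rot A) (rot B)"
  by (intro DblI) (auto simp: Dbl_simps intro: Dbl_cell Dbl_ext)

text \<open>Two quarter turns make a half turn and not the identity, so the converse of
  \<open>Dbl_rot\<close> is not an instance of it and is read off from the clauses.\<close>

lemma Dbl_rot_iff: "frot F \<in> Dbl (rot A) (rot B) \<longleftrightarrow> F \<in> Dbl A B"
proof
  assume *: "frot F \<in> Dbl (rot A) (rot B)"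
  note s = Dbl_simps[OF *, simplified]
  show "F \<in> Dbl A B"
  proof (intro DblI)
    show "F k x \<in> cells B k" if "x \<in> cells A k" for k x
      using Dbl_cell[OF *, of x "krot k"] that by simp
    show "F k \<in> extensional (cells A k)" for k
      using Dbl_ext[OF *, of "krot k"] by simp
  qed (use s in simp_all)
qed (rule Dbl_rot)

section \<open>Models of a presentation\<close>

text \<open>The kind is consulted only at a generator; every other constructor determines the kinds
  of its arguments.\<close>

fun teval :: "'c dblcat \<Rightarrow> (kind \<Rightarrow> 'g \<Rightarrow> 'c) \<Rightarrow> kind \<Rightarrow> 'g tm \<Rightarrow> 'c" where
  "teval C \<phi> k (Gen g) = \<phi> k g"
| "teval C \<phi> k (HOne x) = hone C (teval C \<phi> Ob x)"
| "teval C \<phi> k (VOne x) = vone C (teval C \<phi> Ob x)"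
| "teval C \<phi> k (HCmp f g) = hcmp C (teval C \<phi> Hor f) (teval C \<phi> Hor g)"
| "teval C \<phi> k (VCmp u v) = vcmp C (teval C \<phi> Ver u) (teval C \<phi> Ver v)"
| "teval C \<phi> k (IdH u) = idh C (teval C \<phi> Ver u)"
| "teval C \<phi> k (IdV f) = idv C (teval C \<phi> Hor f)"
| "teval C \<phi> k (HPst a b) = hpst C (teval C \<phi> Sq a) (teval C \<phi> Sq b)"
| "teval C \<phi> k (VPst a b) = vpst C (teval C \<phi> Sq a) (teval C \<phi> Sq b)"

text \<open>Composability is tested on the values in \<open>C\<close>.\<close>

fun twf :: "'g presentation \<Rightarrow> 'c dblcat \<Rightarrow> (kind \<Rightarrow> 'g \<Rightarrow> 'c) \<Rightarrow> kind \<Rightarrow> 'g tm \<Rightarrow> bool" where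
  "twf P C \<phi> k (Gen g) \<longleftrightarrow> g \<in> pgen P k"
| "twf P C \<phi> k (HOne x) \<longleftrightarrow> k = Hor \<and> twf P C \<phi> Ob x"
| "twf P C \<phi> k (VOne x) \<longleftrightarrow> k = Ver \<and> twf P C \<phi> Ob x"
| "twf P C \<phi> k (HCmp f g) \<longleftrightarrow> k = Hor \<and> twf P C \<phi> Hor f \<and> twf P C \<phi> Hor g \<and>
     htgt C (teval C \<phi> Hor f) = hsrc C (teval C \<phi> Hor g)"
| "twf P C \<phi> k (VCmp u v) \<longleftrightarrow> k = Ver \<and> twf P C \<phi> Ver u \<and> twf P C \<phi> Ver v \<and>
     vtgt C (teval C \<phi> Ver u) = vsrc C (teval C \<phi> Ver v)"
| "twf P C \<phi> k (IdH u) \<longleftrightarrow> k = Sq \<and> twf P C \<phi> Ver u"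
| "twf P C \<phi> k (IdV f) \<longleftrightarrow> k = Sq \<and> twf P C \<phi> Hor f"
| "twf P C \<phi> k (HPst a b) \<longleftrightarrow> k = Sq \<and> twf P C \<phi> Sq a \<and> twf P C \<phi> Sq b \<and>
     rt C (teval C \<phi> Sq a) = lf C (teval C \<phi> Sq b)"
| "twf P C \<phi> k (VPst a b) \<longleftrightarrow> k = Sq \<and> twf P C \<phi> Sq a \<and> twf P C \<phi> Sq b \<and>
     bt C (teval C \<phi> Sq a) = tp C (teval C \<phi> Sq b)"

definition gen_model :: "'g presentation \<Rightarrow> 'c dblcat \<Rightarrow> (kind \<Rightarrow> 'g \<Rightarrow> 'c) \<Rightarrow> bool" where
  "gen_model P C \<phi> \<longleftrightarrow>
     (\<forall>k. \<forall>g\<in>pgen P k. \<phi> k g \<in> cells C k) \<and>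
     (\<forall>g\<in>pgen P Hor.
        twf P C \<phi> Ob (phsrc P g) \<and> teval C \<phi> Ob (phsrc P g) = hsrc C (\<phi> Hor g) \<and>
        twf P C \<phi> Ob (phtgt P g) \<and> teval C \<phi> Ob (phtgt P g) = htgt C (\<phi> Hor g)) \<and>
     (\<forall>g\<in>pgen P Ver.
        twf P C \<phi> Ob (pvsrc P g) \<and> teval C \<phi> Ob (pvsrc P g) = vsrc C (\<phi> Ver g) \<and>
        twf P C \<phi> Ob (pvtgt P g) \<and> teval C \<phi> Ob (pvtgt P g) = vtgt C (\<phi> Ver g)) \<and>
     (\<forall>g\<in>pgen P Sq.
        twf P C \<phi> Hor (ptp P g) \<and> teval C \<phi> Hor (ptp P g) = tp C (\<phi> Sq g) \<and>
        twf P C \<phi> Hor (pbt P g) \<and> teval C \<phi> Hor (pbt P g) = bt C (\<phi> Sq g) \<and>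
        twf P C \<phi> Ver (plf P g) \<and> teval C \<phi> Ver (plf P g) = lf C (\<phi> Sq g) \<and>
        twf P C \<phi> Ver (prt P g) \<and> teval C \<phi> Ver (prt P g) = rt C (\<phi> Sq g))"

definition model :: "'g presentation \<Rightarrow> 'c dblcat \<Rightarrow> (kind \<Rightarrow> 'g \<Rightarrow> 'c) \<Rightarrow> bool" where
  "model P C \<phi> \<longleftrightarrow> gen_model P C \<phi> \<and>
     (\<forall>k s t. prel P k s t \<longrightarrow> teval C \<phi> k s = teval C \<phi> k t)"

text \<open>The invariant of the induction over terms. At a composite, membership, well-formedness
  of the boundary terms and the values of these terms depend on one another, hence a single
  conjunction.\<close>

definition twf_bd :: "'g presentation \<Rightarrow> 'c dblcat \<Rightarrow> (kind \<Rightarrow> 'g \<Rightarrow> 'c) \<Rightarrow> kind \<Rightarrow> 'g tm \<Rightarrow> bool" where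
  "twf_bd P C \<phi> k t \<longleftrightarrow> teval C \<phi> k t \<in> cells C k \<and>
     (k = Hor \<longrightarrow>
        twf P C \<phi> Ob (tm_hsrc P t) \<and> teval C \<phi> Ob (tm_hsrc P t) = hsrc C (teval C \<phi> Hor t) \<and>
        twf P C \<phi> Ob (tm_htgt P t) \<and> teval C \<phi> Ob (tm_htgt P t) = htgt C (teval C \<phi> Hor t)) \<and>
     (k = Ver \<longrightarrow>
        twf P C \<phi> Ob (tm_vsrc P t) \<and> teval C \<phi> Ob (tm_vsrc P t) = vsrc C (teval C \<phi> Ver t) \<and>
        twf P C \<phi> Ob (tm_vtgt P t) \<and> teval C \<phi> Ob (tm_vtgt P t) = vtgt C (teval C \<phi> Ver t)) \<and>
     (k = Sq \<longrightarrow>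
        twf P C \<phi> Hor (tm_tp P t) \<and> teval C \<phi> Hor (tm_tp P t) = tp C (teval C \<phi> Sq t) \<and>
        twf P C \<phi> Hor (tm_bt P t) \<and> teval C \<phi> Hor (tm_bt P t) = bt C (teval C \<phi> Sq t) \<and>
        twf P C \<phi> Ver (tm_lf P t) \<and> teval C \<phi> Ver (tm_lf P t) = lf C (teval C \<phi> Sq t) \<and>
        twf P C \<phi> Ver (tm_rt P t) \<and> teval C \<phi> Ver (tm_rt P t) = rt C (teval C \<phi> Sq t))"

lemma twf_bd:
  assumes "double_category C" "gen_model P C \<phi>" "twf P C \<phi> k t"
  shows "twf_bd P C \<phi> k t"
  using assms(3)
proof (induction t arbitrary: k)
  case (Gen g)
  then show ?case using assms(2) unfolding twf_bd_def gen_model_def by (cases k) auto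
next
  case (HOne x)
  then show ?case using HOne.IH[of Ob] assms(1) by (auto simp: twf_bd_def dc)
next
  case (VOne x)
  then show ?case using VOne.IH[of Ob] assms(1) by (auto simp: twf_bd_def dc)
next
  case (HCmp f g)
  then show ?case using HCmp.IH(1)[of Hor] HCmp.IH(2)[of Hor] assms(1) by (auto simp: twf_bd_def dc)
next
  case (VCmp u v)
  then show ?case using VCmp.IH(1)[of Ver] VCmp.IH(2)[of Ver] assms(1) by (auto simp: twf_bd_def dc)
next
  case (IdH u)
  then show ?case using IdH.IH[of Ver] assms(1) by (auto simp: twf_bd_def dc)
next
  case (IdV f)
  then show ?case using IdV.IH[of Hor] assms(1) by (auto simp: twf_bd_def dc)
next
  case (HPst a b)
  then show ?case using HPst.IH(1)[of Sq] HPst.IH(2)[of Sq] assms(1) by (auto simp: twf_bd_def dc)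
next
  case (VPst a b)
  then show ?case using VPst.IH(1)[of Sq] VPst.IH(2)[of Sq] assms(1) by (auto simp: twf_bd_def dc)
qed

lemma teval_cell:
  assumes "double_category C" "gen_model P C \<phi>" "twf P C \<phi> k t"
  shows "teval C \<phi> k t \<in> cells C k"
  using twf_bd[OF assms] by (simp add: twf_bd_def)

lemma teval_bd:
  assumes "double_category C" "gen_model P C \<phi>"
  shows "twf P C \<phi> Hor t \<Longrightarrow> teval C \<phi> Ob (tm_hsrc P t) = hsrc C (teval C \<phi> Hor t)"
    "twf P C \<phi> Hor t \<Longrightarrow> teval C \<phi> Ob (tm_htgt P t) = htgt C (teval C \<phi> Hor t)"
    "twf P C \<phi> Ver t \<Longrightarrow> teval C \<phi> Ob (tm_vsrc P t) = vsrc C (teval C \<phi> Ver t)"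
    "twf P C \<phi> Ver t \<Longrightarrow> teval C \<phi> Ob (tm_vtgt P t) = vtgt C (teval C \<phi> Ver t)"
    "twf P C \<phi> Sq t \<Longrightarrow> teval C \<phi> Hor (tm_tp P t) = tp C (teval C \<phi> Sq t)"
    "twf P C \<phi> Sq t \<Longrightarrow> teval C \<phi> Hor (tm_bt P t) = bt C (teval C \<phi> Sq t)"
    "twf P C \<phi> Sq t \<Longrightarrow> teval C \<phi> Ver (tm_lf P t) = lf C (teval C \<phi> Sq t)"
    "twf P C \<phi> Sq t \<Longrightarrow> teval C \<phi> Ver (tm_rt P t) = rt C (teval C \<phi> Sq t)"
  using twf_bd[OF assms] by (auto simp: twf_bd_def)

lemma twf_tm_bd:
  assumes "double_category C" "gen_model P C \<phi>"
  shows "twf P C \<phi> Hor t \<Longrightarrow> twf P C \<phi> Ob (tm_hsrc P t)"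
    "twf P C \<phi> Hor t \<Longrightarrow> twf P C \<phi> Ob (tm_htgt P t)"
    "twf P C \<phi> Ver t \<Longrightarrow> twf P C \<phi> Ob (tm_vsrc P t)"
    "twf P C \<phi> Ver t \<Longrightarrow> twf P C \<phi> Ob (tm_vtgt P t)"
    "twf P C \<phi> Sq t \<Longrightarrow> twf P C \<phi> Hor (tm_tp P t)"
    "twf P C \<phi> Sq t \<Longrightarrow> twf P C \<phi> Hor (tm_bt P t)"
    "twf P C \<phi> Sq t \<Longrightarrow> twf P C \<phi> Ver (tm_lf P t)"
    "twf P C \<phi> Sq t \<Longrightarrow> twf P C \<phi> Ver (tm_rt P t)"
  using twf_bd[OF assms] by (auto simp: twf_bd_def)

text \<open>No compatibility of the presentation with boundaries is assumed: since
  \<open>twf\<close> tests composability on values in \<open>C\<close>, congruent boundary terms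
  simply become equal cells.\<close>

lemma pcong_sound:
  assumes C: "double_category C" and M: "model P C \<phi>" and "pcong P k s t"
  shows "twf P C \<phi> k s \<and> twf P C \<phi> k t \<and> teval C \<phi> k s = teval C \<phi> k t"
  using assms(3)
proof induction
  have G: "gen_model P C \<phi>" using M by (simp add: model_def)
  note [simp] = teval_bd[OF C G] teval_cell[OF C G] twf_tm_bd[OF C G] dc[OF C]
  case (interchange a b c d)
  then show ?case by (auto intro!: dc_interchange[OF C])
next
  case (rel k s t)
  then show ?case using M by (simp add: model_def)
qed (use M in \<open>auto simp: model_def teval_bd[OF C] teval_cell[OF C] twf_tm_bd[OF C] dc[OF C]\<close>)

lemma gen_model_comp:
  assumes "gen_model P Y \<psi>" "double_category Y" "H \<in> Dbl Y C"
  shows "twf P Y \<psi> k t \<Longrightarrow>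
      twf P C (\<lambda>k g. H k (\<psi> k g)) k t \<and> teval C (\<lambda>k g. H k (\<psi> k g)) k t = H k (teval Y \<psi> k t)"
    "gen_model P C (\<lambda>k g. H k (\<psi> k g))"
proof -
  show *: "twf P C (\<lambda>k g. H k (\<psi> k g)) k t \<and> teval C (\<lambda>k g. H k (\<psi> k g)) k t = H k (teval Y \<psi> k t)"
    if "twf P Y \<psi> k t" for k t
    using that
    by (induction t arbitrary: k)
      (auto simp: Dbl_simps[OF assms(3)] teval_cell[OF assms(2,1)])
  show "gen_model P C (\<lambda>k g. H k (\<psi> k g))"
    using assms(1) * Dbl_cell[OF assms(3)] unfolding gen_model_def
    by (auto simp: Dbl_simps[OF assms(3)])
qed

section \<open>The double category presented by generators and relations\<close>

text \<open>A well-formedness predicate by recursion over the term. The condition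
  \<open>pcong P k t t\<close> cannot be inverted directly, because its derivation may pass through
  other terms by transitivity; \<open>pcong_iff_swf\<close> shows that the two agree.\<close>

fun swf :: "'g presentation \<Rightarrow> kind \<Rightarrow> 'g tm \<Rightarrow> bool" where
  "swf P k (Gen g) \<longleftrightarrow> g \<in> pgen P k"
| "swf P k (HOne x) \<longleftrightarrow> k = Hor \<and> swf P Ob x"
| "swf P k (VOne x) \<longleftrightarrow> k = Ver \<and> swf P Ob x"
| "swf P k (HCmp f g) \<longleftrightarrow> k = Hor \<and> swf P Hor f \<and> swf P Hor g \<and> pcong P Ob (tm_htgt P f) (tm_hsrc P g)"
| "swf P k (VCmp u v) \<longleftrightarrow> k = Ver \<and> swf P Ver u \<and> swf P Ver v \<and> pcong P Ob (tm_vtgt P u) (tm_vsrc P v)"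
| "swf P k (IdH u) \<longleftrightarrow> k = Sq \<and> swf P Ver u"
| "swf P k (IdV f) \<longleftrightarrow> k = Sq \<and> swf P Hor f"
| "swf P k (HPst a b) \<longleftrightarrow> k = Sq \<and> swf P Sq a \<and> swf P Sq b \<and> pcong P Ver (tm_rt P a) (tm_lf P b)"
| "swf P k (VPst a b) \<longleftrightarrow> k = Sq \<and> swf P Sq a \<and> swf P Sq b \<and> pcong P Hor (tm_bt P a) (tm_tp P b)"

lemmas pcong_rules = pcong.hone pcong.vone pcong.hcmp pcong.vcmp pcong.idh pcong.idv pcong.hpst
  pcong.vpst pcong.hcmp_unit_left pcong.hcmp_unit_right pcong.hcmp_assoc pcong.vcmp_unit_left
  pcong.vcmp_unit_right pcong.vcmp_assoc pcong.hpst_unit_left pcong.hpst_unit_right pcong.hpst_assoc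
  pcong.vpst_unit_left pcong.vpst_unit_right pcong.vpst_assoc pcong.id_one pcong.idv_hcmp
  pcong.idh_vcmp pcong.interchange

lemma swf_pcong: "swf P k t \<Longrightarrow> pcong P k t t"
  by (induction t arbitrary: k) (auto intro: pcong.intros)

lemma pcong_refl1: "pcong P k s t \<Longrightarrow> pcong P k s s"
  and pcong_refl2: "pcong P k s t \<Longrightarrow> pcong P k t t"
  by (blast intro: pcong.sym pcong.trans)+

definition corners :: "'g presentation \<Rightarrow> 'g tm \<Rightarrow> 'g tm \<Rightarrow> 'g tm \<Rightarrow> 'g tm \<Rightarrow> bool" where
  "corners P t b l r \<longleftrightarrow>
     pcong P Ob (tm_hsrc P t) (tm_vsrc P l) \<and> pcong P Ob (tm_htgt P t) (tm_vsrc P r) \<and>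
     pcong P Ob (tm_hsrc P b) (tm_vtgt P l) \<and> pcong P Ob (tm_htgt P b) (tm_vtgt P r)"

text \<open>This is what makes the boundary maps descend to congruence classes: generators have
  well-formed boundaries with matching corners, and relations join parallel terms.\<close>

definition pres_ok :: "'g presentation \<Rightarrow> bool" where
  "pres_ok P \<longleftrightarrow>
     (\<forall>g\<in>pgen P Hor. swf P Ob (phsrc P g) \<and> swf P Ob (phtgt P g)) \<and>
     (\<forall>g\<in>pgen P Ver. swf P Ob (pvsrc P g) \<and> swf P Ob (pvtgt P g)) \<and>
     (\<forall>g\<in>pgen P Sq. swf P Hor (ptp P g) \<and> swf P Hor (pbt P g) \<and>
        swf P Ver (plf P g) \<and> swf P Ver (prt P g) \<and> corners P (ptp P g) (pbt P g) (plf P g) (prt P g)) \<and>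
     (\<forall>s t. prel P Hor s t \<longrightarrow>
        pcong P Ob (tm_hsrc P s) (tm_hsrc P t) \<and> pcong P Ob (tm_htgt P s) (tm_htgt P t)) \<and>
     (\<forall>s t. prel P Ver s t \<longrightarrow>
        pcong P Ob (tm_vsrc P s) (tm_vsrc P t) \<and> pcong P Ob (tm_vtgt P s) (tm_vtgt P t)) \<and>
     (\<forall>s t. prel P Sq s t \<longrightarrow> pcong P Sq s s \<longrightarrow> pcong P Sq t t \<longrightarrow>
        pcong P Hor (tm_tp P s) (tm_tp P t) \<and> pcong P Hor (tm_bt P s) (tm_bt P t) \<and>
        pcong P Ver (tm_lf P s) (tm_lf P t) \<and> pcong P Ver (tm_rt P s) (tm_rt P t))"

context
  fixes P :: "'g presentation"
  assumes ok: "pres_ok P"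
begin

text \<open>Boundaries are treated by dimension. The sides of a composite square are composites of
  1-cells, so the square case in \<open>pcong_bd2\<close> needs the endpoints of 1-cells to be
  settled.\<close>

lemma pcong_bd1:
  "pcong P k s t \<Longrightarrow>
    (k = Hor \<longrightarrow> pcong P Ob (tm_hsrc P s) (tm_hsrc P t) \<and> pcong P Ob (tm_htgt P s) (tm_htgt P t)) \<and>
    (k = Ver \<longrightarrow> pcong P Ob (tm_vsrc P s) (tm_vsrc P t) \<and> pcong P Ob (tm_vtgt P s) (tm_vtgt P t))"
proof (induction rule: pcong.induct)
  case (gen g k)
  then show ?case using ok unfolding pres_ok_def by (auto intro: swf_pcong)
next
  case (rel k s t)
  then show ?case using ok unfolding pres_ok_def by auto
next
  case (trans k s t r)
  then show ?case by (blast intro: pcong.trans)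
qed (auto intro: pcong.sym)

lemma pcong_hor_bd:
  "pcong P Hor s t \<Longrightarrow> pcong P Ob (tm_hsrc P s) (tm_hsrc P t)"
  "pcong P Hor s t \<Longrightarrow> pcong P Ob (tm_htgt P s) (tm_htgt P t)"
  "pcong P Ver s t \<Longrightarrow> pcong P Ob (tm_vsrc P s) (tm_vsrc P t)"
  "pcong P Ver s t \<Longrightarrow> pcong P Ob (tm_vtgt P s) (tm_vtgt P t)"
  using pcong_bd1 by blast+

definition sqbd :: "'g tm \<Rightarrow> 'g tm \<Rightarrow> bool" where
  "sqbd s t \<longleftrightarrow>
     pcong P Hor (tm_tp P s) (tm_tp P t) \<and> pcong P Hor (tm_bt P s) (tm_bt P t) \<and>
     pcong P Ver (tm_lf P s) (tm_lf P t) \<and> pcong P Ver (tm_rt P s) (tm_rt P t)"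

abbreviation cor :: "'g tm \<Rightarrow> bool" where
  "cor s \<equiv> corners P (tm_tp P s) (tm_bt P s) (tm_lf P s) (tm_rt P s)"

text \<open>Two squares that share a vertical side have composable tops and bottoms, because the
  corners of each square meet and the shared sides have congruent endpoints.\<close>

lemma hcmp_sq:
  assumes "cor a" "cor b" "pcong P Ver (tm_rt P a) (tm_lf P b)"
  shows "pcong P Ob (tm_htgt P (tm_tp P a)) (tm_hsrc P (tm_tp P b))"
    "pcong P Ob (tm_htgt P (tm_bt P a)) (tm_hsrc P (tm_bt P b))"
  using assms pcong_hor_bd(3,4)[OF assms(3)] unfolding corners_def
  by (meson pcong.sym pcong.trans)+

lemma vcmp_sq:
  assumes "cor a" "cor b" "pcong P Hor (tm_bt P a) (tm_tp P b)"
  shows "pcong P Ob (tm_vtgt P (tm_lf P a)) (tm_vsrc P (tm_lf P b))"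
    "pcong P Ob (tm_vtgt P (tm_rt P a)) (tm_vsrc P (tm_rt P b))"
  using assms pcong_hor_bd(1,2)[OF assms(3)] unfolding corners_def
  by (meson pcong.sym pcong.trans)+

text \<open>The unit sits at an object that is merely congruent to the source. This occurs in the
  top of \<open>HPst (IdH l) a\<close>, where the unit is taken at the source of the side
  \<open>l\<close> and not at that of the top of \<open>a\<close>.\<close>

lemma unit_left_h:
  assumes "pcong P Hor f f" "pcong P Ob (tm_hsrc P f) x"
  shows "pcong P Hor (HCmp (HOne x) f) f" "pcong P Hor f (HCmp (HOne x) f)"
proof -
  have "pcong P Hor (HCmp (HOne (tm_hsrc P f)) f) (HCmp (HOne x) f)"
    using assms by (intro pcong.hcmp pcong.hone) (auto intro: pcong_refl1)
  then show "pcong P Hor (HCmp (HOne x) f) f"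
    using assms by (meson pcong.hcmp_unit_left pcong.sym pcong.trans)
  then show "pcong P Hor f (HCmp (HOne x) f)" by (rule pcong.sym)
qed

lemma unit_right_h:
  assumes "pcong P Hor f f" "pcong P Ob (tm_htgt P f) x"
  shows "pcong P Hor (HCmp f (HOne x)) f" "pcong P Hor f (HCmp f (HOne x))"
proof -
  have "pcong P Hor (HCmp f (HOne (tm_htgt P f))) (HCmp f (HOne x))"
    using assms by (intro pcong.hcmp pcong.hone) (auto intro: pcong_refl1)
  then show "pcong P Hor (HCmp f (HOne x)) f"
    using assms by (meson pcong.hcmp_unit_right pcong.sym pcong.trans)
  then show "pcong P Hor f (HCmp f (HOne x))" by (rule pcong.sym)
qed

lemma unit_left_v:
  assumes "pcong P Ver f f" "pcong P Ob (tm_vsrc P f) x"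
  shows "pcong P Ver (VCmp (VOne x) f) f" "pcong P Ver f (VCmp (VOne x) f)"
proof -
  have "pcong P Ver (VCmp (VOne (tm_vsrc P f)) f) (VCmp (VOne x) f)"
    using assms by (intro pcong.vcmp pcong.vone) (auto intro: pcong_refl1)
  then show "pcong P Ver (VCmp (VOne x) f) f"
    using assms by (meson pcong.vcmp_unit_left pcong.sym pcong.trans)
  then show "pcong P Ver f (VCmp (VOne x) f)" by (rule pcong.sym)
qed

lemma unit_right_v:
  assumes "pcong P Ver f f" "pcong P Ob (tm_vtgt P f) x"
  shows "pcong P Ver (VCmp f (VOne x)) f" "pcong P Ver f (VCmp f (VOne x))"
proof -
  have "pcong P Ver (VCmp f (VOne (tm_vtgt P f))) (VCmp f (VOne x))"
    using assms by (intro pcong.vcmp pcong.vone) (auto intro: pcong_refl1)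
  then show "pcong P Ver (VCmp f (VOne x)) f"
    using assms by (meson pcong.vcmp_unit_right pcong.sym pcong.trans)
  then show "pcong P Ver f (VCmp f (VOne x))" by (rule pcong.sym)
qed

text \<open>The corners take part in the induction: without them the sides of a pasted square could
  not be shown to be composable.\<close>

lemma pcong_bd2: "pcong P k s t \<Longrightarrow> k = Sq \<Longrightarrow> sqbd s t \<and> cor s \<and> cor t"
proof (induction rule: pcong.induct)
  case (gen g k)
  then show ?case using ok unfolding pres_ok_def sqbd_def by (auto intro: swf_pcong)
next
  case (rel k s t)
  then show ?case using ok unfolding pres_ok_def sqbd_def by simp
next
  case (sym k s t)
  then show ?case by (auto simp: sqbd_def intro: pcong.sym)
next
  case (trans k s t r)
  then show ?case by (auto simp: sqbd_def intro: pcong.trans)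
next
  case (idh u v)
  then show ?case using pcong_hor_bd(3,4)[OF idh.hyps]
    by (auto simp: sqbd_def corners_def intro: pcong.hone pcong_refl1 pcong_refl2)
next
  case (idv u v)
  then show ?case using pcong_hor_bd(1,2)[OF idv.hyps]
    by (auto simp: sqbd_def corners_def intro: pcong.vone pcong_refl1 pcong_refl2)
next
  case (hpst a a' b b')
  then show ?case using hcmp_sq[of a b]
    by (auto simp: sqbd_def corners_def intro: pcong.hcmp)
next
  case (vpst a a' b b')
  then show ?case using vcmp_sq[of a b]
    by (auto simp: sqbd_def corners_def intro: pcong.vcmp)
next
  case (hpst_unit_left a)
  then show ?case
    by (auto simp: sqbd_def corners_def intro!: unit_left_h intro: pcong_refl1 pcong_refl2)
next
  case (hpst_unit_right a)
  then show ?case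
    by (auto simp: sqbd_def corners_def intro!: unit_right_h intro: pcong_refl1 pcong_refl2)
next
  case (vpst_unit_left a)
  then show ?case
    by (auto simp: sqbd_def corners_def intro!: unit_left_v intro: pcong_refl1 pcong_refl2 pcong.sym)
next
  case (vpst_unit_right a)
  then show ?case
    by (auto simp: sqbd_def corners_def intro!: unit_right_v intro: pcong_refl1 pcong_refl2 pcong.sym)
next
  case (hpst_assoc a b c)
  then show ?case by (auto simp: sqbd_def corners_def intro: pcong.hcmp_assoc)
next
  case (vpst_assoc a b c)
  then show ?case by (auto simp: sqbd_def corners_def intro: pcong.vcmp_assoc)
next
  case (id_one x)
  then show ?case by (auto simp: sqbd_def corners_def intro: pcong.intros)
next
  case (idv_hcmp f g)
  then show ?case using pcong_hor_bd(1,2)[OF idv_hcmp.hyps]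
    by (auto simp: sqbd_def corners_def intro: pcong.vone)
next
  case (idh_vcmp f g)
  then show ?case using pcong_hor_bd(3,4)[OF idh_vcmp.hyps]
    by (auto simp: sqbd_def corners_def intro: pcong.hone)
next
  case (interchange a b c d)
  then show ?case by (auto simp: sqbd_def corners_def)
qed auto

lemma pcong_sq_bd:
  assumes "pcong P Sq s t"
  shows "pcong P Hor (tm_tp P s) (tm_tp P t)" "pcong P Hor (tm_bt P s) (tm_bt P t)"
    "pcong P Ver (tm_lf P s) (tm_lf P t)" "pcong P Ver (tm_rt P s) (tm_rt P t)"
    "cor s" "cor t"
  using pcong_bd2[OF assms] by (auto simp: sqbd_def)

lemma swf_bd:
  "swf P k t \<Longrightarrow>
    (k = Hor \<longrightarrow> swf P Ob (tm_hsrc P t) \<and> swf P Ob (tm_htgt P t)) \<and>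
    (k = Ver \<longrightarrow> swf P Ob (tm_vsrc P t) \<and> swf P Ob (tm_vtgt P t)) \<and>
    (k = Sq \<longrightarrow> swf P Hor (tm_tp P t) \<and> swf P Hor (tm_bt P t) \<and>
       swf P Ver (tm_lf P t) \<and> swf P Ver (tm_rt P t))"
proof (induction t arbitrary: k)
  case (Gen g)
  then show ?case using ok unfolding pres_ok_def by auto
next
  case (HPst a b)
  then show ?case using hcmp_sq[of a b] pcong_sq_bd(5)[OF swf_pcong] by auto
next
  case (VPst a b)
  then show ?case using vcmp_sq[of a b] pcong_sq_bd(5)[OF swf_pcong] by auto
qed auto

lemma pcong_swf: "pcong P k s t \<Longrightarrow> swf P k s \<and> swf P k t"
proof (induction rule: pcong.induct)
  case (rel k s t)
  then show ?case by blast
next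
  case (hcmp f f' g g')
  then show ?case using pcong_hor_bd(2)[OF hcmp.hyps(1)] pcong_hor_bd(1)[OF hcmp.hyps(2)]
    by (auto intro: pcong.sym pcong.trans)
next
  case (vcmp f f' g g')
  then show ?case using pcong_hor_bd(4)[OF vcmp.hyps(1)] pcong_hor_bd(3)[OF vcmp.hyps(2)]
    by (auto intro: pcong.sym pcong.trans)
next
  case (hpst f f' g g')
  then show ?case using pcong_sq_bd(4)[OF hpst.hyps(1)] pcong_sq_bd(3)[OF hpst.hyps(2)]
    by (auto intro: pcong.sym pcong.trans)
next
  case (vpst f f' g g')
  then show ?case using pcong_sq_bd(2)[OF vpst.hyps(1)] pcong_sq_bd(1)[OF vpst.hyps(2)]
    by (auto intro: pcong.sym pcong.trans)
qed (use swf_bd pcong_hor_bd pcong_sq_bd in \<open>auto intro: swf_pcong pcong.vone pcong.hone\<close>)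

lemma pcong_iff_swf: "pcong P k t t \<longleftrightarrow> swf P k t"
  using pcong_swf swf_pcong by blast

end

lemma pclass_eq: "pcong P k s s \<Longrightarrow> pclass P k s = pclass P k t \<longleftrightarrow> pcong P k s t"
  unfolding pclass_def by (auto intro: pcong.sym pcong.trans)

lemma pclass_eqI: "pcong P k s t \<Longrightarrow> pclass P k s = pclass P k t"
  using pclass_eq pcong_refl1 by metis

text \<open>The one property of the chosen representative on which everything below rests.\<close>

lemma rep_pclass: "pcong P k t t \<Longrightarrow> pcong P k t (rep (pclass P k t))"
  unfolding rep_def pclass_def by (rule someI2[of _ t]) auto

lemma presented_cells: "cells (presented P) k = pclass P k ` {t. pcong P k t t}"
  by (auto simp: presented_def)

lemma pclass_cell [simp, intro]: "pcong P k t t \<Longrightarrow> pclass P k t \<in> cells (presented P) k"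
  by (auto simp: presented_cells)

context
  fixes P :: "'g presentation"
  assumes ok: "pres_ok P"
begin

lemma presented_bd:
  "pcong P Hor f f \<Longrightarrow> hsrc (presented P) (pclass P Hor f) = pclass P Ob (tm_hsrc P f)"
  "pcong P Hor f f \<Longrightarrow> htgt (presented P) (pclass P Hor f) = pclass P Ob (tm_htgt P f)"
  "pcong P Ver u u \<Longrightarrow> vsrc (presented P) (pclass P Ver u) = pclass P Ob (tm_vsrc P u)"
  "pcong P Ver u u \<Longrightarrow> vtgt (presented P) (pclass P Ver u) = pclass P Ob (tm_vtgt P u)"
  "pcong P Sq a a \<Longrightarrow> tp (presented P) (pclass P Sq a) = pclass P Hor (tm_tp P a)"
  "pcong P Sq a a \<Longrightarrow> bt (presented P) (pclass P Sq a) = pclass P Hor (tm_bt P a)"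
  "pcong P Sq a a \<Longrightarrow> lf (presented P) (pclass P Sq a) = pclass P Ver (tm_lf P a)"
  "pcong P Sq a a \<Longrightarrow> rt (presented P) (pclass P Sq a) = pclass P Ver (tm_rt P a)"
  using pcong_hor_bd[OF ok rep_pclass] pcong_sq_bd[OF ok rep_pclass]
  by (auto simp: presented_def intro!: pclass_eqI[symmetric])

lemma presented_one:
  "pcong P Ob x x \<Longrightarrow> hone (presented P) (pclass P Ob x) = pclass P Hor (HOne x)"
  "pcong P Ob x x \<Longrightarrow> vone (presented P) (pclass P Ob x) = pclass P Ver (VOne x)"
  "pcong P Hor f f \<Longrightarrow> idv (presented P) (pclass P Hor f) = pclass P Sq (IdV f)"
  "pcong P Ver u u \<Longrightarrow> idh (presented P) (pclass P Ver u) = pclass P Sq (IdH u)"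
  by (auto simp: presented_def intro!: pclass_eqI pcong.intros rep_pclass intro:
      pcong.sym[OF rep_pclass])

lemma presented_cmp:
  "\<lbrakk>pcong P Hor f f; pcong P Hor g g; pcong P Ob (tm_htgt P f) (tm_hsrc P g)\<rbrakk>
    \<Longrightarrow> hcmp (presented P) (pclass P Hor f) (pclass P Hor g) = pclass P Hor (HCmp f g)"
  "\<lbrakk>pcong P Ver u u; pcong P Ver v v; pcong P Ob (tm_vtgt P u) (tm_vsrc P v)\<rbrakk>
    \<Longrightarrow> vcmp (presented P) (pclass P Ver u) (pclass P Ver v) = pclass P Ver (VCmp u v)"
  "\<lbrakk>pcong P Sq a a; pcong P Sq b b; pcong P Ver (tm_rt P a) (tm_lf P b)\<rbrakk>
    \<Longrightarrow> hpst (presented P) (pclass P Sq a) (pclass P Sq b) = pclass P Sq (HPst a b)"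
  "\<lbrakk>pcong P Sq a a; pcong P Sq b b; pcong P Hor (tm_bt P a) (tm_tp P b)\<rbrakk>
    \<Longrightarrow> vpst (presented P) (pclass P Sq a) (pclass P Sq b) = pclass P Sq (VPst a b)"
  by (auto simp: presented_def intro!: pclass_eqI[symmetric] pcong.hcmp pcong.vcmp pcong.hpst pcong.vpst
      rep_pclass)

lemma double_category_presented: "double_category (presented P)"
proof -
  note bd = pcong_hor_bd[OF ok] pcong_sq_bd(1-4)[OF ok]
  note s = presented_cells presented_bd presented_one presented_cmp pclass_eq bd swf_pcong
  have im: "pcong P k t t \<Longrightarrow> pclass P k t \<in> pclass P k ` {t. pcong P k t t}" for k t by blast
  have cor: "pcong P Ob (tm_hsrc P (tm_tp P a)) (tm_vsrc P (tm_lf P a))"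
    "pcong P Ob (tm_htgt P (tm_tp P a)) (tm_vsrc P (tm_rt P a))"
    "pcong P Ob (tm_hsrc P (tm_bt P a)) (tm_vtgt P (tm_lf P a))"
    "pcong P Ob (tm_htgt P (tm_bt P a)) (tm_vtgt P (tm_rt P a))" if "pcong P Sq a a" for a
    using pcong_sq_bd(5)[OF ok that] by (auto simp: corners_def)
  have 1: "category_on (cells (presented P) Ob) (cells (presented P) Hor) (hsrc (presented P))
      (htgt (presented P)) (hone (presented P)) (hcmp (presented P))"
    unfolding category_on_def
    by (simp add: s im pcong.hone pcong.hcmp pcong.hcmp_unit_left pcong.hcmp_unit_right
        pcong.hcmp_assoc)
  have 2: "category_on (cells (presented P) Ob) (cells (presented P) Ver) (vsrc (presented P))
      (vtgt (presented P)) (vone (presented P)) (vcmp (presented P))"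
    unfolding category_on_def
    by (simp add: s im pcong.vone pcong.vcmp pcong.vcmp_unit_left pcong.vcmp_unit_right
        pcong.vcmp_assoc)
  have 3: "category_on (cells (presented P) Ver) (cells (presented P) Sq) (lf (presented P))
      (rt (presented P)) (idh (presented P)) (hpst (presented P))"
    unfolding category_on_def
    by (simp add: s im pcong.idh pcong.hpst pcong.hpst_unit_left pcong.hpst_unit_right pcong.hpst_assoc)
  have 4: "category_on (cells (presented P) Hor) (cells (presented P) Sq) (tp (presented P))
      (bt (presented P)) (idv (presented P)) (vpst (presented P))"
    unfolding category_on_def
    by (simp add: s im pcong.idv pcong.vpst pcong.vpst_unit_left pcong.vpst_unit_right pcong.vpst_assoc)
  have hc: "pcong P Ob (tm_htgt P (tm_tp P a)) (tm_hsrc P (tm_tp P b))"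
    "pcong P Ob (tm_htgt P (tm_bt P a)) (tm_hsrc P (tm_bt P b))"
    if "pcong P Sq a a" "pcong P Sq b b" "pcong P Ver (tm_rt P a) (tm_lf P b)" for a b
    using hcmp_sq[OF ok _ _ that(3)] pcong_sq_bd[OF ok that(1)] pcong_sq_bd[OF ok that(2)] by blast+
  have vc: "pcong P Ob (tm_vtgt P (tm_lf P a)) (tm_vsrc P (tm_lf P b))"
    "pcong P Ob (tm_vtgt P (tm_rt P a)) (tm_vsrc P (tm_rt P b))"
    if "pcong P Sq a a" "pcong P Sq b b" "pcong P Hor (tm_bt P a) (tm_tp P b)" for a b
    using vcmp_sq[OF ok _ _ that(3)] pcong_sq_bd[OF ok that(1)] pcong_sq_bd[OF ok that(2)] by blast+
  show ?thesis
    unfolding double_category_def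
    by (intro conjI 1 2 3 4)
      (simp_all add: s im cor hc vc pcong_rules)
qed

text \<open>The tautological valuation: evaluating a term at the classes of its generators returns
  the class of the term. Combined with \<open>gen_model_comp\<close>, it shows that a strict double
  functor out of a presented double category is evaluation at its values on generators.\<close>

lemma presented_model:
  "swf P k t \<Longrightarrow> teval (presented P) (\<lambda>k g. pclass P k (Gen g)) k t = pclass P k t \<and>
     twf P (presented P) (\<lambda>k g. pclass P k (Gen g)) k t"
proof (induction t arbitrary: k)
qed (use pcong_hor_bd[OF ok] pcong_sq_bd[OF ok] in
    \<open>auto simp: presented_one presented_cmp presented_bd swf_pcong pclass_eq intro!: pclass_eqI\<close>)

lemma presented_gen_model: "gen_model P (presented P) (\<lambda>k g. pclass P k (Gen g))"
proof -
  have "pcong P k (Gen g) (Gen g)" if "g \<in> pgen P k" for g k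
    using that by (rule pcong.gen)
  then show ?thesis
    using presented_model ok unfolding gen_model_def pres_ok_def by (auto simp: presented_bd)
qed

lemma Dbl_presented_eval:
  assumes "H \<in> Dbl (presented P) C" "swf P k t"
  shows "H k (pclass P k t) = teval C (\<lambda>k g. H k (pclass P k (Gen g))) k t"
  using gen_model_comp(1)[OF presented_gen_model double_category_presented assms(1), of k t]
    presented_model[OF assms(2)] by simp

lemma Dbl_presented_unique:
  assumes "H \<in> Dbl (presented P) C" "H' \<in> Dbl (presented P) C"
    "\<And>k g. g \<in> pgen P k \<Longrightarrow> H k (pclass P k (Gen g)) = H' k (pclass P k (Gen g))"
  shows "H = H'"
proof (rule Dbl_eqI[OF assms(1,2)])
  have "swf P k t \<Longrightarrow> teval C (\<lambda>k g. H k (pclass P k (Gen g))) k t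
      = teval C (\<lambda>k g. H' k (pclass P k (Gen g))) k t" for k t
    using assms(3) by (induction t arbitrary: k) auto
  then show "H k X = H' k X" if "X \<in> cells (presented P) k" for k X
    using that by (auto simp: presented_cells pcong_iff_swf[OF ok] Dbl_presented_eval[OF assms(1)]
        Dbl_presented_eval[OF assms(2)])
qed

definition plift :: "'c dblcat \<Rightarrow> (kind \<Rightarrow> 'g \<Rightarrow> 'c) \<Rightarrow> ('g tm set, 'c) dblfun" where
  "plift C \<phi> = (\<lambda>k. \<lambda>X\<in>cells (presented P) k. teval C \<phi> k (rep X))"

text \<open>Independence of the representative is soundness of \<open>pcong\<close>.\<close>

lemma plift_pclass:
  assumes "double_category C" "model P C \<phi>" "pcong P k t t"
  shows "plift C \<phi> k (pclass P k t) = teval C \<phi> k t"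
  using pcong_sound[OF assms(1,2) rep_pclass[OF assms(3)]] assms(3)
  by (simp add: plift_def pclass_cell)

lemma plift_Dbl:
  assumes C: "double_category C" and M: "model P C \<phi>"
  shows "plift C \<phi> \<in> Dbl (presented P) C"
proof -
  have G: "gen_model P C \<phi>" using M by (simp add: model_def)
  have w: "twf P C \<phi> k t" if "pcong P k t t" for k t
    using pcong_sound[OF C M that] by blast
  note s = presented_cells presented_bd presented_one presented_cmp plift_pclass[OF C M]
    pcong_rules pclass_eq
    pcong_hor_bd[OF ok] pcong_sq_bd(1-4)[OF ok] w teval_bd[OF C G] teval_cell[OF C G]
  show ?thesis
    by (intro DblI) (auto simp: s, simp add: plift_def presented_cells)
qed

end

section \<open>Omitting the relations between squares\<close>

text \<open>The first stage of a presentation, in which boundaries of squares can be computed before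
  the relations between squares are known to respect them.\<close>

definition cut :: "'g presentation \<Rightarrow> 'g presentation" where
  "cut P = P\<lparr>prel := (\<lambda>k s t. k \<noteq> Sq \<and> prel P k s t)\<rparr>"

lemma cut_simps [simp]:
  "pgen (cut P) = pgen P" "phsrc (cut P) = phsrc P" "phtgt (cut P) = phtgt P"
  "pvsrc (cut P) = pvsrc P" "pvtgt (cut P) = pvtgt P" "ptp (cut P) = ptp P" "pbt (cut P) = pbt P"
  "plf (cut P) = plf P" "prt (cut P) = prt P" "prel (cut P) k s t \<longleftrightarrow> k \<noteq> Sq \<and> prel P k s t"
  by (simp_all add: cut_def)

lemma tm_bd_cut [simp]:
  "tm_hsrc (cut P) t = tm_hsrc P t" "tm_htgt (cut P) t = tm_htgt P t"
  "tm_vsrc (cut P) t = tm_vsrc P t" "tm_vtgt (cut P) t = tm_vtgt P t"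
proof -
  show 1: "tm_hsrc (cut P) t = tm_hsrc P t" by (induction t) auto
  show 2: "tm_htgt (cut P) t = tm_htgt P t" by (induction t) auto
  show 3: "tm_vsrc (cut P) t = tm_vsrc P t" by (induction t) auto
  show 4: "tm_vtgt (cut P) t = tm_vtgt P t" by (induction t) auto
qed

lemma tm_sqbd_cut [simp]:
  "tm_tp (cut P) t = tm_tp P t" "tm_bt (cut P) t = tm_bt P t"
  "tm_lf (cut P) t = tm_lf P t" "tm_rt (cut P) t = tm_rt P t"
proof -
  show 1: "tm_tp (cut P) t = tm_tp P t" by (induction t) auto
  show 2: "tm_bt (cut P) t = tm_bt P t" by (induction t) auto
  show 3: "tm_lf (cut P) t = tm_lf P t" by (induction t) auto
  show 4: "tm_rt (cut P) t = tm_rt P t" by (induction t) auto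
qed

lemma pcong_cut: "pcong (cut P) k s t \<Longrightarrow> pcong P k s t"
proof (induction rule: pcong.induct)
  case (trans k s t r)
  then show ?case by (blast intro: pcong.trans)
next
  case (sym k s t)
  then show ?case by (blast intro: pcong.sym)
qed (auto intro: pcong_rules pcong.gen pcong.rel)

text \<open>No rule that concludes a congruence of objects or 1-cells has a premise about squares,
  so the derivation survives unchanged.\<close>

lemma cut_pcong: "pcong P k s t \<Longrightarrow> k \<noteq> Sq \<Longrightarrow> pcong (cut P) k s t"
proof (induction rule: pcong.induct)
  case (trans k s t r)
  then show ?case by (blast intro: pcong.trans)
next
  case (sym k s t)
  then show ?case by (blast intro: pcong.sym)
next
  case (hcmp f f' g g')
  then show ?case by (intro pcong.hcmp) auto
next
  case (vcmp f f' g g')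
  then show ?case by (intro pcong.vcmp) auto
next
  case (hcmp_unit_left f)
  then show ?case using pcong.hcmp_unit_left[of "cut P"] by simp
next
  case (hcmp_unit_right f)
  then show ?case using pcong.hcmp_unit_right[of "cut P"] by simp
next
  case (vcmp_unit_left f)
  then show ?case using pcong.vcmp_unit_left[of "cut P"] by simp
next
  case (vcmp_unit_right f)
  then show ?case using pcong.vcmp_unit_right[of "cut P"] by simp
qed (auto intro: pcong.gen pcong.rel pcong.hone pcong.vone pcong.hcmp_assoc pcong.vcmp_assoc)

lemma pcong_cut_iff: "k \<noteq> Sq \<Longrightarrow> pcong (cut P) k s t \<longleftrightarrow> pcong P k s t"
  using pcong_cut cut_pcong by blast

lemma swf_cut [simp]: "swf (cut P) k t \<longleftrightarrow> swf P k t"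
  by (induction t arbitrary: k) (auto simp: pcong_cut_iff)

lemma twf_cut [simp]: "twf (cut P) C \<phi> k t \<longleftrightarrow> twf P C \<phi> k t"
  by (induction t arbitrary: k) auto

lemma gen_model_cut [simp]: "gen_model (cut P) C \<phi> \<longleftrightarrow> gen_model P C \<phi>"
  by (simp add: gen_model_def)

lemma corners_cut [simp]: "corners (cut P) = corners P"
  by (intro ext) (simp add: corners_def pcong_cut_iff)

text \<open>A converse to \<open>presented_model\<close>: equality of classes in the presented
  double category is congruence of terms, so composability there gives syntactic
  well-formedness.\<close>

lemma twf_presented:
  assumes "pres_ok P"
  shows "twf P (presented P) (\<lambda>k g. pclass P k (Gen g)) k t \<Longrightarrow> swf P k t"
proof (induction t arbitrary: k)
qed (use presented_model[OF assms] in \<open>auto simp: presented_bd[OF assms] swf_pcong pclass_eq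
      pcong_hor_bd[OF assms] pcong_sq_bd[OF assms]\<close>)

text \<open>Used to pass between valuations such as \<open>tfam \<phi>\<close> and
  \<open>\<lambda>k g. pclass P k (Gen g)\<close>, which agree on the generators of the stated kind
  but not on all arguments.\<close>

lemma twf_cong:
  assumes "\<And>k g. g \<in> pgen P k \<Longrightarrow> \<phi> k g = \<psi> k g"
  shows "twf P C \<phi> k t \<Longrightarrow> twf P C \<psi> k t \<and> teval C \<phi> k t = teval C \<psi> k t"
  using assms by (induction t arbitrary: k) auto

lemma gen_model_cong:
  assumes "\<And>k g. g \<in> pgen P k \<Longrightarrow> \<phi> k g = \<psi> k g" "gen_model P C \<phi>"
  shows "gen_model P C \<psi>"
proof -
  note t = twf_cong[of P \<phi> \<psi> C, OF assms(1)]
  have "twf P C \<phi> k t \<Longrightarrow> twf P C \<psi> k t" "twf P C \<phi> k t \<Longrightarrow> teval C \<psi> k t = teval C \<phi> k t" for k t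
    using t[of k t] by simp_all
  then show ?thesis using assms unfolding gen_model_def by simp
qed

section \<open>Quasi-functors\<close>

definition tfam :: "(kind \<Rightarrow> 'a \<Rightarrow> kind \<Rightarrow> 'b \<Rightarrow> 'c) \<Rightarrow> kind \<Rightarrow> ('a, 'b) tgen \<Rightarrow> 'c" where
  "tfam \<phi> m g = (case g of TG k x l y \<Rightarrow> \<phi> k x l y)"

lemma tfam_TG [simp]: "tfam \<phi> m (TG k x l y) = \<phi> k x l y"
  by (simp add: tfam_def)

definition qf_bd :: "'a dblcat \<Rightarrow> 'b dblcat \<Rightarrow> 'c dblcat \<Rightarrow> (kind \<Rightarrow> 'a \<Rightarrow> kind \<Rightarrow> 'b \<Rightarrow> 'c) \<Rightarrow> bool" where
  "qf_bd A B C \<phi> \<longleftrightarrow>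
     (\<forall>k l. dim k + dim l \<le> 2 \<longrightarrow> (\<forall>x\<in>cells A k. \<forall>y\<in>cells B l. \<phi> k x l y \<in> cells C (join k l))) \<and>
     (\<forall>K\<in>cells A Hor. \<forall>b\<in>cells B Ob.
        hsrc C (\<phi> Hor K Ob b) = \<phi> Ob (hsrc A K) Ob b \<and> htgt C (\<phi> Hor K Ob b) = \<phi> Ob (htgt A K) Ob b) \<and>
     (\<forall>a\<in>cells A Ob. \<forall>k\<in>cells B Hor.
        hsrc C (\<phi> Ob a Hor k) = \<phi> Ob a Ob (hsrc B k) \<and> htgt C (\<phi> Ob a Hor k) = \<phi> Ob a Ob (htgt B k)) \<and>
     (\<forall>U\<in>cells A Ver. \<forall>b\<in>cells B Ob.
        vsrc C (\<phi> Ver U Ob b) = \<phi> Ob (vsrc A U) Ob b \<and> vtgt C (\<phi> Ver U Ob b) = \<phi> Ob (vtgt A U) Ob b) \<and>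
     (\<forall>a\<in>cells A Ob. \<forall>u\<in>cells B Ver.
        vsrc C (\<phi> Ob a Ver u) = \<phi> Ob a Ob (vsrc B u) \<and> vtgt C (\<phi> Ob a Ver u) = \<phi> Ob a Ob (vtgt B u)) \<and>
     (\<forall>x\<in>cells A Sq. \<forall>b\<in>cells B Ob.
        tp C (\<phi> Sq x Ob b) = \<phi> Hor (tp A x) Ob b \<and> bt C (\<phi> Sq x Ob b) = \<phi> Hor (bt A x) Ob b \<and>
        lf C (\<phi> Sq x Ob b) = \<phi> Ver (lf A x) Ob b \<and> rt C (\<phi> Sq x Ob b) = \<phi> Ver (rt A x) Ob b) \<and>
     (\<forall>a\<in>cells A Ob. \<forall>y\<in>cells B Sq.
        tp C (\<phi> Ob a Sq y) = \<phi> Ob a Hor (tp B y) \<and> bt C (\<phi> Ob a Sq y) = \<phi> Ob a Hor (bt B y) \<and>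
        lf C (\<phi> Ob a Sq y) = \<phi> Ob a Ver (lf B y) \<and> rt C (\<phi> Ob a Sq y) = \<phi> Ob a Ver (rt B y)) \<and>
     (\<forall>K\<in>cells A Hor. \<forall>k\<in>cells B Hor.
        tp C (\<phi> Hor K Hor k) = hcmp C (\<phi> Ob (hsrc A K) Hor k) (\<phi> Hor K Ob (htgt B k)) \<and>
        bt C (\<phi> Hor K Hor k) = hcmp C (\<phi> Hor K Ob (hsrc B k)) (\<phi> Ob (htgt A K) Hor k) \<and>
        lf C (\<phi> Hor K Hor k) = vone C (\<phi> Ob (hsrc A K) Ob (hsrc B k)) \<and>
        rt C (\<phi> Hor K Hor k) = vone C (\<phi> Ob (htgt A K) Ob (htgt B k))) \<and>
     (\<forall>K\<in>cells A Hor. \<forall>u\<in>cells B Ver.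
        tp C (\<phi> Hor K Ver u) = \<phi> Hor K Ob (vsrc B u) \<and> bt C (\<phi> Hor K Ver u) = \<phi> Hor K Ob (vtgt B u) \<and>
        lf C (\<phi> Hor K Ver u) = \<phi> Ob (hsrc A K) Ver u \<and> rt C (\<phi> Hor K Ver u) = \<phi> Ob (htgt A K) Ver u) \<and>
     (\<forall>U\<in>cells A Ver. \<forall>k\<in>cells B Hor.
        tp C (\<phi> Ver U Hor k) = \<phi> Ob (vsrc A U) Hor k \<and> bt C (\<phi> Ver U Hor k) = \<phi> Ob (vtgt A U) Hor k \<and>
        lf C (\<phi> Ver U Hor k) = \<phi> Ver U Ob (hsrc B k) \<and> rt C (\<phi> Ver U Hor k) = \<phi> Ver U Ob (htgt B k)) \<and>
     (\<forall>U\<in>cells A Ver. \<forall>u\<in>cells B Ver.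
        tp C (\<phi> Ver U Ver u) = hone C (\<phi> Ob (vsrc A U) Ob (vsrc B u)) \<and>
        bt C (\<phi> Ver U Ver u) = hone C (\<phi> Ob (vtgt A U) Ob (vtgt B u)) \<and>
        lf C (\<phi> Ver U Ver u) = vcmp C (\<phi> Ver U Ob (vsrc B u)) (\<phi> Ob (vtgt A U) Ver u) \<and>
        rt C (\<phi> Ver U Ver u) = vcmp C (\<phi> Ob (vsrc A U) Ver u) (\<phi> Ver U Ob (vtgt B u)))"

lemmas qf_bd_eqs = qf_bd_def[THEN iffD1, THEN conjunct2]

lemma qf_bd_cell:
  "\<lbrakk>qf_bd A B C \<phi>; dim k + dim l \<le> 2; x \<in> cells A k; y \<in> cells B l\<rbrakk> \<Longrightarrow> \<phi> k x l y \<in> cells C (join k l)"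
  by (simp add: qf_bd_def)

lemmas qf_bd_cells =
  qf_bd_cell[where k = Ob and l = Ob, simplified] qf_bd_cell[where k = Hor and l = Ob, simplified]
  qf_bd_cell[where k = Ob and l = Hor, simplified] qf_bd_cell[where k = Ver and l = Ob, simplified]
  qf_bd_cell[where k = Ob and l = Ver, simplified] qf_bd_cell[where k = Sq and l = Ob, simplified]
  qf_bd_cell[where k = Ob and l = Sq, simplified] qf_bd_cell[where k = Hor and l = Hor, simplified]
  qf_bd_cell[where k = Hor and l = Ver, simplified] qf_bd_cell[where k = Ver and l = Hor, simplified]
  qf_bd_cell[where k = Ver and l = Ver, simplified]

lemma tensor_pres_simps [simp]:
  "phsrc (tensor_pres A B) = t_hsrc A B" "phtgt (tensor_pres A B) = t_htgt A B"
  "pvsrc (tensor_pres A B) = t_vsrc A B" "pvtgt (tensor_pres A B) = t_vtgt A B"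
  "ptp (tensor_pres A B) = t_tp A B" "pbt (tensor_pres A B) = t_bt A B"
  "plf (tensor_pres A B) = t_lf A B" "prt (tensor_pres A B) = t_rt A B"
  "prel (tensor_pres A B) = t_rel A B"
  by (simp_all add: tensor_pres_def)

lemma tensor_pgen: "TG k x l y \<in> pgen (tensor_pres A B) m \<longleftrightarrow>
    x \<in> cells A k \<and> y \<in> cells B l \<and> dim k + dim l \<le> 2 \<and> m = join k l"
  by (auto simp: tensor_pres_def)

lemma tensor_pgens [simp]:
  "TG k x l y \<in> pgen (tensor_pres A B) Ob \<longleftrightarrow> k = Ob \<and> l = Ob \<and> x \<in> cells A Ob \<and> y \<in> cells B Ob"
  "TG k x l y \<in> pgen (tensor_pres A B) Hor \<longleftrightarrow>
     k = Hor \<and> l = Ob \<and> x \<in> cells A Hor \<and> y \<in> cells B Ob \<or>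
     k = Ob \<and> l = Hor \<and> x \<in> cells A Ob \<and> y \<in> cells B Hor"
  "TG k x l y \<in> pgen (tensor_pres A B) Ver \<longleftrightarrow>
     k = Ver \<and> l = Ob \<and> x \<in> cells A Ver \<and> y \<in> cells B Ob \<or>
     k = Ob \<and> l = Ver \<and> x \<in> cells A Ob \<and> y \<in> cells B Ver"
  "TG k x l y \<in> pgen (tensor_pres A B) Sq \<longleftrightarrow>
     k = Sq \<and> l = Ob \<and> x \<in> cells A Sq \<and> y \<in> cells B Ob \<or>
     k = Ob \<and> l = Sq \<and> x \<in> cells A Ob \<and> y \<in> cells B Sq \<or>
     k = Hor \<and> l = Hor \<and> x \<in> cells A Hor \<and> y \<in> cells B Hor \<or>
     k = Hor \<and> l = Ver \<and> x \<in> cells A Hor \<and> y \<in> cells B Ver \<or>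
     k = Ver \<and> l = Hor \<and> x \<in> cells A Ver \<and> y \<in> cells B Hor \<or>
     k = Ver \<and> l = Ver \<and> x \<in> cells A Ver \<and> y \<in> cells B Ver"
  unfolding tensor_pgen by (cases k; cases l; auto)+

lemma ball_tgen: "(\<forall>g\<in>S. Q g) \<longleftrightarrow> (\<forall>k x l y. TG k x l y \<in> S \<longrightarrow> Q (TG k x l y))"
  by (metis tgen.exhaust)

lemma gen_model_qf_bd:
  assumes "double_category A" "double_category B" "double_category C"
  shows "gen_model (tensor_pres A B) C (tfam \<phi>) \<longleftrightarrow> qf_bd A B C \<phi>"
proof
  assume g: "gen_model (tensor_pres A B) C (tfam \<phi>)"
  then have 0: "\<phi> k x l y \<in> cells C (join k l)"
    if "dim k + dim l \<le> 2" "x \<in> cells A k" "y \<in> cells B l" for k x l y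
    using that unfolding gen_model_def by (metis tensor_pgen tfam_TG)
  let ?P = "tensor_pres A B" and ?e = "teval C (tfam \<phi>)"
  have "\<forall>g\<in>pgen ?P Hor. hsrc C (tfam \<phi> Hor g) = ?e Ob (phsrc ?P g) \<and> htgt C (tfam \<phi> Hor g) = ?e Ob
      (phtgt ?P g)"
    "\<forall>g\<in>pgen ?P Ver. vsrc C (tfam \<phi> Ver g) = ?e Ob (pvsrc ?P g) \<and> vtgt C (tfam \<phi> Ver g) = ?e Ob
      (pvtgt ?P g)"
    "\<forall>g\<in>pgen ?P Sq. tp C (tfam \<phi> Sq g) = ?e Hor (ptp ?P g) \<and> bt C (tfam \<phi> Sq g) = ?e Hor (pbt ?P g) \<and>
       lf C (tfam \<phi> Sq g) = ?e Ver (plf ?P g) \<and> rt C (tfam \<phi> Sq g) = ?e Ver (prt ?P g)"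
    using g by (simp_all add: gen_model_def)
  then show "qf_bd A B C \<phi>"
    unfolding qf_bd_def ball_tgen by (simp add: imp_disjL all_conj_distrib 0 dc[OF assms(1)]
        dc[OF assms(2)])
next
  assume q: "qf_bd A B C \<phi>"
  then have 0: "\<forall>k. \<forall>g\<in>pgen (tensor_pres A B) k. tfam \<phi> k g \<in> cells C k"
    unfolding qf_bd_def ball_tgen by (auto simp: tensor_pgen)
  show "gen_model (tensor_pres A B) C (tfam \<phi>)"
    unfolding gen_model_def
    by (intro conjI 0; unfold ball_tgen)
      (auto simp: qf_bd_cells[OF q] qf_bd_eqs[OF q] dc[OF assms(1)] dc[OF assms(2)])
qed

definition qf :: "'a dblcat \<Rightarrow> 'b dblcat \<Rightarrow> 'c dblcat \<Rightarrow> (kind \<Rightarrow> 'a \<Rightarrow> kind \<Rightarrow> 'b \<Rightarrow> 'c) \<Rightarrow> bool" where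
  "qf A B C \<phi> \<longleftrightarrow> qf_bd A B C \<phi> \<and>
     (\<forall>k s t. t_rel A B k s t \<longrightarrow> teval C (tfam \<phi>) k s = teval C (tfam \<phi>) k t)"

text \<open>A quasi-functor as far as 1-cells are concerned. It is the notion available at two
  points where the relations between squares are still open: in the double category presented by
  \<open>cut TP\<close>, and for the family \<open>tri_cell\<close> behind associativity.\<close>

definition pqf :: "'a dblcat \<Rightarrow> 'b dblcat \<Rightarrow> 'c dblcat \<Rightarrow> (kind \<Rightarrow> 'a \<Rightarrow> kind \<Rightarrow> 'b \<Rightarrow> 'c) \<Rightarrow> bool" where
  "pqf A B C \<phi> \<longleftrightarrow> qf_bd A B C \<phi> \<and>
     (\<forall>k s t. t_rel A B k s t \<longrightarrow> k \<noteq> Sq \<longrightarrow> teval C (tfam \<phi>) k s = teval C (tfam \<phi>) k t)"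

lemma qf_pqf: "qf A B C \<phi> \<Longrightarrow> pqf A B C \<phi>"
  by (auto simp: qf_def pqf_def)

lemma pqf_rel:
  "pqf A B C \<phi> \<Longrightarrow> t_rel A B k s t \<Longrightarrow> k \<noteq> Sq \<Longrightarrow> teval C (tfam \<phi>) k s = teval C (tfam \<phi>) k t"
  by (simp add: pqf_def)

text \<open>
  Both sides of every relation are well-formed and parallel in any double category in which the
  relations between objects and 1-cells hold. Taken in the double category presented without the
  relations between squares, this shows that those relations are compatible with boundaries.
\<close>

lemma t_rel_bd:
  assumes A: "double_category A" and B: "double_category B" and Y: "double_category Y"
    and q: "pqf A B Y \<phi>" and "t_rel A B k s t"
  shows "twf (tensor_pres A B) Y (tfam \<phi>) k s \<and> twf (tensor_pres A B) Y (tfam \<phi>) k t \<and>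
    (k = Sq \<longrightarrow> tp Y (teval Y (tfam \<phi>) k s) = tp Y (teval Y (tfam \<phi>) k t) \<and>
       bt Y (teval Y (tfam \<phi>) k s) = bt Y (teval Y (tfam \<phi>) k t) \<and>
       lf Y (teval Y (tfam \<phi>) k s) = lf Y (teval Y (tfam \<phi>) k t) \<and>
       rt Y (teval Y (tfam \<phi>) k s) = rt Y (teval Y (tfam \<phi>) k t))"
proof -
  have qb: "qf_bd A B Y \<phi>" using q by (simp add: pqf_def)
  \<comment> \<open>Rules 1-4 and 9-12 are the relations between 1-cells, the only ones that
    \<open>pqf\<close> provides.\<close>
  note [simp] = dc[OF A] dc[OF B] dc[OF Y] qf_bd_cells[OF qb] qf_bd_eqs[OF qb] 
    t_rel.intros(1-4,9-12)[THEN pqf_rel[OF q], simplified]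
  show ?thesis
    using assms(5) by cases simp_all
qed


section \<open>The tensor product is a well-behaved presentation\<close>

lemma pcong_tg:
  "x \<in> cells A k \<Longrightarrow> y \<in> cells B l \<Longrightarrow> dim k + dim l \<le> 2 \<Longrightarrow>
    pcong (tensor_pres A B) (join k l) (tg k x l y) (tg k x l y)"
  by (rule pcong.gen) (simp add: tensor_pgen)

context
  fixes A :: "'a dblcat" and B :: "'b dblcat"
  assumes A: "double_category A" and B: "double_category B"
begin

abbreviation "TP \<equiv> tensor_pres A B"

lemma pcong_tg_Ob: "x \<in> cells A Ob \<Longrightarrow> y \<in> cells B Ob \<Longrightarrow> pcong TP Ob (tg Ob x Ob y) (tg Ob x Ob y)"
  using pcong_tg[of x A Ob y B Ob] by simp

lemma pres_ok_cut: "pres_ok (cut TP)"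
proof -
  note [simp] = dc[OF A] dc[OF B] pcong_tg_Ob
  have 1: "pcong TP Ob (tm_hsrc TP s) (tm_hsrc TP t) \<and> pcong TP Ob (tm_htgt TP s) (tm_htgt TP t)"
    if "t_rel A B Hor s t" for s t
    using that by cases simp_all
  have 2: "pcong TP Ob (tm_vsrc TP s) (tm_vsrc TP t) \<and> pcong TP Ob (tm_vtgt TP s) (tm_vtgt TP t)"
    if "t_rel A B Ver s t" for s t
    using that by cases simp_all
  show ?thesis
    unfolding pres_ok_def ball_tgen by (auto simp: corners_def pcong_cut_iff 1 2)
qed

lemma t_rel_swf1: "t_rel A B k s t \<Longrightarrow> k \<noteq> Sq \<Longrightarrow> swf TP k s \<and> swf TP k t"
proof -
  note [simp] = dc[OF A] dc[OF B] pcong_tg_Ob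
  show "t_rel A B k s t \<Longrightarrow> k \<noteq> Sq \<Longrightarrow> swf TP k s \<and> swf TP k t"
    by (induction rule: t_rel.induct) simp_all
qed

lemma tfam_canonical:
  assumes "g \<in> pgen TP k"
  shows "tfam (\<lambda>k x l y. pclass P (join k l) (tg k x l y)) k g = pclass P k (Gen g)"
  using assms by (cases g) (simp add: tensor_pgen)

lemma canonical_qf_bd:
  assumes "pres_ok P" "gen_model TP (presented P) (\<lambda>k g. pclass P k (Gen g))"
  shows "qf_bd A B (presented P) (\<lambda>k x l y. pclass P (join k l) (tg k x l y))"
proof -
  have "gen_model TP (presented P) (tfam (\<lambda>k x l y. pclass P (join k l) (tg k x l y)))"
    by (rule gen_model_cong[OF _ assms(2)]) (simp add: tfam_canonical)
  then show ?thesis by (simp add: gen_model_qf_bd[OF A B double_category_presented[OF assms(1)]])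
qed

lemma teval_canonical:
  assumes "pres_ok P" "pgen P = pgen TP" "swf P k t"
  shows "teval (presented P) (tfam (\<lambda>k x l y. pclass P (join k l) (tg k x l y))) k t = pclass P k t"
proof -
  let ?\<gamma> = "\<lambda>k g. pclass P k (Gen g)"
  have w: "twf P (presented P) ?\<gamma> k t"
    using presented_model[OF assms(1,3)] by blast
  have e: "?\<gamma> k g = tfam (\<lambda>k x l y. pclass P (join k l) (tg k x l y)) k g" if "g \<in> pgen P k" for k g
    using tfam_canonical[of g k P] that assms(2) by simp
  have "teval (presented P) (tfam (\<lambda>k x l y. pclass P (join k l) (tg k x l y))) k t
      = teval (presented P) ?\<gamma> k t"
    by (rule twf_cong[of P ?\<gamma>, OF e w, THEN conjunct2, symmetric])
  then show ?thesis using presented_model[OF assms(1,3)] by simp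
qed

lemma canonical_pqf: "pqf A B (presented (cut TP)) (\<lambda>k x l y. pclass (cut TP) (join k l) (tg k x l y))"
proof -
  let ?\<phi> = "\<lambda>k x l y. pclass (cut TP) (join k l) (tg k x l y)"
  have "teval (presented (cut TP)) (tfam ?\<phi>) k s = teval (presented (cut TP)) (tfam ?\<phi>) k t"
    if "t_rel A B k s t" "k \<noteq> Sq" for k s t
  proof -
    have w: "swf (cut TP) k s" "swf (cut TP) k t" using t_rel_swf1[OF that] by simp_all
    then show ?thesis
      using that by (auto simp: teval_canonical[OF pres_ok_cut] intro!: pclass_eqI pcong.rel swf_pcong)
  qed
  moreover have "qf_bd A B (presented (cut TP)) ?\<phi>"
    using canonical_qf_bd[OF pres_ok_cut] presented_gen_model[OF pres_ok_cut] by simp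
  ultimately show ?thesis unfolding pqf_def by blast
qed

text \<open>In the double category presented by \<open>cut TP\<close>, \<open>t_rel_bd\<close> gives
  composability of the classes, and \<open>twf_presented\<close> turns it into well-formedness of
  the terms. The result passes to \<open>TP\<close> because \<open>swf\<close> depends on congruence
  of objects and 1-cells only.\<close>

lemma t_rel_swf:
  assumes "t_rel A B k s t"
  shows "swf TP k s \<and> swf TP k t"
proof -
  let ?\<gamma> = "\<lambda>k g. pclass (cut TP) k (Gen g)"
  have "swf TP k r" if "twf TP (presented (cut TP))
      (tfam (\<lambda>k x l y. pclass (cut TP) (join k l) (tg k x l y))) k r" for r
  proof -
    have "twf TP (presented (cut TP)) ?\<gamma> k r"
      using twf_cong[of TP, OF _ that, of ?\<gamma>] tfam_canonical by blast
    then show ?thesis using twf_presented[OF pres_ok_cut, of k r] by simp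
  qed
  then show ?thesis
    using t_rel_bd[OF A B double_category_presented[OF pres_ok_cut] canonical_pqf assms] by blast
qed

text \<open>The same test object settles parallelism: the two sides of a relation between squares
  have equal boundaries there, that is, congruent boundary terms.\<close>

lemma pres_ok_tensor: "pres_ok TP"
proof -
  have 1: "pcong TP Hor (tm_tp TP s) (tm_tp TP t) \<and> pcong TP Hor (tm_bt TP s) (tm_bt TP t) \<and>
      pcong TP Ver (tm_lf TP s) (tm_lf TP t) \<and> pcong TP Ver (tm_rt TP s) (tm_rt TP t)"
    if st: "t_rel A B Sq s t" for s t
  proof -
    have w: "swf TP Sq s" "swf TP Sq t" using t_rel_swf[OF st] by auto
    then have r: "pcong (cut TP) Sq s s" "pcong (cut TP) Sq t t" by (auto intro: swf_pcong)
    have "pcong (cut TP) Hor (tm_tp TP s) (tm_tp TP t) \<and> pcong (cut TP) Hor (tm_bt TP s) (tm_bt TP t) \<and>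
        pcong (cut TP) Ver (tm_lf TP s) (tm_lf TP t) \<and> pcong (cut TP) Ver (tm_rt TP s) (tm_rt TP t)"
      using t_rel_bd[OF A B double_category_presented[OF pres_ok_cut] canonical_pqf st] w
        pcong_sq_bd[OF pres_ok_cut r(1)]
      by (simp add: teval_canonical[OF pres_ok_cut] presented_bd[OF pres_ok_cut] r pclass_eq)
    then show ?thesis using pcong_cut by blast
  qed
  then show ?thesis using pres_ok_cut unfolding pres_ok_def by (simp add: pcong_cut_iff)
qed

lemma double_category_tensor: "double_category (A \<otimes> B)"
  unfolding tensor_def by (rule double_category_presented[OF pres_ok_tensor])

text \<open>The universal quasi-functor \<open>J\<close>.\<close>

lemma qf_tcell: "qf A B (A \<otimes> B) (tcell A B)"
proof -
  have t: "tcell A B = (\<lambda>k x l y. pclass TP (join k l) (tg k x l y))"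
    by (simp add: tcell_def fun_eq_iff)
  have "teval (A \<otimes> B) (tfam (tcell A B)) k s = teval (A \<otimes> B) (tfam (tcell A B)) k t"
    if "t_rel A B k s t" for k s t
    using t_rel_swf[OF that] that unfolding tensor_def t
    by (auto simp: teval_canonical[OF pres_ok_tensor] intro!: pclass_eqI pcong.rel swf_pcong)
  then show ?thesis
    unfolding qf_def using canonical_qf_bd[OF pres_ok_tensor presented_gen_model[OF pres_ok_tensor]]
    by (simp add: t tensor_def)
qed

section \<open>Universal property of the tensor product\<close>

lemma qf_model: "double_category C \<Longrightarrow> qf A B C \<phi> \<longleftrightarrow> model TP C (tfam \<phi>)"
  by (simp add: qf_def model_def gen_model_qf_bd[OF A B])

definition qlift :: "'c dblcat \<Rightarrow> (kind \<Rightarrow> 'a \<Rightarrow> kind \<Rightarrow> 'b \<Rightarrow> 'c) \<Rightarrow> (('a, 'b) tcell, 'c) dblfun" where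
  "qlift C \<phi> = plift TP C (tfam \<phi>)"

lemma qlift_Dbl: "double_category C \<Longrightarrow> qf A B C \<phi> \<Longrightarrow> qlift C \<phi> \<in> Dbl (A \<otimes> B) C"
  unfolding qlift_def tensor_def by (rule plift_Dbl[OF pres_ok_tensor]) (simp_all add: qf_model)

lemma qlift_tcell:
  "\<lbrakk>double_category C; qf A B C \<phi>; dim k + dim l \<le> 2; x \<in> cells A k; y \<in> cells B l\<rbrakk> \<Longrightarrow>
    qlift C \<phi> (join k l) (tcell A B k x l y) = \<phi> k x l y"
  unfolding qlift_def tcell_def
  by (subst plift_pclass[OF pres_ok_tensor]) (simp_all add: qf_model pcong_tg)

lemma tensor_unique:
  assumes "H \<in> Dbl (A \<otimes> B) C" "H' \<in> Dbl (A \<otimes> B) C"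
    "\<And>k l x y. \<lbrakk>dim k + dim l \<le> 2; x \<in> cells A k; y \<in> cells B l\<rbrakk> \<Longrightarrow>
      H (join k l) (tcell A B k x l y) = H' (join k l) (tcell A B k x l y)"
  shows "H = H'"
proof (rule Dbl_presented_unique[OF pres_ok_tensor, folded tensor_def, OF assms(1,2)])
  show "H k (pclass TP k (Gen g)) = H' k (pclass TP k (Gen g))" if "g \<in> pgen TP k" for k g
    using that assms(3) by (cases g) (auto simp: tensor_pgen tcell_def)
qed

lemma tcell_cell: "\<lbrakk>dim k + dim l \<le> 2; x \<in> cells A k; y \<in> cells B l\<rbrakk> \<Longrightarrow>
    tcell A B k x l y \<in> cells (A \<otimes> B) (join k l)"
  by (rule qf_bd_cell[OF qf_tcell[unfolded qf_def, THEN conjunct1]])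

text \<open>A strict double functor commutes with the evaluation of well-formed terms, and
  \<open>t_rel_bd\<close> says that both sides of every relation are well-formed; so no relation has
  to be inspected.\<close>

lemma qf_postcomp:
  assumes q: "qf A B C \<phi>" and C: "double_category C" and Q: "Q \<in> Dbl C C'" and C': "double_category C'"
  shows "qf A B C' (\<lambda>k x l y. Q (join k l) (\<phi> k x l y))"
proof -
  have G: "gen_model TP C (tfam \<phi>)" using q by (simp add: gen_model_qf_bd[OF A B C] qf_def)
  have e: "(\<lambda>k g. Q k (tfam \<phi> k g)) m g = tfam (\<lambda>k x l y. Q (join k l) (\<phi> k x l y)) m g"
    if "g \<in> pgen TP m" for m g
    using that by (cases g) (simp add: tensor_pgen)
  note c = gen_model_comp[OF G C Q]
  have "teval C' (tfam (\<lambda>k x l y. Q (join k l) (\<phi> k x l y))) k t = Q k (teval C (tfam \<phi>) k t)"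
    if "twf TP C (tfam \<phi>) k t" for k t
    using twf_cong[of TP, OF e conjunct1[OF c(1)[OF that]]] c(1)[OF that] by simp
  moreover have "twf TP C (tfam \<phi>) k s \<and> twf TP C (tfam \<phi>) k t" if "t_rel A B k s t" for k s t
    using t_rel_bd[OF A B C qf_pqf[OF q] that] by blast
  moreover have "qf_bd A B C' (\<lambda>k x l y. Q (join k l) (\<phi> k x l y))"
    using gen_model_cong[of TP, OF e c(2)] by (simp add: gen_model_qf_bd[OF A B C'])
  ultimately show ?thesis using q unfolding qf_def by simp
qed

lemma Dbl_qf:
  assumes "H \<in> Dbl (A \<otimes> B) C" "double_category C"
  shows "qf A B C (\<lambda>k x l y. H (join k l) (tcell A B k x l y))"
  by (rule qf_postcomp[OF qf_tcell double_category_tensor assms])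

lemma qf_cong:
  assumes "qf A B C \<phi>" "double_category C"
    and "\<And>k l x y. \<lbrakk>dim k + dim l \<le> 2; x \<in> cells A k; y \<in> cells B l\<rbrakk> \<Longrightarrow> \<phi> k x l y = \<psi> k x l y"
  shows "qf A B C \<psi>"
proof -
  have e: "tfam \<phi> m g = tfam \<psi> m g" if "g \<in> pgen TP m" for m g
    using that assms(3) by (cases g) (simp add: tensor_pgen)
  have "gen_model TP C (tfam \<phi>)"
    using assms(1) by (simp add: gen_model_qf_bd[OF A B assms(2)] qf_def)
  from gen_model_cong[OF e this] have "qf_bd A B C \<psi>"
    by (simp add: gen_model_qf_bd[OF A B assms(2)])
  moreover have "teval C (tfam \<psi>) k s = teval C (tfam \<psi>) k t" if "t_rel A B k s t" for k s t
  proof -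
    have w: "twf TP C (tfam \<phi>) k s" "twf TP C (tfam \<phi>) k t"
      using t_rel_bd[OF A B assms(2) qf_pqf[OF assms(1)] that] by blast+
    have "teval C (tfam \<phi>) k s = teval C (tfam \<phi>) k t" using assms(1) that by (simp add: qf_def)
    then show ?thesis
      using twf_cong[of TP "tfam \<phi>", OF e w(1)] twf_cong[of TP "tfam \<phi>", OF e w(2)] by simp
  qed
  ultimately show ?thesis unfolding qf_def by blast
qed

end

section \<open>Precomposition and exchange of the two arguments\<close>

lemma qf_rel: "qf A B C \<phi> \<Longrightarrow> t_rel A B k s t \<Longrightarrow> teval C (tfam \<phi>) k s = teval C (tfam \<phi>) k t"
  by (simp add: qf_def)

lemma qf_precomp:
  assumes q: "qf A B C \<phi>" and F: "F \<in> Dbl A' A" and G: "G \<in> Dbl B' B"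
    and A': "double_category A'" and B': "double_category B'"
  shows "qf A' B' C (\<lambda>k x l y. \<phi> k (F k x) l (G l y))"
proof -
  note e = t_rel.intros[THEN qf_rel[OF q], simplified]
  note [simp] = Dbl_simps[OF F] Dbl_simps[OF G] Dbl_cell[OF F] Dbl_cell[OF G] dc[OF A'] dc[OF B']
  have "qf_bd A B C \<phi>" using q by (simp add: qf_def)
  note b = qf_bd_cells[OF this] qf_bd_eqs[OF this] and c = this[unfolded qf_bd_def, THEN conjunct1]
  have "qf_bd A' B' C (\<lambda>k x l y. \<phi> k (F k x) l (G l y))"
    unfolding qf_bd_def using c by (simp add: b)
  moreover have "teval C (tfam (\<lambda>k x l y. \<phi> k (F k x) l (G l y))) k s
      = teval C (tfam (\<lambda>k x l y. \<phi> k (F k x) l (G l y))) k t" if "t_rel A' B' k s t" for k s t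
    using that
  proof cases
    \<comment> \<open>In the four relations with composites on both sides the boundary maps have
      been moved inside the functors, where the rewrite rules no longer match; the relation is
      therefore instantiated at the image cells.\<close>
    case (H_natural K y)
    then show ?thesis using qf_rel[OF q t_rel.H_natural[of "F Hor K" A "G Sq y" B]] by simp
  next
    case (V_natural U y)
    then show ?thesis using qf_rel[OF q t_rel.V_natural[of "F Ver U" A "G Sq y" B]] by simp
  next
    case (modif_hor x k)
    then show ?thesis using qf_rel[OF q t_rel.modif_hor[of "F Sq x" A "G Hor k" B]] by simp
  next
    case (modif_ver x u)
    then show ?thesis using qf_rel[OF q t_rel.modif_ver[of "F Sq x" A "G Ver u" B]] by simp
  qed (simp_all add: e)
  ultimately show ?thesis unfolding qf_def by blast
qed

lemma join_comm: "join k l = join l k"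
  by (cases k; cases l) simp_all

text \<open>
  Reversing the vertical direction and exchanging the two factors permutes the generators and the
  relations of the tensor product.
\<close>

lemma qf_swap:
  assumes q: "qf A B C \<phi>"
  shows "qf (vop B) (vop A) (vop C) (\<lambda>k x l y. \<phi> l y k x)"
proof -
  note e = t_rel.intros[THEN qf_rel[OF q], simplified]
  have "qf_bd A B C \<phi>" using q by (simp add: qf_def)
  note b = qf_bd_cells[OF this] qf_bd_eqs[OF this] and c = this[unfolded qf_bd_def, THEN conjunct1]
  have c': "\<phi> l y k x \<in> cells C (join k l)"
    if "dim k + dim l \<le> 2" "x \<in> cells B k" "y \<in> cells A l" for k l x y
    using c that join_comm[of k l] by (metis add.commute)
  have "qf_bd (vop B) (vop A) (vop C) (\<lambda>k x l y. \<phi> l y k x)"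
    unfolding qf_bd_def by (simp add: b c')
  moreover have "teval (vop C) (tfam (\<lambda>k x l y. \<phi> l y k x)) k s
      = teval (vop C) (tfam (\<lambda>k x l y. \<phi> l y k x)) k t" if "t_rel (vop B) (vop A) k s t" for k s t
    using that by cases (simp_all add: e)
  ultimately show ?thesis unfolding qf_def by blast
qed

section \<open>Horizontal oplax and vertical lax transformations\<close>

lemma tdom_simps [simp]:
  "tdom B Ob = cells B Ob" "tdom B Hor = cells B Hor" "tdom B Ver = cells B Ver" "tdom B Sq = {}"
  by (simp_all add: tdom_def)

lemma hoplaxD:
  assumes "hoplax B C \<alpha>"
  shows "tsrc \<alpha> \<in> Dbl B C" "ttgt \<alpha> \<in> Dbl B C" "tmap \<alpha> k \<in> extensional (tdom B k)"
    "b \<in> cells B Ob \<Longrightarrow> tmap \<alpha> Ob b \<in> cells C Hor"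
    "b \<in> cells B Ob \<Longrightarrow> hsrc C (tmap \<alpha> Ob b) = tsrc \<alpha> Ob b"
    "b \<in> cells B Ob \<Longrightarrow> htgt C (tmap \<alpha> Ob b) = ttgt \<alpha> Ob b"
    "u \<in> cells B Ver \<Longrightarrow> tmap \<alpha> Ver u \<in> cells C Sq"
    "u \<in> cells B Ver \<Longrightarrow> tp C (tmap \<alpha> Ver u) = tmap \<alpha> Ob (vsrc B u)"
    "u \<in> cells B Ver \<Longrightarrow> bt C (tmap \<alpha> Ver u) = tmap \<alpha> Ob (vtgt B u)"
    "u \<in> cells B Ver \<Longrightarrow> lf C (tmap \<alpha> Ver u) = tsrc \<alpha> Ver u"
    "u \<in> cells B Ver \<Longrightarrow> rt C (tmap \<alpha> Ver u) = ttgt \<alpha> Ver u"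
    "f \<in> cells B Hor \<Longrightarrow> tmap \<alpha> Hor f \<in> cells C Sq"
    "f \<in> cells B Hor \<Longrightarrow> tp C (tmap \<alpha> Hor f) = hcmp C (tsrc \<alpha> Hor f) (tmap \<alpha> Ob (htgt B f))"
    "f \<in> cells B Hor \<Longrightarrow> bt C (tmap \<alpha> Hor f) = hcmp C (tmap \<alpha> Ob (hsrc B f)) (ttgt \<alpha> Hor f)"
    "f \<in> cells B Hor \<Longrightarrow> lf C (tmap \<alpha> Hor f) = vone C (tsrc \<alpha> Ob (hsrc B f))"
    "f \<in> cells B Hor \<Longrightarrow> rt C (tmap \<alpha> Hor f) = vone C (ttgt \<alpha> Ob (htgt B f))"
    "\<lbrakk>f \<in> cells B Hor; g \<in> cells B Hor; htgt B f = hsrc B g\<rbrakk> \<Longrightarrow>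
      tmap \<alpha> Hor (hcmp B f g) = vpst C (hpst C (idv C (tsrc \<alpha> Hor f)) (tmap \<alpha> Hor g))
        (hpst C (tmap \<alpha> Hor f) (idv C (ttgt \<alpha> Hor g)))"
    "b \<in> cells B Ob \<Longrightarrow> tmap \<alpha> Hor (hone B b) = idv C (tmap \<alpha> Ob b)"
    "\<lbrakk>u \<in> cells B Ver; v \<in> cells B Ver; vtgt B u = vsrc B v\<rbrakk> \<Longrightarrow>
      tmap \<alpha> Ver (vcmp B u v) = vpst C (tmap \<alpha> Ver u) (tmap \<alpha> Ver v)"
    "b \<in> cells B Ob \<Longrightarrow> tmap \<alpha> Ver (vone B b) = idv C (tmap \<alpha> Ob b)"
    "y \<in> cells B Sq \<Longrightarrow>
      vpst C (hpst C (tsrc \<alpha> Sq y) (tmap \<alpha> Ver (rt B y))) (tmap \<alpha> Hor (bt B y))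
      = vpst C (tmap \<alpha> Hor (tp B y)) (hpst C (tmap \<alpha> Ver (lf B y)) (ttgt \<alpha> Sq y))"
  using assms unfolding hoplax_def Let_def by simp_all

lemma vlaxD:
  assumes "vlax B C \<alpha>"
  shows "tsrc \<alpha> \<in> Dbl B C" "ttgt \<alpha> \<in> Dbl B C" "tmap \<alpha> k \<in> extensional (tdom B k)"
    "b \<in> cells B Ob \<Longrightarrow> tmap \<alpha> Ob b \<in> cells C Ver"
    "b \<in> cells B Ob \<Longrightarrow> vsrc C (tmap \<alpha> Ob b) = tsrc \<alpha> Ob b"
    "b \<in> cells B Ob \<Longrightarrow> vtgt C (tmap \<alpha> Ob b) = ttgt \<alpha> Ob b"
    "f \<in> cells B Hor \<Longrightarrow> tmap \<alpha> Hor f \<in> cells C Sq"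
    "f \<in> cells B Hor \<Longrightarrow> tp C (tmap \<alpha> Hor f) = tsrc \<alpha> Hor f"
    "f \<in> cells B Hor \<Longrightarrow> bt C (tmap \<alpha> Hor f) = ttgt \<alpha> Hor f"
    "f \<in> cells B Hor \<Longrightarrow> lf C (tmap \<alpha> Hor f) = tmap \<alpha> Ob (hsrc B f)"
    "f \<in> cells B Hor \<Longrightarrow> rt C (tmap \<alpha> Hor f) = tmap \<alpha> Ob (htgt B f)"
    "u \<in> cells B Ver \<Longrightarrow> tmap \<alpha> Ver u \<in> cells C Sq"
    "u \<in> cells B Ver \<Longrightarrow> tp C (tmap \<alpha> Ver u) = hone C (tsrc \<alpha> Ob (vsrc B u))"
    "u \<in> cells B Ver \<Longrightarrow> bt C (tmap \<alpha> Ver u) = hone C (ttgt \<alpha> Ob (vtgt B u))"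
    "u \<in> cells B Ver \<Longrightarrow> lf C (tmap \<alpha> Ver u) = vcmp C (tmap \<alpha> Ob (vsrc B u)) (ttgt \<alpha> Ver u)"
    "u \<in> cells B Ver \<Longrightarrow> rt C (tmap \<alpha> Ver u) = vcmp C (tsrc \<alpha> Ver u) (tmap \<alpha> Ob (vtgt B u))"
    "\<lbrakk>f \<in> cells B Hor; g \<in> cells B Hor; htgt B f = hsrc B g\<rbrakk> \<Longrightarrow>
      tmap \<alpha> Hor (hcmp B f g) = hpst C (tmap \<alpha> Hor f) (tmap \<alpha> Hor g)"
    "b \<in> cells B Ob \<Longrightarrow> tmap \<alpha> Hor (hone B b) = idh C (tmap \<alpha> Ob b)"
    "\<lbrakk>u \<in> cells B Ver; v \<in> cells B Ver; vtgt B u = vsrc B v\<rbrakk> \<Longrightarrow>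
      tmap \<alpha> Ver (vcmp B u v) = hpst C (vpst C (tmap \<alpha> Ver u) (idh C (ttgt \<alpha> Ver v)))
        (vpst C (idh C (tsrc \<alpha> Ver u)) (tmap \<alpha> Ver v))"
    "b \<in> cells B Ob \<Longrightarrow> tmap \<alpha> Ver (vone B b) = idh C (tmap \<alpha> Ob b)"
    "y \<in> cells B Sq \<Longrightarrow>
      hpst C (tmap \<alpha> Ver (lf B y)) (vpst C (tsrc \<alpha> Sq y) (tmap \<alpha> Hor (bt B y)))
      = hpst C (vpst C (tmap \<alpha> Hor (tp B y)) (ttgt \<alpha> Sq y)) (tmap \<alpha> Ver (rt B y))"
  using assms unfolding vlax_def Let_def by simp_all

lemma transf_eqI:
  fixes \<alpha> \<beta> :: "('b, 'c) transf"
  assumes "tsrc \<alpha> = tsrc \<beta>" "ttgt \<alpha> = ttgt \<beta>"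
    "\<And>k. tmap \<alpha> k \<in> extensional (tdom B k)" "\<And>k. tmap \<beta> k \<in> extensional (tdom B k)"
    "\<And>x. x \<in> cells B Ob \<Longrightarrow> tmap \<alpha> Ob x = tmap \<beta> Ob x"
    "\<And>x. x \<in> cells B Hor \<Longrightarrow> tmap \<alpha> Hor x = tmap \<beta> Hor x"
    "\<And>x. x \<in> cells B Ver \<Longrightarrow> tmap \<alpha> Ver x = tmap \<beta> Ver x"
  shows "\<alpha> = \<beta>"
proof -
  have "tmap \<alpha> k x = tmap \<beta> k x" if "x \<in> tdom B k" for k x
    using that assms(5-7) by (cases k) simp_all
  then have "tmap \<alpha> k = tmap \<beta> k" for k
    using extensionalityI[OF assms(3,4)] by blast
  then show ?thesis using assms(1,2) by (cases \<alpha>; cases \<beta>) (simp add: fun_eq_iff)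
qed

lemma htr_one_simps [simp]:
  "tsrc (htr_one B C F) = F" "ttgt (htr_one B C F) = F"
  "x \<in> cells B Ob \<Longrightarrow> tmap (htr_one B C F) Ob x = hone C (F Ob x)"
  "x \<in> cells B Hor \<Longrightarrow> tmap (htr_one B C F) Hor x = idv C (F Hor x)"
  "x \<in> cells B Ver \<Longrightarrow> tmap (htr_one B C F) Ver x = idh C (F Ver x)"
  "tmap (htr_one B C F) k \<in> extensional (tdom B k)"
  by (simp_all add: htr_one_def)

lemma vtr_one_simps [simp]:
  "tsrc (vtr_one B C F) = F" "ttgt (vtr_one B C F) = F"
  "x \<in> cells B Ob \<Longrightarrow> tmap (vtr_one B C F) Ob x = vone C (F Ob x)"
  "x \<in> cells B Hor \<Longrightarrow> tmap (vtr_one B C F) Hor x = idv C (F Hor x)"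
  "x \<in> cells B Ver \<Longrightarrow> tmap (vtr_one B C F) Ver x = idh C (F Ver x)"
  "tmap (vtr_one B C F) k \<in> extensional (tdom B k)"
  by (simp_all add: vtr_one_def)

lemma htr_cmp_simps [simp]:
  "tsrc (htr_cmp B C \<alpha> \<beta>) = tsrc \<alpha>" "ttgt (htr_cmp B C \<alpha> \<beta>) = ttgt \<beta>"
  "x \<in> cells B Ob \<Longrightarrow> tmap (htr_cmp B C \<alpha> \<beta>) Ob x = hcmp C (tmap \<alpha> Ob x) (tmap \<beta> Ob x)"
  "x \<in> cells B Hor \<Longrightarrow> tmap (htr_cmp B C \<alpha> \<beta>) Hor x
    = vpst C (hpst C (tmap \<alpha> Hor x) (idv C (tmap \<beta> Ob (htgt B x))))
             (hpst C (idv C (tmap \<alpha> Ob (hsrc B x))) (tmap \<beta> Hor x))"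
  "x \<in> cells B Ver \<Longrightarrow> tmap (htr_cmp B C \<alpha> \<beta>) Ver x = hpst C (tmap \<alpha> Ver x) (tmap \<beta> Ver x)"
  "tmap (htr_cmp B C \<alpha> \<beta>) k \<in> extensional (tdom B k)"
  by (simp_all add: htr_cmp_def)

lemma vtr_cmp_simps [simp]:
  "tsrc (vtr_cmp B C \<alpha> \<beta>) = tsrc \<alpha>" "ttgt (vtr_cmp B C \<alpha> \<beta>) = ttgt \<beta>"
  "x \<in> cells B Ob \<Longrightarrow> tmap (vtr_cmp B C \<alpha> \<beta>) Ob x = vcmp C (tmap \<alpha> Ob x) (tmap \<beta> Ob x)"
  "x \<in> cells B Hor \<Longrightarrow> tmap (vtr_cmp B C \<alpha> \<beta>) Hor x = vpst C (tmap \<alpha> Hor x) (tmap \<beta> Hor x)"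
  "x \<in> cells B Ver \<Longrightarrow> tmap (vtr_cmp B C \<alpha> \<beta>) Ver x
    = hpst C (vpst C (idh C (tmap \<alpha> Ob (vsrc B x))) (tmap \<beta> Ver x))
             (vpst C (tmap \<alpha> Ver x) (idh C (tmap \<beta> Ob (vtgt B x))))"
  "tmap (vtr_cmp B C \<alpha> \<beta>) k \<in> extensional (tdom B k)"
  by (simp_all add: vtr_cmp_def)

section \<open>Composition of horizontal oplax transformations\<close>

context
  fixes B :: "'b dblcat" and C :: "'c dblcat"
  assumes B: "double_category B" and C: "double_category C"
begin

lemma whisk_right:
  assumes "x \<in> cells C Sq" "y \<in> cells C Sq" "k \<in> cells C Hor" "bt C x = tp C y"
    "rt C x = vone C (hsrc C k)" "rt C y = vone C (hsrc C k)"
  shows "hpst C (vpst C x y) (idv C k) = vpst C (hpst C x (idv C k)) (hpst C y (idv C k))"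
  using dc_interchange[OF C, of x "idv C k" y "idv C k"] assms by (simp add: dc[OF C])

lemma whisk_left:
  assumes "x \<in> cells C Sq" "y \<in> cells C Sq" "k \<in> cells C Hor" "bt C x = tp C y"
    "lf C x = vone C (htgt C k)" "lf C y = vone C (htgt C k)"
  shows "hpst C (idv C k) (vpst C x y) = vpst C (hpst C (idv C k) x) (hpst C (idv C k) y)"
  using dc_interchange[OF C, of "idv C k" x "idv C k" y] assms by (simp add: dc[OF C])

text \<open>Two squares that meet along an identity 1v-cell may be performed in either order: by
  interchange both composites equal \<open>hpst C x y\<close>.\<close>

lemma slide:
  assumes "x \<in> cells C Sq" "y \<in> cells C Sq" "rt C x = vone C z" "lf C y = vone C z" "z \<in> cells C Ob"
  shows "vpst C (hpst C x (idv C (tp C y))) (hpst C (idv C (bt C x)) y)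
    = vpst C (hpst C (idv C (tp C x)) y) (hpst C x (idv C (bt C y)))"
proof -
  have e: "htgt C (bt C x) = z" "hsrc C (tp C y) = z" "htgt C (tp C x) = z" "hsrc C (bt C y) = z"
    using assms by (simp_all add: dc[OF C])
  have "vpst C (hpst C x (idv C (tp C y))) (hpst C (idv C (bt C x)) y) = hpst C x y"
    using dc_interchange[OF C, of x "idv C (tp C y)" "idv C (bt C x)" y] assms e
    by (simp add: dc[OF C] del: dc_corners)
  moreover have "vpst C (hpst C (idv C (tp C x)) y) (hpst C x (idv C (bt C y))) = hpst C x y"
    using dc_interchange[OF C, of "idv C (tp C x)" y x "idv C (bt C y)"] assms e
    by (simp add: dc[OF C] del: dc_corners)
  ultimately show ?thesis by simp
qed

text \<open>
  Gives both the naturality of a composite oplax transformation at squares and the first axiom for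
  a horizontal composite of modifications.
\<close>

lemma cylinder_comp:
  assumes cells: "p \<in> cells C Sq" "q \<in> cells C Sq" "d \<in> cells C Sq" "e \<in> cells C Sq" "r \<in> cells C Sq"
      "p' \<in> cells C Sq" "q' \<in> cells C Sq" "d' \<in> cells C Sq" "e' \<in> cells C Sq" "r' \<in> cells C Sq"
      "p'' \<in> cells C Sq"
    and h: "rt C p = lf C q" "rt C q = lf C q'" "rt C r = lf C p'" "rt C p' = lf C q'"
      "lf C r' = lf C p'" "rt C r' = lf C p''"
      "rt C d = lf C (idv C (bt C q'))" "rt C e = lf C (idv C (tp C q'))"
      "lf C d' = rt C (idv C (bt C r))" "lf C e' = rt C (idv C (tp C r))"
    and v: "tp C d = hcmp C (bt C p) (bt C q)" "bt C d = hcmp C (bt C r) (bt C p')"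
      "tp C e = hcmp C (tp C p) (tp C q)" "bt C e = hcmp C (tp C r) (tp C p')"
      "tp C d' = hcmp C (bt C p') (bt C q')" "bt C d' = hcmp C (bt C r') (bt C p'')"
      "tp C e' = hcmp C (tp C p') (tp C q')" "bt C e' = hcmp C (tp C r') (tp C p'')"
    and eq: "vpst C (hpst C p q) d = vpst C e (hpst C r p')"
      "vpst C (hpst C p' q') d' = vpst C e' (hpst C r' p'')"
  shows "vpst C (hpst C p (hpst C q q')) (vpst C (hpst C d (idv C (bt C q')))
      (hpst C (idv C (bt C r)) d'))
    = vpst C (vpst C (hpst C e (idv C (tp C q'))) (hpst C (idv C (tp C r)) e'))
        (hpst C (hpst C r r') p'')"
proof -
  note [simp] = cells h v dc[OF C]
  have i1: "vpst C (hpst C (hpst C p q) q') (hpst C d (idv C (bt C q')))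
      = hpst C (vpst C (hpst C p q) d) (vpst C q' (idv C (bt C q')))"
    by (rule dc_interchange[OF C]) simp_all
  have i2: "vpst C (hpst C e (idv C (tp C q'))) (hpst C (hpst C r p') q')
      = hpst C (vpst C e (hpst C r p')) (vpst C (idv C (tp C q')) q')"
    by (rule dc_interchange[OF C]) simp_all
  have i3: "vpst C (hpst C r (hpst C p' q')) (hpst C (idv C (bt C r)) d')
      = hpst C (vpst C r (idv C (bt C r))) (vpst C (hpst C p' q') d')"
    by (rule dc_interchange[OF C]) simp_all
  have i4: "vpst C (hpst C (idv C (tp C r)) e') (hpst C r (hpst C r' p''))
      = hpst C (vpst C (idv C (tp C r)) r) (vpst C e' (hpst C r' p''))"
    by (rule dc_interchange[OF C]) simp_all
  let ?E = "hpst C e (idv C (tp C q'))" and ?D' = "hpst C (idv C (bt C r)) d'"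
  \<comment> \<open>Interchange widens each hypothesis by an identity square to the full width of
    the composite. The first one is applied to the left part, which moves \<open>d\<close> up to
    \<open>e\<close>; the second one is then applied to the right part.\<close>
  have "vpst C (hpst C p (hpst C q q')) (vpst C (hpst C d (idv C (bt C q'))) ?D')
      = vpst C (vpst C (hpst C (hpst C p q) q') (hpst C d (idv C (bt C q')))) ?D'"
    by simp
  also have "\<dots> = vpst C (vpst C ?E (hpst C (hpst C r p') q')) ?D'"
    unfolding i1 i2 eq by simp
  also have "\<dots> = vpst C ?E (vpst C (hpst C r (hpst C p' q')) ?D')" by simp
  also have "\<dots> = vpst C ?E (vpst C (hpst C (idv C (tp C r)) e') (hpst C r (hpst C r' p'')))"
    unfolding i3 i4 eq by simp
  finally show ?thesis by simp
qed

lemma hoplax_one: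
  assumes F: "F \<in> Dbl B C"
  shows "hoplax B C (htr_one B C F)"
  unfolding hoplax_def Let_def using F
  by (simp add: Dbl_simps[OF F] Dbl_cell[OF F] dc[OF B] dc[OF C] dc_interchange[OF C])

lemma hoplax_cmp:
  assumes \<alpha>: "hoplax B C \<alpha>" and \<beta>: "hoplax B C \<beta>" and t: "ttgt \<alpha> = tsrc \<beta>"
  shows "hoplax B C (htr_cmp B C \<alpha> \<beta>)"
proof -
  note F = hoplaxD(1)[OF \<alpha>] and G = hoplaxD(1)[OF \<beta>] and H = hoplaxD(2)[OF \<beta>]
  note [simp] = t Dbl_simps[OF F] Dbl_cell[OF F] Dbl_simps[OF G] Dbl_cell[OF G]
    Dbl_simps[OF H] Dbl_cell[OF H] dc[OF B] dc[OF C] hoplaxD(4-20)[OF \<alpha>] hoplaxD(4-20)[OF \<beta>]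
  let ?d = "tmap (htr_cmp B C \<alpha> \<beta>) Hor" and ?s = "tmap (htr_cmp B C \<alpha> \<beta>) Ver"
  let ?F = "tsrc \<alpha>" and ?H = "ttgt \<beta>"
  have 1: "?d (hcmp B f g) = vpst C (hpst C (idv C (?F Hor f)) (?d g))
      (hpst C (?d f) (idv C (?H Hor g)))"
    if f: "f \<in> cells B Hor" and g: "g \<in> cells B Hor" and fg: "htgt B f = hsrc B g" for f g
  proof -
    note [simp] = f g fg
    let ?a = "tmap \<alpha> Hor f" and ?b = "tmap \<beta> Hor g"
    let ?i = "\<lambda>k. idv C k"
    \<comment> \<open>The component of \<alpha> at \<open>f\<close> and that of \<beta> at
      \<open>g\<close> occur in opposite orders on the two sides; they meet along an identity
      1v-cell and can be exchanged.\<close>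
    have s: "vpst C (hpst C ?a (hpst C (?i (tsrc \<beta> Hor g)) (?i (tmap \<beta> Ob (htgt B g)))))
        (hpst C (?i (tmap \<alpha> Ob (hsrc B f))) (hpst C (?i (tsrc \<beta> Hor f)) ?b))
      = vpst C (hpst C (?i (?F Hor f)) (hpst C (?i (tmap \<alpha> Ob (hsrc B g))) ?b))
         (hpst C ?a (hpst C (?i (tmap \<beta> Ob (hsrc B g))) (?i (?H Hor g))))"
      using slide[of ?a ?b "tsrc \<beta> Ob (hsrc B g)"] by simp
    \<comment> \<open>The same exchange with a tail \<open>X\<close>, since vertical pastings are
      associated to the right.\<close>
    have s': "vpst C (hpst C ?a (hpst C (?i (tsrc \<beta> Hor g)) (?i (tmap \<beta> Ob (htgt B g)))))
        (vpst C (hpst C (?i (tmap \<alpha> Ob (hsrc B f))) (hpst C (?i (tsrc \<beta> Hor f)) ?b)) X)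
      = vpst C (hpst C (?i (?F Hor f)) (hpst C (?i (tmap \<alpha> Ob (hsrc B g))) ?b))
         (vpst C (hpst C ?a (hpst C (?i (tmap \<beta> Ob (hsrc B g))) (?i (?H Hor g)))) X)"
      if "X \<in> cells C Sq" "tp C X = hcmp C (tmap \<alpha> Ob (hsrc B f)) (hcmp C (tsrc \<beta> Hor f)
         (hcmp C (tmap \<beta> Ob (hsrc B g)) (?H Hor g)))" for X
      using arg_cong[OF s, of "\<lambda>z. vpst C z X"] that by simp
    show ?thesis
      by (simp add: whisk_left whisk_right s')
  qed
  have 2: "vpst C (hpst C (?F Sq y) (?s (rt B y))) (?d (bt B y)) = vpst C (?d (tp B y))
      (hpst C (?s (lf B y)) (?H Sq y))"
    if [simp]: "y \<in> cells B Sq" for y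
    using cylinder_comp[OF _ _ _ _ _ _ _ _ _ _ _ _ _ _ _ _ _ _ _ _ _ _ _ _ _ _ _ _ _
        hoplaxD(21)[OF \<alpha> that] hoplaxD(21)[OF \<beta> that, folded t]] by simp
  show ?thesis
    unfolding hoplax_def Let_def using F H 1 2 by (simp add: dc_interchange[OF C])
qed

lemma htr_cmp_one:
  assumes \<alpha>: "hoplax B C \<alpha>"
  shows "htr_cmp B C (htr_one B C (tsrc \<alpha>)) \<alpha> = \<alpha>" "htr_cmp B C \<alpha> (htr_one B C (ttgt \<alpha>)) = \<alpha>"
proof -
  note F = hoplaxD(1)[OF \<alpha>] and G = hoplaxD(2)[OF \<alpha>]
  note [simp] = Dbl_simps[OF F] Dbl_cell[OF F] Dbl_simps[OF G] Dbl_cell[OF G]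
    dc[OF B] dc[OF C] hoplaxD(4-20)[OF \<alpha>]
  show "htr_cmp B C (htr_one B C (tsrc \<alpha>)) \<alpha> = \<alpha>"
    by (rule transf_eqI[of _ _ B]) (simp_all add: hoplaxD(3)[OF \<alpha>])
  show "htr_cmp B C \<alpha> (htr_one B C (ttgt \<alpha>)) = \<alpha>"
    by (rule transf_eqI[of _ _ B]) (simp_all add: hoplaxD(3)[OF \<alpha>])
qed

lemma htr_cmp_assoc:
  assumes \<alpha>: "hoplax B C \<alpha>" and \<beta>: "hoplax B C \<beta>" and \<gamma>: "hoplax B C \<gamma>"
    and t: "ttgt \<alpha> = tsrc \<beta>" "ttgt \<beta> = tsrc \<gamma>"
  shows "htr_cmp B C (htr_cmp B C \<alpha> \<beta>) \<gamma> = htr_cmp B C \<alpha> (htr_cmp B C \<beta> \<gamma>)"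
proof -
  note F = hoplaxD(1)[OF \<alpha>] and G = hoplaxD(1)[OF \<beta>] and H = hoplaxD(1)[OF \<gamma>] and K = hoplaxD(2)[OF \<gamma>]
  note [simp] = t Dbl_simps[OF F] Dbl_cell[OF F] Dbl_simps[OF G] Dbl_cell[OF G]
    Dbl_simps[OF H] Dbl_cell[OF H] Dbl_simps[OF K] Dbl_cell[OF K] dc[OF B] dc[OF C]
    hoplaxD(4-20)[OF \<alpha>] hoplaxD(4-20)[OF \<beta>] hoplaxD(4-20)[OF \<gamma>]
  show ?thesis
    by (rule transf_eqI[of _ _ B]) (simp_all add: whisk_left whisk_right)
qed

end

section \<open>Turning transformations and modifications\<close>

text \<open>\<open>rot\<close> sends vertical sources to horizontal sources but horizontal sources
  to vertical targets. A vertical transformation thus keeps its direction, while a horizontal one is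
  reversed; the latter is the purpose of \<open>trot'\<close>.\<close>

definition trot :: "('b, 'c) transf \<Rightarrow> ('b, 'c) transf" where
  "trot \<alpha> = \<lparr>tsrc = frot (tsrc \<alpha>), ttgt = frot (ttgt \<alpha>), tmap = (\<lambda>k. tmap \<alpha> (krot k))\<rparr>"

definition trot' :: "('b, 'c) transf \<Rightarrow> ('b, 'c) transf" where
  "trot' \<alpha> = \<lparr>tsrc = frot (ttgt \<alpha>), ttgt = frot (tsrc \<alpha>), tmap = (\<lambda>k. tmap \<alpha> (krot k))\<rparr>"

lemma trot_simps [simp]:
  "tsrc (trot \<alpha>) = frot (tsrc \<alpha>)" "ttgt (trot \<alpha>) = frot (ttgt \<alpha>)" "tmap (trot \<alpha>) k = tmap \<alpha> (krot k)"
  "tsrc (trot' \<alpha>) = frot (ttgt \<alpha>)" "ttgt (trot' \<alpha>) = frot (tsrc \<alpha>)" "tmap (trot' \<alpha>) k = tmap \<alpha> (krot k)"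
  by (simp_all add: trot_def trot'_def)

lemma frot_eq [simp]: "frot F = frot G \<longleftrightarrow> F = G"
  by (metis frot_simps(2))

lemma trot_eq [simp]: "trot \<alpha> = trot \<beta> \<longleftrightarrow> \<alpha> = \<beta>"
proof
  assume e: "trot \<alpha> = trot \<beta>"
  have "tmap \<alpha> k = tmap \<beta> k" for k
    using arg_cong[OF e, of "\<lambda>x. tmap x (krot k)"] by simp
  moreover have "tsrc \<alpha> = tsrc \<beta>" "ttgt \<alpha> = ttgt \<beta>"
    using arg_cong[OF e, of tsrc] arg_cong[OF e, of ttgt] by simp_all
  ultimately show "\<alpha> = \<beta>" by (cases \<alpha>; cases \<beta>) (simp add: fun_eq_iff)
qed simp

lemma tdom_rot [simp]: "tdom (rot B) k = tdom B (krot k)"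
  by (cases k) simp_all

lemma all_krot: "(\<forall>k. Q (krot k)) \<longleftrightarrow> (\<forall>k. Q k)"
  by (metis krot_krot)

text \<open>After the turn the two lists of axioms agree clause by clause, up to order. In
  particular the 2-cell \<open>\<alpha>\<^sub>0\<^sup>u\<close>, globular in the horizontal sense,
  becomes the oplax structure cell.\<close>

lemma vlax_rot: "vlax B C \<alpha> \<longleftrightarrow> hoplax (rot B) (rot C) (trot \<alpha>)"
  unfolding vlax_def hoplax_def Let_def
  using all_krot[of "\<lambda>k. tmap \<alpha> k \<in> extensional (tdom B k)"]
  by (simp add: Dbl_rot_iff) (auto 0 3)

lemma hoplax_rot: "hoplax B C \<alpha> \<longleftrightarrow> vlax (rot B) (rot C) (trot' \<alpha>)"
  unfolding vlax_def hoplax_def Let_def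
  using all_krot[of "\<lambda>k. tmap \<alpha> k \<in> extensional (tdom B k)"]
  by (simp add: Dbl_rot_iff) (auto 0 3)

lemma trot_cmp: "trot (vtr_cmp B C \<alpha> \<beta>) = htr_cmp (rot B) (rot C) (trot \<alpha>) (trot \<beta>)"
  by (rule transf_eqI[of _ _ "rot B"]) (simp_all add: htr_cmp_simps(6)[of "rot B", simplified])

lemma trot_one: "trot (vtr_one B C F) = htr_one (rot B) (rot C) (frot F)"
  by (rule transf_eqI[of _ _ "rot B"]) (simp_all add: htr_one_simps(6)[of "rot B", simplified])

section \<open>Composition of vertical lax transformations, by turning\<close>

context
  fixes B :: "'b dblcat" and C :: "'c dblcat"
  assumes B: "double_category B" and C: "double_category C"
begin

lemma vlax_one: "F \<in> Dbl B C \<Longrightarrow> vlax B C (vtr_one B C F)"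
  unfolding vlax_rot trot_one by (intro hoplax_one double_category_rot B C Dbl_rot)

lemma vlax_cmp: "vlax B C \<alpha> \<Longrightarrow> vlax B C \<beta> \<Longrightarrow> ttgt \<alpha> = tsrc \<beta> \<Longrightarrow> vlax B C (vtr_cmp B C \<alpha> \<beta>)"
  unfolding vlax_rot trot_cmp by (intro hoplax_cmp double_category_rot B C) simp_all

lemma vtr_cmp_one:
  assumes "vlax B C \<alpha>"
  shows "vtr_cmp B C (vtr_one B C (tsrc \<alpha>)) \<alpha> = \<alpha>" "vtr_cmp B C \<alpha> (vtr_one B C (ttgt \<alpha>)) = \<alpha>"
proof -
  note h = htr_cmp_one[OF double_category_rot[OF B] double_category_rot[OF C] assms[unfolded vlax_rot]]
  show "vtr_cmp B C (vtr_one B C (tsrc \<alpha>)) \<alpha> = \<alpha>"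
    by (rule trot_eq[THEN iffD1]) (use h in \<open>simp add: trot_cmp trot_one del: trot_eq\<close>)
  show "vtr_cmp B C \<alpha> (vtr_one B C (ttgt \<alpha>)) = \<alpha>"
    by (rule trot_eq[THEN iffD1]) (use h in \<open>simp add: trot_cmp trot_one del: trot_eq\<close>)
qed

lemma vtr_cmp_assoc:
  assumes "vlax B C \<alpha>" "vlax B C \<beta>" "vlax B C \<gamma>" "ttgt \<alpha> = tsrc \<beta>" "ttgt \<beta> = tsrc \<gamma>"
  shows "vtr_cmp B C (vtr_cmp B C \<alpha> \<beta>) \<gamma> = vtr_cmp B C \<alpha> (vtr_cmp B C \<beta> \<gamma>)"
proof -
  note h = htr_cmp_assoc[OF double_category_rot[OF B] double_category_rot[OF C]
      assms(1-3)[unfolded vlax_rot]]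
  show ?thesis
    by (rule trot_eq[THEN iffD1]) (use h assms(4,5) in \<open>simp add: trot_cmp del: trot_eq\<close>)
qed

end

section \<open>Modifications\<close>

lemma modificationD:
  assumes "modification B C \<Theta>"
  shows "hoplax B C (mtp \<Theta>)" "hoplax B C (mbt \<Theta>)" "vlax B C (mlf \<Theta>)" "vlax B C (mrt \<Theta>)"
    "tsrc (mtp \<Theta>) = tsrc (mlf \<Theta>)" "ttgt (mtp \<Theta>) = tsrc (mrt \<Theta>)" "tsrc (mbt \<Theta>) = ttgt (mlf \<Theta>)"
    "ttgt (mbt \<Theta>) = ttgt (mrt \<Theta>)" "mmap \<Theta> \<in> extensional (cells B Ob)"
    "b \<in> cells B Ob \<Longrightarrow> mmap \<Theta> b \<in> cells C Sq"
    "b \<in> cells B Ob \<Longrightarrow> tp C (mmap \<Theta> b) = tmap (mtp \<Theta>) Ob b"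
    "b \<in> cells B Ob \<Longrightarrow> bt C (mmap \<Theta> b) = tmap (mbt \<Theta>) Ob b"
    "b \<in> cells B Ob \<Longrightarrow> lf C (mmap \<Theta> b) = tmap (mlf \<Theta>) Ob b"
    "b \<in> cells B Ob \<Longrightarrow> rt C (mmap \<Theta> b) = tmap (mrt \<Theta>) Ob b"
    "f \<in> cells B Hor \<Longrightarrow>
      vpst C (hpst C (tmap (mlf \<Theta>) Hor f) (mmap \<Theta> (htgt B f))) (tmap (mbt \<Theta>) Hor f)
      = vpst C (tmap (mtp \<Theta>) Hor f) (hpst C (mmap \<Theta> (hsrc B f)) (tmap (mrt \<Theta>) Hor f))"
    "u \<in> cells B Ver \<Longrightarrow>
      hpst C (tmap (mlf \<Theta>) Ver u) (vpst C (tmap (mtp \<Theta>) Ver u) (mmap \<Theta> (vtgt B u)))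
      = hpst C (vpst C (mmap \<Theta> (vsrc B u)) (tmap (mbt \<Theta>) Ver u)) (tmap (mrt \<Theta>) Ver u)"
  using assms unfolding modification_def Let_def by simp_all

definition mod_idh :: "'b dblcat \<Rightarrow> 'c dblcat \<Rightarrow> ('b, 'c) transf \<Rightarrow> ('b, 'c) modif" where
  "mod_idh B C \<alpha> = \<lparr>mtp = htr_one B C (tsrc \<alpha>), mbt = htr_one B C (ttgt \<alpha>), mlf = \<alpha>, mrt = \<alpha>,
     mmap = (\<lambda>b\<in>cells B Ob. idh C (tmap \<alpha> Ob b))\<rparr>"

definition mod_idv :: "'b dblcat \<Rightarrow> 'c dblcat \<Rightarrow> ('b, 'c) transf \<Rightarrow> ('b, 'c) modif" where
  "mod_idv B C \<alpha> = \<lparr>mtp = \<alpha>, mbt = \<alpha>, mlf = vtr_one B C (tsrc \<alpha>), mrt = vtr_one B C (ttgt \<alpha>),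
     mmap = (\<lambda>b\<in>cells B Ob. idv C (tmap \<alpha> Ob b))\<rparr>"

definition mod_h :: "'b dblcat \<Rightarrow> 'c dblcat \<Rightarrow> ('b, 'c) modif \<Rightarrow> ('b, 'c) modif \<Rightarrow> ('b, 'c) modif" where
  "mod_h B C \<Theta> \<Psi> = \<lparr>mtp = htr_cmp B C (mtp \<Theta>) (mtp \<Psi>), mbt = htr_cmp B C (mbt \<Theta>) (mbt \<Psi>),
     mlf = mlf \<Theta>, mrt = mrt \<Psi>, mmap = (\<lambda>b\<in>cells B Ob. hpst C (mmap \<Theta> b) (mmap \<Psi> b))\<rparr>"

definition mod_v :: "'b dblcat \<Rightarrow> 'c dblcat \<Rightarrow> ('b, 'c) modif \<Rightarrow> ('b, 'c) modif \<Rightarrow> ('b, 'c) modif" where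
  "mod_v B C \<Theta> \<Psi> = \<lparr>mtp = mtp \<Theta>, mbt = mbt \<Psi>, mlf = vtr_cmp B C (mlf \<Theta>) (mlf \<Psi>),
     mrt = vtr_cmp B C (mrt \<Theta>) (mrt \<Psi>), mmap = (\<lambda>b\<in>cells B Ob. vpst C (mmap \<Theta> b) (mmap \<Psi> b))\<rparr>"

definition mrot :: "('b, 'c) modif \<Rightarrow> ('b, 'c) modif" where
  "mrot \<Theta> = \<lparr>mtp = trot (mrt \<Theta>), mbt = trot (mlf \<Theta>), mlf = trot' (mtp \<Theta>), mrt = trot' (mbt \<Theta>),
     mmap = mmap \<Theta>\<rparr>"

lemma modification_rot: "modification B C \<Theta> \<longleftrightarrow> modification (rot B) (rot C) (mrot \<Theta>)"
  unfolding modification_def Let_def mrot_def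
  by (simp add: vlax_rot[of B C] hoplax_rot[of B C]) (auto 0 3)

lemma mrot_mod_v: "mrot (mod_v B C \<Theta> \<Psi>) = mod_h (rot B) (rot C) (mrot \<Theta>) (mrot \<Psi>)"
  by (simp add: mrot_def mod_v_def mod_h_def trot_cmp)

context
  fixes B :: "'b dblcat" and C :: "'c dblcat"
  assumes B: "double_category B" and C: "double_category C"
begin

lemma modification_idh:
  assumes \<alpha>: "vlax B C \<alpha>"
  shows "modification B C (mod_idh B C \<alpha>)"
proof -
  note F = vlaxD(1)[OF \<alpha>] and G = vlaxD(2)[OF \<alpha>]
  note [simp] = Dbl_simps[OF F] Dbl_cell[OF F] Dbl_simps[OF G] Dbl_cell[OF G]
    dc[OF B] dc[OF C] vlaxD(4-20)[OF \<alpha>]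
  show ?thesis
    unfolding modification_def Let_def using \<alpha> F G by (simp add: mod_idh_def hoplax_one[OF B C])
qed

lemma modification_idv:
  assumes \<alpha>: "hoplax B C \<alpha>"
  shows "modification B C (mod_idv B C \<alpha>)"
proof -
  note F = hoplaxD(1)[OF \<alpha>] and G = hoplaxD(2)[OF \<alpha>]
  note [simp] = Dbl_simps[OF F] Dbl_cell[OF F] Dbl_simps[OF G] Dbl_cell[OF G]
    dc[OF B] dc[OF C] hoplaxD(4-20)[OF \<alpha>]
  show ?thesis
    unfolding modification_def Let_def using \<alpha> F G by (simp add: mod_idv_def vlax_one[OF B C])
qed

lemma modification_h:
  assumes \<Theta>: "modification B C \<Theta>" and \<Psi>: "modification B C \<Psi>" and t: "mrt \<Theta> = mlf \<Psi>"
  shows "modification B C (mod_h B C \<Theta> \<Psi>)"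
proof -
  note h = modificationD(1,2)[OF \<Theta>] modificationD(1,2)[OF \<Psi>]
  note l = modificationD(3)[OF \<Theta>] modificationD(3,4)[OF \<Psi>]
  note F = hoplaxD(1)[OF h(1)] hoplaxD(2)[OF h(1)] hoplaxD(1)[OF h(2)] hoplaxD(2)[OF h(2)]
    hoplaxD(2)[OF h(3)] hoplaxD(2)[OF h(4)]
  note eqs = modificationD(5-8)[OF \<Theta>] modificationD(5-8)[OF \<Psi>]
  note D = F[unfolded eqs t]
  note [simp] = t eqs dc[OF B] dc[OF C] hoplaxD(4-16)[OF h(1)] hoplaxD(4-16)[OF h(2)]
    hoplaxD(4-16)[OF h(3)] hoplaxD(4-16)[OF h(4)] vlaxD(4-16)[OF l(1)] vlaxD(4-16)[OF l(2)]
    vlaxD(4-16)[OF l(3)] modificationD(10-14)[OF \<Theta>] modificationD(10-14)[OF \<Psi>]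
    Dbl_simps[OF D(1)] Dbl_simps[OF D(2)] Dbl_simps[OF D(3)] Dbl_simps[OF D(4)]
    Dbl_simps[OF D(5)] Dbl_simps[OF D(6)]
    Dbl_cell[OF D(1)] Dbl_cell[OF D(2)] Dbl_cell[OF D(3)] Dbl_cell[OF D(4)] Dbl_cell[OF D(5)]
        Dbl_cell[OF D(6)]
  let ?T = "mod_h B C \<Theta> \<Psi>"
  have 1: "vpst C (hpst C (tmap (mlf ?T) Hor f) (mmap ?T (htgt B f))) (tmap (mbt ?T) Hor f)
      = vpst C (tmap (mtp ?T) Hor f) (hpst C (mmap ?T (hsrc B f)) (tmap (mrt ?T) Hor f))"
    if [simp]: "f \<in> cells B Hor" for f
    using cylinder_comp[OF B C _ _ _ _ _ _ _ _ _ _ _ _ _ _ _ _ _ _ _ _ _ _ _ _ _ _ _ _ _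
        modificationD(15)[OF \<Theta> that] modificationD(15)[OF \<Psi> that, folded t]]
    by (simp add: mod_h_def)
  \<comment> \<open>At a 1v-cell the components of a composite are pasted horizontally without
    whiskering, so interchange lets the axioms of \<Theta> and \<Psi> be applied one after the
    other.\<close>
  have 2: "hpst C (tmap (mlf ?T) Ver u) (vpst C (tmap (mtp ?T) Ver u) (mmap ?T (vtgt B u)))
      = hpst C (vpst C (mmap ?T (vsrc B u)) (tmap (mbt ?T) Ver u)) (tmap (mrt ?T) Ver u)"
    if [simp]: "u \<in> cells B Ver" for u
  proof -
    let ?a = "tmap (mtp \<Theta>) Ver u" and ?m = "mmap \<Theta>" and ?a' = "tmap (mtp \<Psi>) Ver u" and ?m' = "mmap \<Psi>"
    let ?b = "tmap (mbt \<Theta>) Ver u" and ?b' = "tmap (mbt \<Psi>) Ver u"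
    have "hpst C (tmap (mlf \<Theta>) Ver u) (vpst C (hpst C ?a ?a') (hpst C (?m (vtgt B u)) (?m' (vtgt B u))))
        = hpst C (hpst C (tmap (mlf \<Theta>) Ver u) (vpst C ?a (?m (vtgt B u))))
          (vpst C ?a' (?m' (vtgt B u)))"
      by (simp add: dc_interchange[OF C])
    also have "\<dots> = hpst C (vpst C (?m (vsrc B u)) ?b)
        (hpst C (tmap (mlf \<Psi>) Ver u) (vpst C ?a' (?m' (vtgt B u))))"
      unfolding modificationD(16)[OF \<Theta> that] by simp
    also have "\<dots> = hpst C (vpst C (hpst C (?m (vsrc B u)) (?m' (vsrc B u))) (hpst C ?b ?b'))
        (tmap (mrt \<Psi>) Ver u)"
      unfolding modificationD(16)[OF \<Psi> that] by (simp add: dc_interchange[OF C])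
    finally show ?thesis by (simp add: mod_h_def)
  qed
  show ?thesis
    unfolding modification_def Let_def using 1 2 h l
    by (simp add: hoplax_cmp[OF B C]) (simp add: mod_h_def hoplax_cmp[OF B C])
qed

end

text \<open>The turn carries vertical pasting to horizontal pasting and exchanges the two
  modification axioms.\<close>

lemma modification_v:
  assumes "double_category B" "double_category C"
    and "modification B C \<Theta>" "modification B C \<Psi>" "mbt \<Theta> = mtp \<Psi>"
  shows "modification B C (mod_v B C \<Theta> \<Psi>)"
  using modification_h[OF assms(1,2)[THEN double_category_rot], of "mrot \<Theta>" "mrot \<Psi>"] assms(3-5)
  by (simp add: modification_rot[of B C] mrot_mod_v) (simp add: mrot_def)

lemma mod_simps [simp]:
  "mtp (mod_idh B C \<alpha>) = htr_one B C (tsrc \<alpha>)" "mbt (mod_idh B C \<alpha>) = htr_one B C (ttgt \<alpha>)"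
  "mlf (mod_idh B C \<alpha>) = \<alpha>" "mrt (mod_idh B C \<alpha>) = \<alpha>"
  "b \<in> cells B Ob \<Longrightarrow> mmap (mod_idh B C \<alpha>) b = idh C (tmap \<alpha> Ob b)"
  "mmap (mod_idh B C \<alpha>) \<in> extensional (cells B Ob)"
  "mtp (mod_idv B C \<alpha>) = \<alpha>" "mbt (mod_idv B C \<alpha>) = \<alpha>"
  "mlf (mod_idv B C \<alpha>) = vtr_one B C (tsrc \<alpha>)" "mrt (mod_idv B C \<alpha>) = vtr_one B C (ttgt \<alpha>)"
  "b \<in> cells B Ob \<Longrightarrow> mmap (mod_idv B C \<alpha>) b = idv C (tmap \<alpha> Ob b)"
  "mmap (mod_idv B C \<alpha>) \<in> extensional (cells B Ob)"
  "mtp (mod_h B C \<Theta> \<Psi>) = htr_cmp B C (mtp \<Theta>) (mtp \<Psi>)"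
  "mbt (mod_h B C \<Theta> \<Psi>) = htr_cmp B C (mbt \<Theta>) (mbt \<Psi>)"
  "mlf (mod_h B C \<Theta> \<Psi>) = mlf \<Theta>" "mrt (mod_h B C \<Theta> \<Psi>) = mrt \<Psi>"
  "b \<in> cells B Ob \<Longrightarrow> mmap (mod_h B C \<Theta> \<Psi>) b = hpst C (mmap \<Theta> b) (mmap \<Psi> b)"
  "mmap (mod_h B C \<Theta> \<Psi>) \<in> extensional (cells B Ob)"
  "mlf (mod_v B C \<Theta> \<Psi>) = vtr_cmp B C (mlf \<Theta>) (mlf \<Psi>)"
  "mrt (mod_v B C \<Theta> \<Psi>) = vtr_cmp B C (mrt \<Theta>) (mrt \<Psi>)"
  "mtp (mod_v B C \<Theta> \<Psi>) = mtp \<Theta>" "mbt (mod_v B C \<Theta> \<Psi>) = mbt \<Psi>"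
  "b \<in> cells B Ob \<Longrightarrow> mmap (mod_v B C \<Theta> \<Psi>) b = vpst C (mmap \<Theta> b) (mmap \<Psi> b)"
  "mmap (mod_v B C \<Theta> \<Psi>) \<in> extensional (cells B Ob)"
  by (simp_all add: mod_idh_def mod_idv_def mod_h_def mod_v_def)

lemma modif_eqI:
  fixes \<Theta> \<Psi> :: "('b, 'c) modif"
  assumes "mtp \<Theta> = mtp \<Psi>" "mbt \<Theta> = mbt \<Psi>" "mlf \<Theta> = mlf \<Psi>" "mrt \<Theta> = mrt \<Psi>"
    "mmap \<Theta> \<in> extensional X" "mmap \<Psi> \<in> extensional X" "\<And>b. b \<in> X \<Longrightarrow> mmap \<Theta> b = mmap \<Psi> b"
  shows "\<Theta> = \<Psi>"
  using assms(1-4) extensionalityI[OF assms(5-7)] by (cases \<Theta>; cases \<Psi>) simp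

section \<open>The double category \<open>Dbl_hop\<close>\<close>

lemma Dbl_hop_simps [simp]:
  "cells (Dbl_hop B C) Ob = FunC ` Dbl B C"
  "cells (Dbl_hop B C) Hor = HTrC ` {\<alpha>. hoplax B C \<alpha>}"
  "cells (Dbl_hop B C) Ver = VTrC ` {\<alpha>. vlax B C \<alpha>}"
  "cells (Dbl_hop B C) Sq = ModC ` {\<Theta>. modification B C \<Theta>}"
  "hsrc (Dbl_hop B C) (HTrC \<alpha>) = FunC (tsrc \<alpha>)" "htgt (Dbl_hop B C) (HTrC \<alpha>) = FunC (ttgt \<alpha>)"
  "vsrc (Dbl_hop B C) (VTrC \<alpha>) = FunC (tsrc \<alpha>)" "vtgt (Dbl_hop B C) (VTrC \<alpha>) = FunC (ttgt \<alpha>)"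
  "tp (Dbl_hop B C) (ModC \<Theta>) = HTrC (mtp \<Theta>)" "bt (Dbl_hop B C) (ModC \<Theta>) = HTrC (mbt \<Theta>)"
  "lf (Dbl_hop B C) (ModC \<Theta>) = VTrC (mlf \<Theta>)" "rt (Dbl_hop B C) (ModC \<Theta>) = VTrC (mrt \<Theta>)"
  "hone (Dbl_hop B C) (FunC F) = HTrC (htr_one B C F)"
    "vone (Dbl_hop B C) (FunC F) = VTrC (vtr_one B C F)"
  "hcmp (Dbl_hop B C) (HTrC \<alpha>) (HTrC \<beta>) = HTrC (htr_cmp B C \<alpha> \<beta>)"
  "vcmp (Dbl_hop B C) (VTrC \<alpha>) (VTrC \<beta>) = VTrC (vtr_cmp B C \<alpha> \<beta>)"
  "idh (Dbl_hop B C) (VTrC \<alpha>) = ModC (mod_idh B C \<alpha>)"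
  "idv (Dbl_hop B C) (HTrC \<alpha>) = ModC (mod_idv B C \<alpha>)"
  "hpst (Dbl_hop B C) (ModC \<Theta>) (ModC \<Psi>) = ModC (mod_h B C \<Theta> \<Psi>)"
  "vpst (Dbl_hop B C) (ModC \<Theta>) (ModC \<Psi>) = ModC (mod_v B C \<Theta> \<Psi>)"
  by (simp_all add: Dbl_hop_def mod_idh_def mod_idv_def mod_h_def mod_v_def Let_def)

lemma hopcell_mem [simp]:
  "FunC F \<in> FunC ` X \<longleftrightarrow> F \<in> X" "HTrC \<alpha> \<in> HTrC ` Y \<longleftrightarrow> \<alpha> \<in> Y"
  "VTrC \<alpha> \<in> VTrC ` Y \<longleftrightarrow> \<alpha> \<in> Y" "ModC \<Theta> \<in> ModC ` Z \<longleftrightarrow> \<Theta> \<in> Z"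
  by (auto simp: image_iff)

text \<open>By \<open>modif_eqI\<close> a law for modifications splits into laws for the bounding
  transformations, proved above, and the same law in \<open>C\<close> at every object of
  \<open>B\<close>.\<close>

lemma double_category_hop:
  fixes B :: "'b dblcat" and C :: "'c dblcat"
  assumes B: "double_category B" and C: "double_category C"
  shows "double_category (Dbl_hop B C)"
proof -
  let ?D = "Dbl_hop B C"
  note s = hoplaxD(1,2) vlaxD(1,2) hoplax_one[OF B C] hoplax_cmp[OF B C] vlax_one[OF B C]
      vlax_cmp[OF B C]
    modificationD(1-8) modification_idh[OF B C] modification_idv[OF B C] modification_h[OF B C]
    modification_v[OF B C] htr_cmp_one[OF B C] vtr_cmp_one[OF B C] htr_cmp_assoc[OF B C]
        vtr_cmp_assoc[OF B C]
  have cat1: "category_on (cells ?D Ob) (cells ?D Hor) (hsrc ?D) (htgt ?D) (hone ?D) (hcmp ?D)"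
    "category_on (cells ?D Ob) (cells ?D Ver) (vsrc ?D) (vtgt ?D) (vone ?D) (vcmp ?D)"
    unfolding category_on_def by (simp_all add: s)
  have "mod_h B C (mod_idh B C (mlf \<Theta>)) \<Theta> = \<Theta>" "mod_h B C \<Theta> (mod_idh B C (mrt \<Theta>)) = \<Theta>"
    "mod_v B C (mod_idv B C (mtp \<Theta>)) \<Theta> = \<Theta>" "mod_v B C \<Theta> (mod_idv B C (mbt \<Theta>)) = \<Theta>"
    if m: "modification B C \<Theta>" for \<Theta>
  proof -
    note d = modificationD[OF m]
    note [simp] = d htr_cmp_one[OF B C d(1), unfolded d(5-8)] htr_cmp_one[OF B C d(2), unfolded d(5-8)]
      vtr_cmp_one[OF B C d(3)] vtr_cmp_one[OF B C d(4)] dc[OF C]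
    show "mod_h B C (mod_idh B C (mlf \<Theta>)) \<Theta> = \<Theta>" "mod_h B C \<Theta> (mod_idh B C (mrt \<Theta>)) = \<Theta>"
      "mod_v B C (mod_idv B C (mtp \<Theta>)) \<Theta> = \<Theta>" "mod_v B C \<Theta> (mod_idv B C (mbt \<Theta>)) = \<Theta>"
      by (rule modif_eqI[of _ _ "cells B Ob"]; simp add: vlaxD(4) [OF d(3)] vlaxD(4)[OF d(4)]
        hoplaxD(4)[OF d(1)] hoplaxD(4)[OF d(2)])+
  qed
  moreover have "mod_h B C (mod_h B C \<Theta> \<Psi>) \<Phi> = mod_h B C \<Theta> (mod_h B C \<Psi> \<Phi>)"
    if m: "modification B C \<Theta>" "modification B C \<Psi>" "modification B C \<Phi>" "mrt \<Theta> = mlf \<Psi>" "mrt \<Psi> = mlf \<Phi>"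
    for \<Theta> \<Psi> \<Phi>
    by (rule modif_eqI[of _ _ "cells B Ob"])
      (simp_all add: m htr_cmp_assoc[OF B C] modificationD[OF m(1)] modificationD[OF m(2)]
        modificationD[OF m(3)] dc[OF C])
  moreover have "mod_v B C (mod_v B C \<Theta> \<Psi>) \<Phi> = mod_v B C \<Theta> (mod_v B C \<Psi> \<Phi>)"
    if m: "modification B C \<Theta>" "modification B C \<Psi>" "modification B C \<Phi>" "mbt \<Theta> = mtp \<Psi>" "mbt \<Psi> = mtp \<Phi>"
    for \<Theta> \<Psi> \<Phi>
  proof (rule modif_eqI[of _ _ "cells B Ob"])
    \<comment> \<open>The sides of vertically composable modifications are composable because their
      ends are ends of the shared horizontal transformation.\<close>
    have "ttgt (mlf \<Theta>) = tsrc (mlf \<Psi>)" "ttgt (mlf \<Psi>) = tsrc (mlf \<Phi>)"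
      "ttgt (mrt \<Theta>) = tsrc (mrt \<Psi>)" "ttgt (mrt \<Psi>) = tsrc (mrt \<Phi>)"
      using m modificationD(5-8) by metis+
    then show "mlf (mod_v B C (mod_v B C \<Theta> \<Psi>) \<Phi>) = mlf (mod_v B C \<Theta> (mod_v B C \<Psi> \<Phi>))"
      "mrt (mod_v B C (mod_v B C \<Theta> \<Psi>) \<Phi>) = mrt (mod_v B C \<Theta> (mod_v B C \<Psi> \<Phi>))"
      by (simp_all add: vtr_cmp_assoc[OF B C modificationD(3)[OF m(1)] modificationD(3)[OF m(2)]
        modificationD(3)[OF m(3)]]
          vtr_cmp_assoc[OF B C modificationD(4)[OF m(1)] modificationD(4)[OF m(2)]
            modificationD(4)[OF m(3)]])
  qed (simp_all add: m modificationD[OF m(1)] modificationD[OF m(2)] modificationD[OF m(3)] dc[OF C])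
  ultimately have
    "category_on (cells ?D Ver) (cells ?D Sq) (lf ?D) (rt ?D) (idh ?D) (hpst ?D)"
    "category_on (cells ?D Hor) (cells ?D Sq) (tp ?D) (bt ?D) (idv ?D) (vpst ?D)"
    unfolding category_on_def by (simp_all add: modificationD(1-4) modification_idh[OF B C]
        modification_idv[OF B C]
        modification_h[OF B C] modification_v[OF B C])
  moreover have
    "mod_idh B C (vtr_one B C F) = mod_idv B C (htr_one B C F)" if "F \<in> Dbl B C" for F
    using that by (intro modif_eqI[of _ _ "cells B Ob"]) (simp_all add: Dbl_cell[OF that] dc[OF C])
  moreover have "mod_idv B C (htr_cmp B C \<alpha> \<beta>) = mod_h B C (mod_idv B C \<alpha>) (mod_idv B C \<beta>)"
    if "hoplax B C \<alpha>" "hoplax B C \<beta>" "ttgt \<alpha> = tsrc \<beta>" for \<alpha> \<beta>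
    using that by (intro modif_eqI[of _ _ "cells B Ob"]) (simp_all add: hoplaxD(4-6) dc[OF C])
  moreover have "mod_idh B C (vtr_cmp B C \<alpha> \<beta>) = mod_v B C (mod_idh B C \<alpha>) (mod_idh B C \<beta>)"
    if "vlax B C \<alpha>" "vlax B C \<beta>" "ttgt \<alpha> = tsrc \<beta>" for \<alpha> \<beta>
    using that by (intro modif_eqI[of _ _ "cells B Ob"]) (simp_all add: vlaxD(4-6) dc[OF C])
  moreover have "mod_v B C (mod_h B C \<Theta> \<Psi>) (mod_h B C \<Theta>' \<Psi>') = mod_h B C (mod_v B C \<Theta> \<Theta>')
      (mod_v B C \<Psi> \<Psi>')"
    if "modification B C \<Theta>" "modification B C \<Psi>" "modification B C \<Theta>'" "modification B C \<Psi>'"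
      "mrt \<Theta> = mlf \<Psi>" "mrt \<Theta>' = mlf \<Psi>'" "mbt \<Theta> = mtp \<Theta>'" "mbt \<Psi> = mtp \<Psi>'" for \<Theta> \<Psi> \<Theta>' \<Psi>'
    using that by (intro modif_eqI[of _ _ "cells B Ob"]) (simp_all add: modificationD(10-14)
        dc_interchange[OF C])
  ultimately show ?thesis
    using cat1 unfolding double_category_def by (simp add: modificationD)
qed

section \<open>Transposition\<close>

lemma slice_simps [simp]:
  "y \<in> cells B l \<Longrightarrow> slice_fun B \<phi> x l y = \<phi> Ob x l y"
  "slice_fun B \<phi> x l \<in> extensional (cells B l)"
  "tsrc (slice_htr A B \<phi> x) = slice_fun B \<phi> (hsrc A x)"
    "ttgt (slice_htr A B \<phi> x) = slice_fun B \<phi> (htgt A x)"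
  "y \<in> tdom B l \<Longrightarrow> tmap (slice_htr A B \<phi> x) l y = \<phi> Hor x l y"
  "tmap (slice_htr A B \<phi> x) l \<in> extensional (tdom B l)"
  "tsrc (slice_vtr A B \<phi> x) = slice_fun B \<phi> (vsrc A x)"
    "ttgt (slice_vtr A B \<phi> x) = slice_fun B \<phi> (vtgt A x)"
  "y \<in> tdom B l \<Longrightarrow> tmap (slice_vtr A B \<phi> x) l y = \<phi> Ver x l y"
  "tmap (slice_vtr A B \<phi> x) l \<in> extensional (tdom B l)"
  by (simp_all add: slice_fun_def slice_htr_def slice_vtr_def)

definition slice_mod ::
  "'x dblcat \<Rightarrow> 'b dblcat \<Rightarrow> (kind \<Rightarrow> 'x \<Rightarrow> kind \<Rightarrow> 'b \<Rightarrow> 'c) \<Rightarrow> 'x \<Rightarrow> ('b, 'c) modif" where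
  "slice_mod A B \<phi> x = \<lparr>mtp = slice_htr A B \<phi> (tp A x), mbt = slice_htr A B \<phi> (bt A x),
     mlf = slice_vtr A B \<phi> (lf A x), mrt = slice_vtr A B \<phi> (rt A x),
     mmap = (\<lambda>b\<in>cells B Ob. \<phi> Sq x Ob b)\<rparr>"

lemma slice_mod_simps [simp]:
  "mtp (slice_mod A B \<phi> x) = slice_htr A B \<phi> (tp A x)"
    "mbt (slice_mod A B \<phi> x) = slice_htr A B \<phi> (bt A x)"
  "mlf (slice_mod A B \<phi> x) = slice_vtr A B \<phi> (lf A x)"
    "mrt (slice_mod A B \<phi> x) = slice_vtr A B \<phi> (rt A x)"
  "b \<in> cells B Ob \<Longrightarrow> mmap (slice_mod A B \<phi> x) b = \<phi> Sq x Ob b"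
  "mmap (slice_mod A B \<phi> x) \<in> extensional (cells B Ob)"
  by (simp_all add: slice_mod_def)

lemma transpose_simps [simp]:
  "x \<in> cells A Ob \<Longrightarrow> transpose A B \<phi> Ob x = FunC (slice_fun B \<phi> x)"
  "x \<in> cells A Hor \<Longrightarrow> transpose A B \<phi> Hor x = HTrC (slice_htr A B \<phi> x)"
  "x \<in> cells A Ver \<Longrightarrow> transpose A B \<phi> Ver x = VTrC (slice_vtr A B \<phi> x)"
  "x \<in> cells A Sq \<Longrightarrow> transpose A B \<phi> Sq x = ModC (slice_mod A B \<phi> x)"
  by (simp_all add: transpose_def slice_mod_def)

lemma transpose_ext: "transpose A B \<phi> k \<in> extensional (cells A k)"
  by (simp add: transpose_def)

text \<open>Slices look at \<phi> only on pairs of total dimension at most two, which are exactly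
  the pairs that name generators.\<close>

lemma transpose_cong:
  assumes A: "double_category A"
    and e: "\<And>k l x y. \<lbrakk>dim k + dim l \<le> 2; x \<in> cells A k; y \<in> cells B l\<rbrakk> \<Longrightarrow> \<phi> k x l y = \<psi> k x l y"
  shows "transpose A B \<phi> = transpose A B \<psi>"
proof -
  have f: "slice_fun B \<phi> x = slice_fun B \<psi> x" if "x \<in> cells A Ob" for x
  proof (rule dblfun_eqI[of _ B])
    show "slice_fun B \<phi> x k y = slice_fun B \<psi> x k y" if "y \<in> cells B k" for k y
      using that \<open>x \<in> cells A Ob\<close> e[of Ob k x y] by (cases k) simp_all
  qed simp_all
  have h: "slice_htr A B \<phi> x = slice_htr A B \<psi> x" if "x \<in> cells A Hor" for x
    by (rule transf_eqI[of _ _ B]) (use that e[of Hor] f in \<open>simp_all add: dc[OF A]\<close>)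
  have v: "slice_vtr A B \<phi> x = slice_vtr A B \<psi> x" if "x \<in> cells A Ver" for x
    by (rule transf_eqI[of _ _ B]) (use that e[of Ver] f in \<open>simp_all add: dc[OF A]\<close>)
  have m: "slice_mod A B \<phi> x = slice_mod A B \<psi> x" if "x \<in> cells A Sq" for x
    by (rule modif_eqI[of _ _ "cells B Ob"]) (use that e[of Sq Ob] h v in \<open>simp_all add: dc[OF A]\<close>)
  have "transpose A B \<phi> k x = transpose A B \<psi> k x" if "x \<in> cells A k" for k x
    using that f h v m by (cases k) simp_all
  then show ?thesis by (rule dblfun_eqI[OF transpose_ext transpose_ext])
qed

lemma transpose_inj:
  assumes "transpose A B \<phi> = transpose A B \<psi>" "dim k + dim l \<le> 2" "x \<in> cells A k" "y \<in> cells B l"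
  shows "\<phi> k x l y = \<psi> k x l y"
proof (cases k)
  case Ob
  then have "slice_fun B \<phi> x = slice_fun B \<psi> x"
    using fun_cong[OF fun_cong[OF assms(1), of Ob], of x] assms(3) by simp
  from fun_cong[OF fun_cong[OF this, of l], of y] show ?thesis using Ob assms(4) by simp
next
  case Hor
  then have "slice_htr A B \<phi> x = slice_htr A B \<psi> x"
    using fun_cong[OF fun_cong[OF assms(1), of Hor], of x] assms(3) by simp
  from arg_cong[OF this, of "\<lambda>t. tmap t l y"] show ?thesis using Hor assms(2,4) by (cases l) simp_all
next
  case Ver
  then have "slice_vtr A B \<phi> x = slice_vtr A B \<psi> x"
    using fun_cong[OF fun_cong[OF assms(1), of Ver], of x] assms(3) by simp
  from arg_cong[OF this, of "\<lambda>t. tmap t l y"] show ?thesis using Ver assms(2,4) by (cases l) simp_all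
next
  case Sq
  then have "slice_mod A B \<phi> x = slice_mod A B \<psi> x"
    using fun_cong[OF fun_cong[OF assms(1), of Sq], of x] assms(3) by simp
  from arg_cong[OF this, of "\<lambda>t. mmap t y"] show ?thesis using Sq assms(2,4) by (cases l) simp_all
qed

text \<open>At a square the kind \<open>l\<close> is ignored: a modification has components at
  objects only, and a quasi-functor imposes nothing on pairs of total dimension above two.\<close>

definition untranspose :: "('x, ('b, 'c) hopcell) dblfun \<Rightarrow> kind \<Rightarrow> 'x \<Rightarrow> kind \<Rightarrow> 'b \<Rightarrow> 'c" where
  "untranspose G k x l y = (case k of Ob \<Rightarrow> the_fun (G Ob x) l y | Hor \<Rightarrow> tmap (the_htr (G Hor x)) l y
     | Ver \<Rightarrow> tmap (the_vtr (G Ver x)) l y | Sq \<Rightarrow> mmap (the_mod (G Sq x)) y)"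

context
  fixes A :: "'a dblcat" and B :: "'b dblcat" and C :: "'c dblcat"
  assumes A: "double_category A" and B: "double_category B" and C: "double_category C"
begin

text \<open>The relations of the tensor product split in two. Those that vary the second argument,
  together with naturality and the modification relations, make the slices double functors,
  transformations and modifications; those that vary the first say that slicing preserves identities
  and composites.\<close>

lemma transpose_Dbl:
  assumes q: "qf A B C \<phi>"
  shows "transpose A B \<phi> \<in> Dbl A (Dbl_hop B C)"
proof -
  note e = t_rel.intros[THEN qf_rel[OF q], simplified]
  have "qf_bd A B C \<phi>" using q by (simp add: qf_def)
  note [simp] = qf_bd_cells[OF this] qf_bd_eqs[OF this] e dc[OF A] dc[OF B]
  have c: "\<phi> Ob x k y \<in> cells C k" if "x \<in> cells A Ob" "y \<in> cells B k" for x y k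
    using that by (cases k) simp_all
  have f: "slice_fun B \<phi> x \<in> Dbl B C" if "x \<in> cells A Ob" for x
    using that by (intro DblI) (simp_all add: c)
  have h: "hoplax B C (slice_htr A B \<phi> x)" if "x \<in> cells A Hor" for x
    unfolding hoplax_def Let_def using that by (simp add: f)
  have v: "vlax B C (slice_vtr A B \<phi> x)" if "x \<in> cells A Ver" for x
    unfolding vlax_def Let_def using that by (simp add: f)
  have m: "modification B C (slice_mod A B \<phi> x)" if "x \<in> cells A Sq" for x
    unfolding modification_def Let_def using that by (simp add: h v)
  note teq = transf_eqI[of _ _ B] modif_eqI[of _ _ "cells B Ob"]
  have h1: "slice_htr A B \<phi> (hone A x) = htr_one B C (slice_fun B \<phi> x)" if "x \<in> cells A Ob" for x
    using that by (intro teq) simp_all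
  have v1: "slice_vtr A B \<phi> (vone A x) = vtr_one B C (slice_fun B \<phi> x)" if "x \<in> cells A Ob" for x
    using that by (intro teq) simp_all
  have hc: "slice_htr A B \<phi> (hcmp A x y) = htr_cmp B C (slice_htr A B \<phi> x) (slice_htr A B \<phi> y)"
    if "x \<in> cells A Hor" "y \<in> cells A Hor" "htgt A x = hsrc A y" for x y
    using that by (intro teq) simp_all
  have vc: "slice_vtr A B \<phi> (vcmp A x y) = vtr_cmp B C (slice_vtr A B \<phi> x) (slice_vtr A B \<phi> y)"
    if "x \<in> cells A Ver" "y \<in> cells A Ver" "vtgt A x = vsrc A y" for x y
    using that by (intro teq) simp_all
  have mi: "slice_mod A B \<phi> (idh A x) = mod_idh B C (slice_vtr A B \<phi> x)" if "x \<in> cells A Ver" for x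
    using that by (intro teq) (simp_all add: h1)
  have mj: "slice_mod A B \<phi> (idv A x) = mod_idv B C (slice_htr A B \<phi> x)" if "x \<in> cells A Hor" for x
    using that by (intro teq) (simp_all add: v1)
  have mh: "slice_mod A B \<phi> (hpst A x y) = mod_h B C (slice_mod A B \<phi> x) (slice_mod A B \<phi> y)"
    if "x \<in> cells A Sq" "y \<in> cells A Sq" "rt A x = lf A y" for x y
    using that by (intro teq) (simp_all add: hc)
  have mv: "slice_mod A B \<phi> (vpst A x y) = mod_v B C (slice_mod A B \<phi> x) (slice_mod A B \<phi> y)"
    if "x \<in> cells A Sq" "y \<in> cells A Sq" "bt A x = tp A y" for x y
    using that by (intro teq) (simp_all add: vc)
  show ?thesis
  proof (rule DblI)
    show "transpose A B \<phi> k x \<in> cells (Dbl_hop B C) k" if "x \<in> cells A k" for k x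
      using that by (cases k) (simp_all add: f h v m)
  qed (simp_all add: transpose_ext h1 v1 hc vc mi mj mh mv)
qed

text \<open>The same correspondence read backwards: each relation is recovered from a clause of
  \<open>hoplax\<close>, \<open>vlax\<close> or \<open>modification\<close>, or from an identity or
  composition law of \<open>G\<close>.\<close>

lemma transpose_surj:
  assumes G: "G \<in> Dbl A (Dbl_hop B C)"
  shows "qf A B C (untranspose G)" "transpose A B (untranspose G) = G"
proof -
  define f where "f x = the_fun (G Ob x)" for x
  define h where "h x = the_htr (G Hor x)" for x
  define v where "v x = the_vtr (G Ver x)" for x
  define m where "m x = the_mod (G Sq x)" for x
  have GO: "G Ob x = FunC (f x)" "f x \<in> Dbl B C" if "x \<in> cells A Ob" for x
    using Dbl_cell[OF G that] by (auto simp: f_def)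
  have GH: "G Hor x = HTrC (h x)" "hoplax B C (h x)" if "x \<in> cells A Hor" for x
    using Dbl_cell[OF G that] by (auto simp: h_def)
  have GV: "G Ver x = VTrC (v x)" "vlax B C (v x)" if "x \<in> cells A Ver" for x
    using Dbl_cell[OF G that] by (auto simp: v_def)
  have GS: "G Sq x = ModC (m x)" "modification B C (m x)" if "x \<in> cells A Sq" for x
    using Dbl_cell[OF G that] by (auto simp: m_def)
  have [simp]: "untranspose G Ob x = f x" "untranspose G Hor x = tmap (h x)"
      "untranspose G Ver x = tmap (v x)"
    "untranspose G Sq x l y = mmap (m x) y" for x l y
    by (simp_all add: untranspose_def f_def h_def v_def m_def fun_eq_iff)
  note [simp] = dc[OF A] dc[OF B] dc[OF C]
  have bd: "x \<in> cells A Hor \<Longrightarrow> tsrc (h x) = f (hsrc A x)" "x \<in> cells A Hor \<Longrightarrow> ttgt (h x) = f (htgt A x)"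
    "x \<in> cells A Ver \<Longrightarrow> tsrc (v x) = f (vsrc A x)" "x \<in> cells A Ver \<Longrightarrow> ttgt (v x) = f (vtgt A x)"
    "x \<in> cells A Sq \<Longrightarrow> mtp (m x) = h (tp A x)" "x \<in> cells A Sq \<Longrightarrow> mbt (m x) = h (bt A x)"
    "x \<in> cells A Sq \<Longrightarrow> mlf (m x) = v (lf A x)" "x \<in> cells A Sq \<Longrightarrow> mrt (m x) = v (rt A x)" for x
    using Dbl_simps(1-8)[OF G, of x] by (simp_all add: GO GH GV GS)
  have op: "x \<in> cells A Ob \<Longrightarrow> h (hone A x) = htr_one B C (f x)"
      "x \<in> cells A Ob \<Longrightarrow> v (vone A x) = vtr_one B C (f x)"
    "x \<in> cells A Hor \<Longrightarrow> m (idv A x) = mod_idv B C (h x)"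
      "x \<in> cells A Ver \<Longrightarrow> m (idh A x) = mod_idh B C (v x)" for x
    using Dbl_simps(9-12)[OF G, of x] by (simp_all add: GO GH GV GS)
  have cmp:
    "\<lbrakk>x \<in> cells A Hor; y \<in> cells A Hor; htgt A x = hsrc A y\<rbrakk> \<Longrightarrow> h (hcmp A x y) = htr_cmp B C (h x) (h y)"
    "\<lbrakk>x \<in> cells A Ver; y \<in> cells A Ver; vtgt A x = vsrc A y\<rbrakk> \<Longrightarrow> v (vcmp A x y) = vtr_cmp B C (v x) (v y)"
    "\<lbrakk>x \<in> cells A Sq; y \<in> cells A Sq; rt A x = lf A y\<rbrakk> \<Longrightarrow> m (hpst A x y) = mod_h B C (m x) (m y)"
    "\<lbrakk>x \<in> cells A Sq; y \<in> cells A Sq; bt A x = tp A y\<rbrakk> \<Longrightarrow> m (vpst A x y) = mod_v B C (m x) (m y)" for x y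
    using Dbl_simps(13-16)[OF G, of x y] by (simp_all add: GO GH GV GS)
  note hD = hoplaxD[OF GH(2)] and vD = vlaxD[OF GV(2)] and mD = modificationD[OF GS(2)]
  note [simp] = GO(2) GH(2) GV(2) GS(2) bd op cmp hD(4-20) vD(4-20) mD(10-14)
    Dbl_simps[OF GO(2)] Dbl_cell[OF GO(2)]
  have c: "untranspose G k x l y \<in> cells C (join k l)"
    if "dim k + dim l \<le> 2" "x \<in> cells A k" "y \<in> cells B l" for k x l y
    using that by (cases k; cases l) simp_all
  have "qf_bd A B C (untranspose G)"
    unfolding qf_bd_def by (simp add: c)
  moreover have "teval C (tfam (untranspose G)) k s = teval C (tfam (untranspose G)) k t"
    if "t_rel A B k s t" for k s t
    using that
  proof cases
    case (H_natural K y)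
    then show ?thesis using hD(21)[of K y] by simp
  next
    case (V_natural U y)
    then show ?thesis using vD(21)[of U y] by simp
  next
    case (modif_hor x k)
    then show ?thesis using mD(15)[of x k] by simp
  next
    case (modif_ver x u)
    then show ?thesis using mD(16)[of x u] by simp
  qed simp_all
  ultimately show "qf A B C (untranspose G)" unfolding qf_def by blast
  have f': "slice_fun B (untranspose G) x = f x" if "x \<in> cells A Ob" for x
    by (rule dblfun_eqI[of _ B]) (simp_all add: Dbl_ext[OF GO(2)[OF that]])
  have h': "slice_htr A B (untranspose G) x = h x" if "x \<in> cells A Hor" for x
    using that by (intro transf_eqI[of _ _ B]) (simp_all add: f' hD(3))
  have v': "slice_vtr A B (untranspose G) x = v x" if "x \<in> cells A Ver" for x
    using that by (intro transf_eqI[of _ _ B]) (simp_all add: f' vD(3))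
  have m': "slice_mod A B (untranspose G) x = m x" if "x \<in> cells A Sq" for x
    using that by (intro modif_eqI[of _ _ "cells B Ob"]) (simp_all add: h' v' mD(9))
  have "transpose A B (untranspose G) k x = G k x" if "x \<in> cells A k" for k x
    using that by (cases k) (simp_all add: GO(1) GH(1) GV(1) GS(1) f' h' v' m')
  then show "transpose A B (untranspose G) = G" by (rule dblfun_eqI[OF transpose_ext Dbl_ext[OF G]])
qed

end

lemma hop_transpose_bij:
  assumes "double_category A" "double_category B" "double_category C"
  shows "bij_betw (hop_transpose A B) (Dbl (A \<otimes> B) C) (Dbl A (Dbl_hop B C))"
proof (rule bij_betw_imageI)
  show "inj_on (hop_transpose A B) (Dbl (A \<otimes> B) C)"
    unfolding hop_transpose_def
    by (intro inj_onI, erule (1) tensor_unique[OF assms(1,2)]) (drule (3) transpose_inj)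
  have "hop_transpose A B H \<in> Dbl A (Dbl_hop B C)" if "H \<in> Dbl (A \<otimes> B) C" for H
    unfolding hop_transpose_def by (intro transpose_Dbl assms Dbl_qf that)
  moreover have "G \<in> hop_transpose A B ` Dbl (A \<otimes> B) C" if "G \<in> Dbl A (Dbl_hop B C)" for G
  proof -
    note q = transpose_surj[OF assms that]
    have "hop_transpose A B (qlift A B C (untranspose G)) = transpose A B (untranspose G)"
      unfolding hop_transpose_def
      by (rule transpose_cong[OF assms(1)]) (rule qlift_tcell[OF assms q(1)])
    then show ?thesis using q(2) qlift_Dbl[OF assms q(1)] by (metis imageI)
  qed
  ultimately show "hop_transpose A B ` Dbl (A \<otimes> B) C = Dbl A (Dbl_hop B C)" by blast
qed

text \<open>This is transposition for the vertical duals. \<open>Dbl_vop\<close> moves the outer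
  \<open>vop\<close> of \<open>Dbl_hlx\<close> to the domain, and \<open>qf_swap\<close> puts
  \<open>B\<close> into the second argument.\<close>

lemma hlx_transpose_bij:
  assumes "double_category A" "double_category B" "double_category C"
  shows "bij_betw (hlx_transpose A B) (Dbl (B \<otimes> A) C) (Dbl A (Dbl_hlx B C))"
proof (rule bij_betw_imageI)
  have v: "double_category (vop A)" "double_category (vop B)" "double_category (vop C)" using assms
      by simp_all
  have d: "Dbl A (Dbl_hlx B C) = Dbl (vop A) (Dbl_hop (vop B) (vop C))"
    by (simp add: Dbl_hlx_def Dbl_vop)
  show "inj_on (hlx_transpose A B) (Dbl (B \<otimes> A) C)"
    unfolding hlx_transpose_def
    by (intro inj_onI, erule (1) tensor_unique[OF assms(2,1)])
      (drule transpose_inj; simp add: add.commute)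
  have "hlx_transpose A B H \<in> Dbl A (Dbl_hlx B C)" if "H \<in> Dbl (B \<otimes> A) C" for H
    unfolding d hlx_transpose_def
    by (intro transpose_Dbl v qf_swap[where \<phi> = "\<lambda>k x l y. H (join k l) (tcell B A k x l y)"] Dbl_qf
        that assms)
  moreover have "G \<in> hlx_transpose A B ` Dbl (B \<otimes> A) C" if "G \<in> Dbl A (Dbl_hlx B C)" for G
  proof -
    note q = transpose_surj[OF v that[unfolded d]]
    let ?\<phi> = "\<lambda>k x l y. untranspose G l y k x"
    have q': "qf B A C ?\<phi>" using qf_swap[OF q(1)] by simp
    have "hlx_transpose A B (qlift B A C ?\<phi>) = transpose (vop A) (vop B) (untranspose G)"
      unfolding hlx_transpose_def
      by (rule transpose_cong[OF v(1)]) (simp add: qlift_tcell[OF assms(2,1,3) q'] add.commute)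
    then show ?thesis using q(2) qlift_Dbl[OF assms(2,1,3) q'] by (metis imageI)
  qed
  ultimately show "hlx_transpose A B ` Dbl (B \<otimes> A) C = Dbl A (Dbl_hlx B C)" by blast
qed

section \<open>Post-composition\<close>

lemma push_simps [simp]:
  "tsrc (transf_push m B Q \<alpha>) = dbl_comp B Q (tsrc \<alpha>)"
    "ttgt (transf_push m B Q \<alpha>) = dbl_comp B Q (ttgt \<alpha>)"
  "x \<in> tdom B k \<Longrightarrow> tmap (transf_push m B Q \<alpha>) k x = Q (join m k) (tmap \<alpha> k x)"
  "tmap (transf_push m B Q \<alpha>) k \<in> extensional (tdom B k)"
  by (simp_all add: transf_push_def)

definition mod_push :: "'b dblcat \<Rightarrow> ('c, 'c1) dblfun \<Rightarrow> ('b, 'c) modif \<Rightarrow> ('b, 'c1) modif" where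
  "mod_push B Q \<Theta> = \<lparr>mtp = transf_push Hor B Q (mtp \<Theta>), mbt = transf_push Hor B Q (mbt \<Theta>),
     mlf = transf_push Ver B Q (mlf \<Theta>), mrt = transf_push Ver B Q (mrt \<Theta>),
     mmap = (\<lambda>b\<in>cells B Ob. Q Sq (mmap \<Theta> b))\<rparr>"

lemma mod_push_simps [simp]:
  "mtp (mod_push B Q \<Theta>) = transf_push Hor B Q (mtp \<Theta>)"
    "mbt (mod_push B Q \<Theta>) = transf_push Hor B Q (mbt \<Theta>)"
  "mlf (mod_push B Q \<Theta>) = transf_push Ver B Q (mlf \<Theta>)"
    "mrt (mod_push B Q \<Theta>) = transf_push Ver B Q (mrt \<Theta>)"
  "b \<in> cells B Ob \<Longrightarrow> mmap (mod_push B Q \<Theta>) b = Q Sq (mmap \<Theta> b)"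
  "mmap (mod_push B Q \<Theta>) \<in> extensional (cells B Ob)"
  by (simp_all add: mod_push_def)

lemma hop_map_simps [simp]:
  "F \<in> Dbl B C \<Longrightarrow> Dbl_hop_map B C Q Ob (FunC F) = FunC (dbl_comp B Q F)"
  "hoplax B C \<alpha> \<Longrightarrow> Dbl_hop_map B C Q Hor (HTrC \<alpha>) = HTrC (transf_push Hor B Q \<alpha>)"
  "vlax B C \<alpha> \<Longrightarrow> Dbl_hop_map B C Q Ver (VTrC \<alpha>) = VTrC (transf_push Ver B Q \<alpha>)"
  "modification B C \<Theta> \<Longrightarrow> Dbl_hop_map B C Q Sq (ModC \<Theta>) = ModC (mod_push B Q \<Theta>)"
  by (simp_all add: Dbl_hop_map_def mod_push_def)

lemma hop_map_ext: "Dbl_hop_map B C Q k \<in> extensional (cells (Dbl_hop B C) k)"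
  by (simp add: Dbl_hop_map_def)

context
  fixes B :: "'b dblcat" and C :: "'c dblcat" and C' :: "'c1 dblcat" and Q :: "('c, 'c1) dblfun"
  assumes B: "double_category B" and C: "double_category C" and Q: "Q \<in> Dbl C C'"
begin

lemma hoplax_push:
  assumes \<alpha>: "hoplax B C \<alpha>"
  shows "hoplax B C' (transf_push Hor B Q \<alpha>)"
proof -
  note F = hoplaxD(1)[OF \<alpha>] and G = hoplaxD(2)[OF \<alpha>]
  note [simp] = Dbl_simps[OF F] Dbl_cell[OF F] Dbl_simps[OF G] Dbl_cell[OF G] Dbl_simps[OF Q]
      Dbl_cell[OF Q]
    dc[OF B] dc[OF C] hoplaxD(4-20)[OF \<alpha>]
  have "vpst C' (hpst C' (Q Sq (tsrc \<alpha> Sq y)) (Q Sq (tmap \<alpha> Ver (rt B y)))) (Q Sq (tmap \<alpha> Hor (bt B y)))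
      = vpst C' (Q Sq (tmap \<alpha> Hor (tp B y))) (hpst C' (Q Sq (tmap \<alpha> Ver (lf B y)))
        (Q Sq (ttgt \<alpha> Sq y)))"
    if "y \<in> cells B Sq" for y
    using arg_cong[OF hoplaxD(21)[OF \<alpha> that], of "Q Sq"] that by simp
  then show ?thesis
    unfolding hoplax_def Let_def by (simp add: Dbl_comp[OF B F Q] Dbl_comp[OF B G Q])
qed

lemma vlax_push:
  assumes \<alpha>: "vlax B C \<alpha>"
  shows "vlax B C' (transf_push Ver B Q \<alpha>)"
proof -
  note F = vlaxD(1)[OF \<alpha>] and G = vlaxD(2)[OF \<alpha>]
  note [simp] = Dbl_simps[OF F] Dbl_cell[OF F] Dbl_simps[OF G] Dbl_cell[OF G] Dbl_simps[OF Q]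
      Dbl_cell[OF Q]
    dc[OF B] dc[OF C] vlaxD(4-20)[OF \<alpha>]
  have "hpst C' (Q Sq (tmap \<alpha> Ver (lf B y))) (vpst C' (Q Sq (tsrc \<alpha> Sq y)) (Q Sq (tmap \<alpha> Hor (bt B y))))
      = hpst C' (vpst C' (Q Sq (tmap \<alpha> Hor (tp B y))) (Q Sq (ttgt \<alpha> Sq y)))
        (Q Sq (tmap \<alpha> Ver (rt B y)))"
    if "y \<in> cells B Sq" for y
    using arg_cong[OF vlaxD(21)[OF \<alpha> that], of "Q Sq"] that by simp
  then show ?thesis
    unfolding vlax_def Let_def by (simp add: Dbl_comp[OF B F Q] Dbl_comp[OF B G Q])
qed

lemma modification_push:
  assumes \<Theta>: "modification B C \<Theta>"
  shows "modification B C' (mod_push B Q \<Theta>)"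
proof -
  note h = modificationD(1,2)[OF \<Theta>] and l = modificationD(3,4)[OF \<Theta>]
  note F = vlaxD(1,2)[OF l(1)] vlaxD(1,2)[OF l(2)]
  note [simp] = Dbl_simps[OF F(1)] Dbl_cell[OF F(1)] Dbl_simps[OF F(2)] Dbl_cell[OF F(2)]
      Dbl_simps[OF F(3)]
    Dbl_cell[OF F(3)] Dbl_simps[OF F(4)] Dbl_cell[OF F(4)] Dbl_simps[OF Q] Dbl_cell[OF Q]
    dc[OF B] dc[OF C] hoplaxD(4-16)[OF h(1)] hoplaxD(4-16)[OF h(2)] vlaxD(4-16)[OF l(1)]
        vlaxD(4-16)[OF l(2)]
    modificationD(5-8,10-14)[OF \<Theta>]
  have "vpst C' (hpst C' (Q Sq (tmap (mlf \<Theta>) Hor f)) (Q Sq (mmap \<Theta> (htgt B f))))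
      (Q Sq (tmap (mbt \<Theta>) Hor f))
      = vpst C' (Q Sq (tmap (mtp \<Theta>) Hor f)) (hpst C' (Q Sq (mmap \<Theta> (hsrc B f)))
        (Q Sq (tmap (mrt \<Theta>) Hor f)))"
    if "f \<in> cells B Hor" for f
    using arg_cong[OF modificationD(15)[OF \<Theta> that], of "Q Sq"] that by simp
  moreover have "hpst C' (Q Sq (tmap (mlf \<Theta>) Ver u)) (vpst C' (Q Sq (tmap (mtp \<Theta>) Ver u))
      (Q Sq (mmap \<Theta> (vtgt B u))))
      = hpst C' (vpst C' (Q Sq (mmap \<Theta> (vsrc B u))) (Q Sq (tmap (mbt \<Theta>) Ver u)))
        (Q Sq (tmap (mrt \<Theta>) Ver u))"
    if "u \<in> cells B Ver" for u
    using arg_cong[OF modificationD(16)[OF \<Theta> that], of "Q Sq"] that by simp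
  ultimately show ?thesis
    unfolding modification_def Let_def by (simp add: h l hoplax_push vlax_push)
qed

text \<open>The operations of \<open>Dbl_hop\<close> are given componentwise by pastings in the
  codomain, and \<open>Q\<close> preserves these.\<close>

lemma Dbl_hop_map_Dbl: "Dbl_hop_map B C Q \<in> Dbl (Dbl_hop B C) (Dbl_hop B C')"
proof -
  note [simp] = Dbl_simps[OF Q] Dbl_cell[OF Q] dc[OF B] dc[OF C]
  note teq = transf_eqI[of _ _ B] modif_eqI[of _ _ "cells B Ob"]
  have one: "transf_push Hor B Q (htr_one B C F) = htr_one B C' (dbl_comp B Q F)"
    "transf_push Ver B Q (vtr_one B C F) = vtr_one B C' (dbl_comp B Q F)" if "F \<in> Dbl B C" for F
    using Dbl_cell[OF that] by (intro teq; simp)+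
  have hc: "transf_push Hor B Q (htr_cmp B C \<alpha> \<beta>) = htr_cmp B C' (transf_push Hor B Q \<alpha>)
      (transf_push Hor B Q \<beta>)"
    if "hoplax B C \<alpha>" "hoplax B C \<beta>" "ttgt \<alpha> = tsrc \<beta>" for \<alpha> \<beta>
  proof -
    note F = hoplaxD(1)[OF that(1)] hoplaxD(1,2)[OF that(2)]
    note [simp] = that(3) Dbl_simps[OF F(1)] Dbl_cell[OF F(1)] Dbl_simps[OF F(2)] Dbl_cell[OF F(2)]
      Dbl_simps[OF F(3)] Dbl_cell[OF F(3)] hoplaxD(4-16)[OF that(1)] hoplaxD(4-16)[OF that(2)]
    show ?thesis by (intro teq) simp_all
  qed
  have vc: "transf_push Ver B Q (vtr_cmp B C \<alpha> \<beta>) = vtr_cmp B C' (transf_push Ver B Q \<alpha>)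
      (transf_push Ver B Q \<beta>)"
    if "vlax B C \<alpha>" "vlax B C \<beta>" "ttgt \<alpha> = tsrc \<beta>" for \<alpha> \<beta>
  proof -
    note F = vlaxD(1)[OF that(1)] vlaxD(1,2)[OF that(2)]
    note [simp] = that(3) Dbl_simps[OF F(1)] Dbl_cell[OF F(1)] Dbl_simps[OF F(2)] Dbl_cell[OF F(2)]
      Dbl_simps[OF F(3)] Dbl_cell[OF F(3)] vlaxD(4-16)[OF that(1)] vlaxD(4-16)[OF that(2)]
    show ?thesis by (intro teq) simp_all
  qed
  have mi: "mod_push B Q (mod_idh B C \<alpha>) = mod_idh B C' (transf_push Ver B Q \<alpha>)" if "vlax B C \<alpha>" for \<alpha>
    by (intro teq) (simp_all add: one vlaxD(1-6)[OF that])
  have mj: "mod_push B Q (mod_idv B C \<alpha>) = mod_idv B C' (transf_push Hor B Q \<alpha>)" if "hoplax B C \<alpha>" for \<alpha>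
    by (intro teq) (simp_all add: one hoplaxD(1-6)[OF that])
  have mh: "mod_push B Q (mod_h B C \<Theta> \<Psi>) = mod_h B C' (mod_push B Q \<Theta>) (mod_push B Q \<Psi>)"
    if "modification B C \<Theta>" "modification B C \<Psi>" "mrt \<Theta> = mlf \<Psi>" for \<Theta> \<Psi>
    using that(3) by (intro teq) (simp_all add: hc modificationD[OF that(1)] modificationD[OF that(2)])
  have mv: "mod_push B Q (mod_v B C \<Theta> \<Psi>) = mod_v B C' (mod_push B Q \<Theta>) (mod_push B Q \<Psi>)"
    if "modification B C \<Theta>" "modification B C \<Psi>" "mbt \<Theta> = mtp \<Psi>" for \<Theta> \<Psi>
  proof -
    have "ttgt (mlf \<Theta>) = tsrc (mlf \<Psi>)" "ttgt (mrt \<Theta>) = tsrc (mrt \<Psi>)"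
      using that(3) modificationD(5-8)[OF that(1)] modificationD(5-8)[OF that(2)] by simp_all
    then show ?thesis
      using that(3) by (intro teq) (simp_all add: vc modificationD(3,4,10-14)[OF that(1)]
        modificationD(3,4,10-14)[OF that(2)])
  qed
  show ?thesis
  proof (rule DblI)
    show "Dbl_hop_map B C Q k x \<in> cells (Dbl_hop B C') k" if "x \<in> cells (Dbl_hop B C) k" for k x
      using that by (cases k) (auto simp: Dbl_comp[OF B _ Q] hoplax_push vlax_push modification_push)
  qed (auto simp: hop_map_ext hoplaxD(1,2) vlaxD(1,2) modificationD(1-4) hoplax_one[OF B C]
      vlax_one[OF B C]
      hoplax_cmp[OF B C] vlax_cmp[OF B C] modification_idh[OF B C] modification_idv[OF B C]
      modification_h[OF B C] modification_v[OF B C] one hc vc mi mj mh mv)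
qed

end

lemma push_id:
  assumes B: "double_category B"
  shows "hoplax B C \<alpha> \<Longrightarrow> transf_push Hor B (dbl_id C) \<alpha> = \<alpha>"
    "vlax B C \<alpha> \<Longrightarrow> transf_push Ver B (dbl_id C) \<alpha> = \<alpha>"
proof -
  show "transf_push Hor B (dbl_id C) \<alpha> = \<alpha>" if "hoplax B C \<alpha>"
    by (rule transf_eqI[of _ _ B]) (simp_all add: hoplaxD[OF that]
        dbl_comp_id(2)[OF hoplaxD(1)[OF that]]
        dbl_comp_id(2)[OF hoplaxD(2)[OF that]])
  show "transf_push Ver B (dbl_id C) \<alpha> = \<alpha>" if "vlax B C \<alpha>"
    by (rule transf_eqI[of _ _ B]) (simp_all add: vlaxD[OF that] dbl_comp_id(2)[OF vlaxD(1)[OF that]]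
        dbl_comp_id(2)[OF vlaxD(2)[OF that]])
qed

lemma mod_push_id:
  assumes "double_category B" "modification B C \<Theta>"
  shows "mod_push B (dbl_id C) \<Theta> = \<Theta>"
  by (rule modif_eqI[of _ _ "cells B Ob"]) (simp_all add: modificationD[OF assms(2)]
      push_id[OF assms(1)])

lemma Dbl_hop_map_id:
  assumes "double_category B"
  shows "Dbl_hop_map B C (dbl_id C) = dbl_id (Dbl_hop B C)"
proof (rule dblfun_eqI[OF hop_map_ext])
  show "dbl_id (Dbl_hop B C) k \<in> extensional (cells (Dbl_hop B C) k)" for k
    by (simp add: dbl_id_def)
  show "Dbl_hop_map B C (dbl_id C) k x = dbl_id (Dbl_hop B C) k x" if "x \<in> cells (Dbl_hop B C) k"
      for k x
    using that by (cases k) (auto simp: dbl_comp_id push_id[OF assms] mod_push_id[OF assms])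
qed

lemma push_comp:
  assumes "double_category B"
  shows "hoplax B C \<alpha> \<Longrightarrow> transf_push Hor B (dbl_comp C Q' Q) \<alpha> = transf_push Hor B Q'
      (transf_push Hor B Q \<alpha>)"
    "vlax B C \<alpha> \<Longrightarrow> transf_push Ver B (dbl_comp C Q' Q) \<alpha> = transf_push Ver B Q' (transf_push Ver B Q \<alpha>)"
proof -
  show "transf_push Hor B (dbl_comp C Q' Q) \<alpha> = transf_push Hor B Q' (transf_push Hor B Q \<alpha>)" if
      "hoplax B C \<alpha>"
    by (rule transf_eqI[of _ _ B]) (simp_all add: hoplaxD[OF that]
        dbl_comp_assoc[OF hoplaxD(1)[OF that]]
        dbl_comp_assoc[OF hoplaxD(2)[OF that]])
  show "transf_push Ver B (dbl_comp C Q' Q) \<alpha> = transf_push Ver B Q' (transf_push Ver B Q \<alpha>)" if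
      "vlax B C \<alpha>"
    by (rule transf_eqI[of _ _ B]) (simp_all add: vlaxD[OF that] dbl_comp_assoc[OF vlaxD(1)[OF that]]
        dbl_comp_assoc[OF vlaxD(2)[OF that]])
qed

lemma Dbl_hop_map_comp:
  assumes B: "double_category B" and C: "double_category C" and Q: "Q \<in> Dbl C C'"
  shows "Dbl_hop_map B C (dbl_comp C Q' Q) = dbl_comp (Dbl_hop B C) (Dbl_hop_map B C' Q')
      (Dbl_hop_map B C Q)"
proof (rule dblfun_eqI[OF hop_map_ext dbl_comp_ext])
  have m: "mod_push B (dbl_comp C Q' Q) \<Theta> = mod_push B Q' (mod_push B Q \<Theta>)" if "modification B C \<Theta>"
      for \<Theta>
    by (rule modif_eqI[of _ _ "cells B Ob"]) (simp_all add: modificationD[OF that] push_comp[OF B])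
  show "Dbl_hop_map B C (dbl_comp C Q' Q) k x = dbl_comp (Dbl_hop B C) (Dbl_hop_map B C' Q')
      (Dbl_hop_map B C Q) k x"
    if "x \<in> cells (Dbl_hop B C) k" for k x
    using that
    by (cases k) (auto simp: m dbl_comp_assoc push_comp[OF B] hoplax_push[OF B C Q] vlax_push[OF B C Q]
        modification_push[OF B C Q] Dbl_comp[OF B _ Q])
qed

text \<open>Naturality in both variables at once. It holds already for quasi-functors, so it serves
  both adjunctions.\<close>

lemma transpose_natural:
  assumes X': "double_category X'" and X: "double_category X" and B: "double_category B" and C:
      "double_category C"
    and P: "P \<in> Dbl X' X" and q: "qf X B C \<phi>" and Q: "Q \<in> Dbl C C'"
  shows "transpose X' B (\<lambda>k x l y. Q (join k l) (\<phi> k (P k x) l y))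
    = dbl_comp X' (Dbl_hop_map B C Q) (dbl_comp X' (transpose X B \<phi>) P)"
proof (rule dblfun_eqI[OF transpose_ext dbl_comp_ext])
  let ?\<psi> = "\<lambda>k x l y. Q (join k l) (\<phi> k (P k x) l y)"
  note T = Dbl_cell[OF transpose_Dbl[OF X B C q]]
  have c: "x \<in> cells X Ob \<Longrightarrow> slice_fun B \<phi> x \<in> Dbl B C"
      "x \<in> cells X Hor \<Longrightarrow> hoplax B C (slice_htr X B \<phi> x)"
    "x \<in> cells X Ver \<Longrightarrow> vlax B C (slice_vtr X B \<phi> x)"
      "x \<in> cells X Sq \<Longrightarrow> modification B C (slice_mod X B \<phi> x)" for x
    using T[of x Ob] T[of x Hor] T[of x Ver] T[of x Sq] by simp_all
  note [simp] = Dbl_simps[OF P] Dbl_cell[OF P] dc[OF X] dc[OF X']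
  have f: "slice_fun B ?\<psi> x = dbl_comp B Q (slice_fun B \<phi> (P Ob x))" for x
    by (rule dblfun_eqI[OF _ dbl_comp_ext]) simp_all
  have h: "slice_htr X' B ?\<psi> x = transf_push Hor B Q (slice_htr X B \<phi> (P Hor x))" if
      "x \<in> cells X' Hor" for x
    using that by (intro transf_eqI[of _ _ B]) (simp_all add: f)
  have v: "slice_vtr X' B ?\<psi> x = transf_push Ver B Q (slice_vtr X B \<phi> (P Ver x))" if
      "x \<in> cells X' Ver" for x
    using that by (intro transf_eqI[of _ _ B]) (simp_all add: f)
  have m: "slice_mod X' B ?\<psi> x = mod_push B Q (slice_mod X B \<phi> (P Sq x))" if "x \<in> cells X' Sq" for x
    using that by (intro modif_eqI[of _ _ "cells B Ob"]) (simp_all add: h v)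
  show "transpose X' B ?\<psi> k x = dbl_comp X' (Dbl_hop_map B C Q) (dbl_comp X' (transpose X B \<phi>) P) k x"
    if "x \<in> cells X' k" for k x
    using that by (cases k) (simp_all add: f h v m c)
qed

section \<open>Generating families of cells\<close>

text \<open>For an iterated tensor product \<open>tensor_unique\<close> would require agreement on w
  \<otimes> z for arbitrary composites w. Closure of a family under the operations allows the test
  to be restricted to generators of the inner factors as well.\<close>

inductive gen :: "'a dblcat \<Rightarrow> (kind \<Rightarrow> 'a set) \<Rightarrow> kind \<Rightarrow> 'a \<Rightarrow> bool" for M S where
  base: "x \<in> S k \<Longrightarrow> gen M S k x"
| hone: "gen M S Ob x \<Longrightarrow> gen M S Hor (hone M x)"
| vone: "gen M S Ob x \<Longrightarrow> gen M S Ver (vone M x)"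
| idh: "gen M S Ver u \<Longrightarrow> gen M S Sq (idh M u)"
| idv: "gen M S Hor f \<Longrightarrow> gen M S Sq (idv M f)"
| hcmp: "\<lbrakk>gen M S Hor f; gen M S Hor g; htgt M f = hsrc M g\<rbrakk> \<Longrightarrow> gen M S Hor (hcmp M f g)"
| vcmp: "\<lbrakk>gen M S Ver u; gen M S Ver v; vtgt M u = vsrc M v\<rbrakk> \<Longrightarrow> gen M S Ver (vcmp M u v)"
| hpst: "\<lbrakk>gen M S Sq a; gen M S Sq b; rt M a = lf M b\<rbrakk> \<Longrightarrow> gen M S Sq (hpst M a b)"
| vpst: "\<lbrakk>gen M S Sq a; gen M S Sq b; bt M a = tp M b\<rbrakk> \<Longrightarrow> gen M S Sq (vpst M a b)"

text \<open>All objects must lie in \<open>S\<close>, because no operation produces an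
  object.\<close>

definition generates :: "'a dblcat \<Rightarrow> (kind \<Rightarrow> 'a set) \<Rightarrow> bool" where
  "generates M S \<longleftrightarrow> double_category M \<and> (\<forall>k. S k \<subseteq> cells M k) \<and> S Ob = cells M Ob \<and>
     (\<forall>k. \<forall>x\<in>cells M k. gen M S k x)"

definition tens :: "'a dblcat \<Rightarrow> 'b dblcat \<Rightarrow> (kind \<Rightarrow> 'a set) \<Rightarrow> (kind \<Rightarrow> 'b set) \<Rightarrow> kind \<Rightarrow> ('a, 'b)
    tcell set" where
  "tens M N S S' j = {tcell M N k x l y | k x l y. dim k + dim l \<le> 2 \<and> j = join k l \<and> x \<in> S k \<and> y \<in>
    S' l}"

lemma generates_cells: "double_category M \<Longrightarrow> generates M (cells M)"
  by (simp add: generates_def gen.base)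

text \<open>Every cell of positive dimension of the unit is an identity on its object. Hence a
  double functor out of a tensor product with the unit is tested with the object in that
  factor.\<close>

lemma generates_unit: "generates unit_dbl (\<lambda>k. if k = Ob then UNIV else {})"
proof -
  have d: "double_category unit_dbl"
    by (simp add: double_category_def category_on_def unit_dbl_def)
  let ?g = "gen unit_dbl (\<lambda>k. if k = Ob then UNIV else {})"
  have o: "?g Ob ()" by (simp add: gen.base)
  have "?g k ()" for k
    using o gen.hone[OF o] gen.vone[OF o] gen.idv[OF gen.hone[OF o]] by (cases k) simp_all
  then show ?thesis using d by (simp add: generates_def unit_dbl_def)
qed

lemma generates_unique:
  assumes g: "generates M S" and T: "T \<in> Dbl M Y" "T' \<in> Dbl M Y'"
    and ops: "Y = Y'" and e: "\<And>k x. x \<in> S k \<Longrightarrow> T k x = T' k x"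
  shows "T = T'"
proof (rule Dbl_eqI[OF T])
  have M: "double_category M" and S: "\<And>k x. x \<in> S k \<Longrightarrow> x \<in> cells M k" using g by
      (auto simp: generates_def)
  have "x \<in> cells M k \<and> T k x = T' k x" if "gen M S k x" for k x
    using that by induction (use T ops in \<open>simp_all add: S e dc[OF M] Dbl_simps\<close>)
  then show "T k x = T' k x" if "x \<in> cells M k" for k x
    using that g by (simp add: generates_def)
qed

lemma join_Ob [simp]: "join k Ob = k"
  by (cases k) simp_all

text \<open>The bound matters: \<open>join\<close> sends all pairs of kinds of positive dimension to
  \<open>Sq\<close>, so it truncates dimensions above two.\<close>

lemma dim_join: "dim k + dim l \<le> 2 \<Longrightarrow> dim (join k l) = dim k + dim l"
  by (cases k; cases l) simp_all

text \<open>The relations of the tensor product expand x \<otimes> y along an identity or a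
  composite in either argument into pastings of simpler cells, so the generating families may be
  used one argument at a time.\<close>

lemma generates_tensor:
  fixes M :: "'a dblcat" and N :: "'b dblcat"
  assumes g: "generates M S" and g': "generates N S'"
  shows "generates (M \<otimes> N) (tens M N S S')"
proof -
  have M: "double_category M" and N: "double_category N" using g g' by (auto simp: generates_def)
  have S: "S Ob = cells M Ob" "\<And>k x. x \<in> S k \<Longrightarrow> x \<in> cells M k"
    and S': "S' Ob = cells N Ob" "\<And>k x. x \<in> S' k \<Longrightarrow> x \<in> cells N k"
    using g g' by (auto simp: generates_def)
  have T: "double_category (M \<otimes> N)" by (rule double_category_tensor[OF M N])
  note q = qf_tcell[OF M N]
  have qb: "qf_bd M N (M \<otimes> N) (tcell M N)" using q by (simp add: qf_def)
  note [simp] = t_rel.intros[THEN qf_rel[OF q], simplified] qf_bd_cells[OF qb] qf_bd_eqs[OF qb]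
      dc[OF M] dc[OF N] dc[OF T]
  let ?Z = "gen (M \<otimes> N) (tens M N S S')"
  have tz: "?Z (join k l) (tcell M N k x l y)" if "x \<in> S k" "y \<in> S' l" "dim k + dim l \<le> 2" for k x l y
    using that by (intro gen.base) (auto simp: tens_def)
  have sub: "x \<in> cells M k" if "gen M S k x" for k x
    using that by induction (simp_all add: S)
  have sub': "y \<in> cells N l" if "gen N S' l y" for l y
    using that by induction (simp_all add: S')
  have dim2: "dim k \<le> 2" for k by (cases k) simp_all
  have O: "?Z l (tcell M N Ob x l y)" if y: "gen N S' l y" and x: "x \<in> cells M Ob" for x l y
    using y
  proof induction
    case (base y l)
    then show ?case using tz[of x Ob y l] x S by (simp add: dim2)
  qed (use x in \<open>simp_all add: sub' gen.intros\<close>)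
  have O': "?Z k (tcell M N k x Ob y)" if x: "gen M S k x" and y: "y \<in> cells N Ob" for x k y
    using x
  proof induction
    case (base x k)
    then show ?case using tz[of x k y Ob] y S' by (simp add: dim2)
  qed (use y in \<open>simp_all add: sub gen.intros\<close>)
  \<comment> \<open>For two 1-cells the second argument is decomposed first, with the first one kept
    in \<open>S\<close>. The conjunction over \<open>l\<close> makes the statement an induction over
    all kinds; objects and squares satisfy it vacuously.\<close>
  have H: "(l = Hor \<longrightarrow> ?Z Sq (tcell M N Hor x Hor y)) \<and> (l = Ver \<longrightarrow> ?Z Sq (tcell M N Hor x Ver y))"
    if y: "gen N S' l y" and x: "x \<in> S Hor" for x l y
    using y
  proof induction
    case (base y l)
    then show ?case using tz[of x Hor y l] x by auto
  qed (use x S(2)[OF x] in \<open>simp_all add: sub' O O' gen.base gen.intros\<close>)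
  have V: "(l = Hor \<longrightarrow> ?Z Sq (tcell M N Ver x Hor y)) \<and> (l = Ver \<longrightarrow> ?Z Sq (tcell M N Ver x Ver y))"
    if y: "gen N S' l y" and x: "x \<in> S Ver" for x l y
    using y
  proof induction
    case (base y l)
    then show ?case using tz[of x Ver y l] x by auto
  qed (use x S(2)[OF x] in \<open>simp_all add: sub' O O' gen.base gen.intros\<close>)
  \<comment> \<open>Now the first argument is decomposed, for an arbitrary 1-cell \<open>y\<close>;
    the base case is \<open>H\<close> or \<open>V\<close>.\<close>
  have HV: "(k = Hor \<longrightarrow> ?Z Sq (tcell M N Hor x l y)) \<and> (k = Ver \<longrightarrow> ?Z Sq (tcell M N Ver x l y))"
    if x: "gen M S k x" and y: "gen N S' l y" and l: "l = Hor \<or> l = Ver" for k x l y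
    using x
  proof induction
    case (base x k)
    then show ?case using H[OF y] V[OF y] l by auto
  qed (use l y sub'[OF y] in \<open>auto simp: sub O O' gen.base gen.intros\<close>)
  have all: "?Z (join k l) (tcell M N k x l y)"
    if "x \<in> cells M k" "y \<in> cells N l" "dim k + dim l \<le> 2" for k x l y
  proof -
    have "gen M S k x" "gen N S' l y" using that g g' by (auto simp: generates_def)
    then show ?thesis using that O[of l y x] O'[of k x y] HV[of k x l y] by (cases k; cases l) auto
  qed
  note ok = pres_ok_tensor[OF M N]
  let ?P = "tensor_pres M N"
  have "?Z k (pclass (tensor_pres M N) k t)" if "swf (tensor_pres M N) k t" for k t
    using that
  proof (induction t arbitrary: k)
    case (Gen g)
    then show ?case using all by (cases g) (auto simp: tensor_pgen tcell_def)
  next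
    case (HOne x)
    then show ?case using gen.hone[OF HOne.IH] presented_one[OF ok] by (simp add: tensor_def swf_pcong)
  next
    case (VOne x)
    then show ?case using gen.vone[OF VOne.IH] presented_one[OF ok] by (simp add: tensor_def swf_pcong)
  next
    case (IdH x)
    then show ?case using gen.idh[OF IdH.IH] presented_one[OF ok] by (simp add: tensor_def swf_pcong)
  next
    case (IdV x)
    then show ?case using gen.idv[OF IdV.IH] presented_one[OF ok] by (simp add: tensor_def swf_pcong)
  next
    case (HCmp x y)
    then have w: "swf ?P Hor x" "swf ?P Hor y" "pcong ?P Ob (tm_htgt ?P x) (tm_hsrc ?P y)" "k = Hor"
        by simp_all
    have "htgt (M \<otimes> N) (pclass ?P Hor x) = hsrc (M \<otimes> N) (pclass ?P Hor y)"
      using w by (simp add: tensor_def presented_bd[OF ok] swf_pcong pclass_eqI[OF w(3)])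
    from gen.hcmp[OF HCmp.IH(1)[OF w(1)] HCmp.IH(2)[OF w(2)] this] show ?case
      using w by (simp add: tensor_def presented_cmp[OF ok] swf_pcong)
  next
    case (VCmp x y)
    then have w: "swf ?P Ver x" "swf ?P Ver y" "pcong ?P Ob (tm_vtgt ?P x) (tm_vsrc ?P y)" "k = Ver"
        by simp_all
    have "vtgt (M \<otimes> N) (pclass ?P Ver x) = vsrc (M \<otimes> N) (pclass ?P Ver y)"
      using w by (simp add: tensor_def presented_bd[OF ok] swf_pcong pclass_eqI[OF w(3)])
    from gen.vcmp[OF VCmp.IH(1)[OF w(1)] VCmp.IH(2)[OF w(2)] this] show ?case
      using w by (simp add: tensor_def presented_cmp[OF ok] swf_pcong)
  next
    case (HPst x y)
    then have w: "swf ?P Sq x" "swf ?P Sq y" "pcong ?P Ver (tm_rt ?P x) (tm_lf ?P y)" "k = Sq" by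
        simp_all
    have "rt (M \<otimes> N) (pclass ?P Sq x) = lf (M \<otimes> N) (pclass ?P Sq y)"
      using w by (simp add: tensor_def presented_bd[OF ok] swf_pcong pclass_eqI[OF w(3)])
    from gen.hpst[OF HPst.IH(1)[OF w(1)] HPst.IH(2)[OF w(2)] this] show ?case
      using w by (simp add: tensor_def presented_cmp[OF ok] swf_pcong)
  next
    case (VPst x y)
    then have w: "swf ?P Sq x" "swf ?P Sq y" "pcong ?P Hor (tm_bt ?P x) (tm_tp ?P y)" "k = Sq" by
        simp_all
    have "bt (M \<otimes> N) (pclass ?P Sq x) = tp (M \<otimes> N) (pclass ?P Sq y)"
      using w by (simp add: tensor_def presented_bd[OF ok] swf_pcong pclass_eqI[OF w(3)])
    from gen.vpst[OF VPst.IH(1)[OF w(1)] VPst.IH(2)[OF w(2)] this] show ?case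
      using w by (simp add: tensor_def presented_cmp[OF ok] swf_pcong)
  qed
  then have 1: "\<forall>k. \<forall>w\<in>cells (M \<otimes> N) k. ?Z k w"
    by (auto simp: tensor_def presented_cells pcong_iff_swf[OF ok])
  have 2: "\<forall>k. tens M N S S' k \<subseteq> cells (M \<otimes> N) k"
    using tcell_cell[OF M N] S S' by (auto simp: tens_def)
  have "cells (M \<otimes> N) Ob \<subseteq> tens M N S S' Ob"
  proof
    fix w
    assume "w \<in> cells (M \<otimes> N) Ob"
    then have "?Z Ob w" using 1 by blast
    then show "w \<in> tens M N S S' Ob" by cases simp_all
  qed
  then show ?thesis using 1 2 T unfolding generates_def by blast
qed

section \<open>Associativity\<close>

definition hop_eval :: "'b dblcat \<Rightarrow> 'c dblcat \<Rightarrow> 'b \<Rightarrow> (('b, 'c) hopcell, 'c) dblfun" where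
  "hop_eval B C b = (\<lambda>k. \<lambda>Z\<in>cells (Dbl_hop B C) k. (case Z of FunC F \<Rightarrow> F Ob b
     | HTrC \<alpha> \<Rightarrow> tmap \<alpha> Ob b | VTrC \<alpha> \<Rightarrow> tmap \<alpha> Ob b | ModC \<Theta> \<Rightarrow> mmap \<Theta> b))"

lemma hop_eval_simps [simp]:
  "F \<in> Dbl B C \<Longrightarrow> hop_eval B C b Ob (FunC F) = F Ob b"
  "hoplax B C \<alpha> \<Longrightarrow> hop_eval B C b Hor (HTrC \<alpha>) = tmap \<alpha> Ob b"
  "vlax B C \<alpha> \<Longrightarrow> hop_eval B C b Ver (VTrC \<alpha>) = tmap \<alpha> Ob b"
  "modification B C \<Theta> \<Longrightarrow> hop_eval B C b Sq (ModC \<Theta>) = mmap \<Theta> b"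
  by (simp_all add: hop_eval_def)

text \<open>At an object the component of a composite transformation is the composite of the
  components; whiskering enters only in components at 1-cells.\<close>

lemma hop_eval_Dbl:
  assumes B: "double_category B" and C: "double_category C" and b: "b \<in> cells B Ob"
  shows "hop_eval B C b \<in> Dbl (Dbl_hop B C) C"
proof (rule DblI)
  show "hop_eval B C b k \<in> extensional (cells (Dbl_hop B C) k)" for k by (simp add: hop_eval_def)
  show "hop_eval B C b k x \<in> cells C k" if "x \<in> cells (Dbl_hop B C) k" for k x
    using that b by (cases k) (auto simp: Dbl_cell hoplaxD(4) vlaxD(4) modificationD(10))
qed (use b in \<open>auto simp: hoplaxD(1,2,4-6) vlaxD(1,2,4-6) modificationD(1-4,10-14)
    hoplax_one[OF B C] vlax_one[OF B C]
      hoplax_cmp[OF B C] vlax_cmp[OF B C] modification_idh[OF B C] modification_idv[OF B C]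
      modification_h[OF B C] modification_v[OF B C]\<close>)

lemma slice_fun_Dbl:
  assumes "double_category A" "double_category B" "double_category C" "qf A B C \<phi>" "x \<in> cells A Ob"
  shows "slice_fun B \<phi> x \<in> Dbl B C"
  using Dbl_cell[OF transpose_Dbl[OF assms(1-4)] assms(5)] assms(5) by simp

lemma qf_slice:
  assumes B: "double_category B" and C: "double_category C" and X: "double_category X" and F:
      "F \<in> Dbl (B \<otimes> C) X"
  shows "qf B C X (\<lambda>l y m z. F (join l m) (tcell B C l y m z))"
  by (rule qf_postcomp[OF B C qf_tcell[OF B C] double_category_tensor[OF B C] F X])

text \<open>A slice in the first argument is a slice in the second argument after
  \<open>qf_swap\<close>.\<close>

lemma right_slice_Dbl:
  assumes "double_category A" "double_category B" "double_category C" "qf A B C \<phi>" "y \<in> cells B Ob"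
  shows "(\<lambda>k. \<lambda>x\<in>cells A k. \<phi> k x Ob y) \<in> Dbl A C"
proof -
  have "slice_fun (vop A) (\<lambda>k x l y. \<phi> l y k x) y \<in> Dbl (vop A) (vop C)"
    by (rule slice_fun_Dbl[OF _ _ _ qf_swap]) (use assms in simp_all)
  then show ?thesis by (simp add: slice_fun_def)
qed

section \<open>Slicing a quasi-functor on \<open>A\<close> and \<open>B \<otimes> C\<close>\<close>

context
  fixes A :: "'a dblcat" and B :: "'b dblcat" and C :: "'c dblcat" and X :: "'x dblcat"
    and \<phi> :: "kind \<Rightarrow> 'a \<Rightarrow> kind \<Rightarrow> ('b, 'c) tcell \<Rightarrow> 'x"
  assumes A: "double_category A" and B: "double_category B" and C: "double_category C" and X:
      "double_category X"
    and q: "qf A (B \<otimes> C) X \<phi>"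
begin

definition "tri k x l y m z = \<phi> k x (join l m) (tcell B C l y m z)"

definition "trib b k x m z = tri k x Ob b m z"

text \<open>The boundaries copy those of the four kinds of structure squares (\<open>t_tp\<close>,
  \<open>t_bt\<close>, \<open>t_lf\<close>, \<open>t_rt\<close>) inside \<open>Dbl_hop C X\<close>:
  the factor x contributes its slice at an object of \<open>B\<close>, the factor y its slice at an
  object of \<open>A\<close>.\<close>

definition "tri_mod k x l y = (case (k, l) of
    (Hor, Hor) \<Rightarrow> \<lparr>mtp = htr_cmp C X (slice_htr B C (tri Ob (hsrc A x)) y)
        (slice_htr A C (trib (htgt B y)) x),
       mbt = htr_cmp C X (slice_htr A C (trib (hsrc B y)) x) (slice_htr B C (tri Ob (htgt A x)) y),
       mlf = vtr_one C X (slice_fun C (tri Ob (hsrc A x)) (hsrc B y)),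
       mrt = vtr_one C X (slice_fun C (tri Ob (htgt A x)) (htgt B y)), mmap =
         (\<lambda>c\<in>cells C Ob. tri k x l y Ob c)\<rparr>
  | (Hor, Ver) \<Rightarrow> \<lparr>mtp = slice_htr A C (trib (vsrc B y)) x, mbt = slice_htr A C (trib (vtgt B y)) x,
       mlf = slice_vtr B C (tri Ob (hsrc A x)) y, mrt = slice_vtr B C (tri Ob (htgt A x)) y,
       mmap = (\<lambda>c\<in>cells C Ob. tri k x l y Ob c)\<rparr>
  | (Ver, Hor) \<Rightarrow> \<lparr>mtp = slice_htr B C (tri Ob (vsrc A x)) y, mbt = slice_htr B C (tri Ob (vtgt A x)) y,
       mlf = slice_vtr A C (trib (hsrc B y)) x, mrt = slice_vtr A C (trib (htgt B y)) x,
       mmap = (\<lambda>c\<in>cells C Ob. tri k x l y Ob c)\<rparr>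
  | (Ver, Ver) \<Rightarrow> \<lparr>mtp = htr_one C X (slice_fun C (tri Ob (vsrc A x)) (vsrc B y)),
       mbt = htr_one C X (slice_fun C (tri Ob (vtgt A x)) (vtgt B y)),
       mlf = vtr_cmp C X (slice_vtr A C (trib (vsrc B y)) x) (slice_vtr B C (tri Ob (vtgt A x)) y),
       mrt = vtr_cmp C X (slice_vtr B C (tri Ob (vsrc A x)) y) (slice_vtr A C (trib (vtgt B y)) x),
       mmap = (\<lambda>c\<in>cells C Ob. tri k x l y Ob c)\<rparr>)"

definition "tri_cell k x l y =
  (if k = Ob then transpose B C (tri Ob x) l y
   else if l = Ob then transpose A C (trib y) k x
   else ModC (tri_mod k x l y))"

lemma BC: "double_category (B \<otimes> C)"
  by (rule double_category_tensor[OF B C])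

text \<open>Fixing an object in any one of the three arguments leaves a quasi-functor in the other
  two. This and the next two lemmas cover every condition in which some argument is an object, so
  that only the cubes remain.\<close>

lemma tri_qf1: "a \<in> cells A Ob \<Longrightarrow> qf B C X (tri Ob a)"
  by (rule qf_cong[OF B C qf_slice[OF B C X slice_fun_Dbl[OF A BC X q]] X])
    (simp_all add: tri_def tcell_cell[OF B C])

lemma tri_qf2:
  assumes "b \<in> cells B Ob"
  shows "qf A C X (trib b)"
  by (rule qf_cong[OF A C qf_precomp[OF q Dbl_id[OF A] slice_fun_Dbl[OF B C BC qf_tcell[OF B C]
      assms] A C] X])
    (simp_all add: tri_def trib_def)

lemma tri_qf3:
  assumes "c \<in> cells C Ob"
  shows "qf A B X (\<lambda>k x l y. tri k x l y Ob c)"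
  by (rule qf_cong[OF A B qf_precomp[OF q Dbl_id[OF A] right_slice_Dbl[OF B C BC qf_tcell[OF B C]
      assms] A B] X])
    (simp_all add: tri_def)

lemma slice_trib [simp]: "slice_fun C (trib b) a = slice_fun C (tri Ob a) b"
  by (simp add: slice_fun_def trib_def)

lemma tri_slices:
  "a \<in> cells A Ob \<Longrightarrow> b \<in> cells B Ob \<Longrightarrow> slice_fun C (tri Ob a) b \<in> Dbl C X"
  "a \<in> cells A Ob \<Longrightarrow> k \<in> cells B Hor \<Longrightarrow> hoplax C X (slice_htr B C (tri Ob a) k)"
  "a \<in> cells A Ob \<Longrightarrow> u \<in> cells B Ver \<Longrightarrow> vlax C X (slice_vtr B C (tri Ob a) u)"
  "a \<in> cells A Ob \<Longrightarrow> y \<in> cells B Sq \<Longrightarrow> modification C X (slice_mod B C (tri Ob a) y)"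
  "K \<in> cells A Hor \<Longrightarrow> b \<in> cells B Ob \<Longrightarrow> hoplax C X (slice_htr A C (trib b) K)"
  "U \<in> cells A Ver \<Longrightarrow> b \<in> cells B Ob \<Longrightarrow> vlax C X (slice_vtr A C (trib b) U)"
  "x \<in> cells A Sq \<Longrightarrow> b \<in> cells B Ob \<Longrightarrow> modification C X (slice_mod A C (trib b) x)"
  using Dbl_cell[OF transpose_Dbl[OF B C X tri_qf1]] Dbl_cell[OF transpose_Dbl[OF A C X tri_qf2]]
  by fastforce+

lemma tri_modification:
  assumes "k = Hor \<or> k = Ver" "l = Hor \<or> l = Ver" "x \<in> cells A k" "y \<in> cells B l"
  shows "modification C X (tri_mod k x l y)"
proof -
  have qb: "qf_bd A (B \<otimes> C) X \<phi>" "qf_bd B C (B \<otimes> C) (tcell B C)"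
    using q qf_tcell[OF B C] by (simp_all add: qf_def)
  \<comment> \<open>The omitted rules 21 and 26 are the naturality relations, which are instantiated
    below at the squares \<open>y \<otimes> z\<close>. The other rules expand the composite sides of
    such a square, for instance \<open>HH_hcmp\<close> in case 1, and so produce the faces of the
    cube.\<close>
  note [simp] = t_rel.intros(1-20,22-25,27-36)[THEN qf_rel[OF q], simplified] qf_bd_cells[OF qb(1)]
      qf_bd_eqs[OF qb(1)] qf_bd_cells[OF qb(2)] qf_bd_eqs[OF qb(2)]
    dc[OF A] dc[OF B] dc[OF C] dc[OF X] dc[OF BC] tri_slices hoplax_cmp[OF C X] vlax_cmp[OF C X]
    hoplax_one[OF C X] vlax_one[OF C X] tri_def trib_def tri_mod_def
  consider "k = Hor" "l = Hor" | "k = Hor" "l = Ver" | "k = Ver" "l = Hor" | "k = Ver" "l = Ver"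
    using assms(1,2) by blast
  then show ?thesis
  proof cases
    case 1
    note [simp] = 1 assms(3,4)[unfolded 1]
    show ?thesis
      unfolding modification_def Let_def
      apply (simp, intro conjI ballI)
      subgoal for z
        using qf_rel[OF q t_rel.H_natural[of x A "tcell B C Hor y Hor z" "B \<otimes> C"]] by simp
      subgoal for z
        using qf_rel[OF q t_rel.H_natural[of x A "tcell B C Hor y Ver z" "B \<otimes> C"]] by simp
      done
  next
    case 2
    note [simp] = 2 assms(3,4)[unfolded 2]
    show ?thesis
      unfolding modification_def Let_def
      apply (simp, intro conjI ballI)
      subgoal for z
        using qf_rel[OF q t_rel.H_natural[of x A "tcell B C Ver y Hor z" "B \<otimes> C"]] by simp
      subgoal for z
        using qf_rel[OF q t_rel.H_natural[of x A "tcell B C Ver y Ver z" "B \<otimes> C"]] by simp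
      done
  next
    case 3
    note [simp] = 3 assms(3,4)[unfolded 3]
    show ?thesis
      unfolding modification_def Let_def
      apply (simp, intro conjI ballI)
      subgoal for z
        using qf_rel[OF q t_rel.V_natural[of x A "tcell B C Hor y Hor z" "B \<otimes> C"]] by simp
      subgoal for z
        using qf_rel[OF q t_rel.V_natural[of x A "tcell B C Hor y Ver z" "B \<otimes> C"]] by simp
      done
  next
    case 4
    note [simp] = 4 assms(3,4)[unfolded 4]
    show ?thesis
      unfolding modification_def Let_def
      apply (simp, intro conjI ballI)
      subgoal for z
        using qf_rel[OF q t_rel.V_natural[of x A "tcell B C Ver y Hor z" "B \<otimes> C"]] by simp
      subgoal for z
        using qf_rel[OF q t_rel.V_natural[of x A "tcell B C Ver y Ver z" "B \<otimes> C"]] by simp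
      done
  qed
qed

lemma tri_cell_simps [simp]:
  "a \<in> cells A Ob \<Longrightarrow> b \<in> cells B Ob \<Longrightarrow> tri_cell Ob a Ob b = FunC (slice_fun C (tri Ob a) b)"
  "k \<in> cells B Hor \<Longrightarrow> tri_cell Ob a Hor k = HTrC (slice_htr B C (tri Ob a) k)"
  "u \<in> cells B Ver \<Longrightarrow> tri_cell Ob a Ver u = VTrC (slice_vtr B C (tri Ob a) u)"
  "y \<in> cells B Sq \<Longrightarrow> tri_cell Ob a Sq y = ModC (slice_mod B C (tri Ob a) y)"
  "K \<in> cells A Hor \<Longrightarrow> tri_cell Hor K Ob b = HTrC (slice_htr A C (trib b) K)"
  "U \<in> cells A Ver \<Longrightarrow> tri_cell Ver U Ob b = VTrC (slice_vtr A C (trib b) U)"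
  "x \<in> cells A Sq \<Longrightarrow> tri_cell Sq x Ob b = ModC (slice_mod A C (trib b) x)"
  "tri_cell Hor K Hor k = ModC (tri_mod Hor K Hor k)"
    "tri_cell Hor K Ver u = ModC (tri_mod Hor K Ver u)"
  "tri_cell Ver U Hor k = ModC (tri_mod Ver U Hor k)"
    "tri_cell Ver U Ver u = ModC (tri_mod Ver U Ver u)"
  by (simp_all add: tri_cell_def)

text \<open>In a relation between 1-cells one of the two arguments is a fixed object, so the
  relation is functoriality of the transpose of \<open>tri Ob a\<close> or of
  \<open>trib b\<close>.\<close>

lemma tri_pqf: "pqf A B (Dbl_hop C X) tri_cell"
proof -
  note [simp] = dc[OF A] dc[OF B] tri_slices
  have m: "k \<noteq> Ob \<Longrightarrow> k \<noteq> Sq \<Longrightarrow> l \<noteq> Ob \<Longrightarrow> l \<noteq> Sq \<Longrightarrow> x \<in> cells A k \<Longrightarrow> y \<in> cells B l \<Longrightarrow>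
      modification C X (tri_mod k x l y)" for k x l y
    by (rule tri_modification) (cases k; cases l; simp)+
  have c: "tri_cell k x l y \<in> cells (Dbl_hop C X) (join k l)"
    if "dim k + dim l \<le> 2" "x \<in> cells A k" "y \<in> cells B l" for k x l y
    using that by (cases k; cases l) (simp_all add: m)
  have "qf_bd A B (Dbl_hop C X) tri_cell"
    unfolding qf_bd_def by (simp add: c) (simp add: tri_mod_def)
  moreover have "teval (Dbl_hop C X) (tfam tri_cell) k s = teval (Dbl_hop C X) (tfam tri_cell) k t"
    if "t_rel A B k s t" "k \<noteq> Sq" for k s t
  proof -
    note t1 = Dbl_simps(9,10,13,14)[OF transpose_Dbl[OF B C X tri_qf1]]
    note t2 = Dbl_simps(9,10,13,14)[OF transpose_Dbl[OF A C X tri_qf2]]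
    show ?thesis
      using that
    proof cases
      case (R_hcmp a f g)
      then show ?thesis using t1(3)[of a f g] by simp
    next
      case (R_hone a b)
      then show ?thesis using t1(1)[of a b] by simp
    next
      case (R_vcmp a f g)
      then show ?thesis using t1(4)[of a f g] by simp
    next
      case (R_vone a b)
      then show ?thesis using t1(2)[of a b] by simp
    next
      case (L_hcmp b f g)
      then show ?thesis using t2(3)[of b f g] by simp
    next
      case (L_hone a b)
      then show ?thesis using t2(1)[of b a] by simp
    next
      case (L_vcmp b f g)
      then show ?thesis using t2(4)[of b f g] by simp
    next
      case (L_vone a b)
      then show ?thesis using t2(2)[of b a] by simp
    qed simp_all
  qed
  ultimately show ?thesis unfolding pqf_def by blast
qed

lemma hop_eval_tri:
  assumes "dim k + dim l \<le> 2" "x \<in> cells A k" "y \<in> cells B l" "c \<in> cells C Ob"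
  shows "hop_eval C X c (join k l) (tri_cell k x l y) = tri k x l y Ob c"
proof -
  have "tri_cell k x l y \<in> cells (Dbl_hop C X) (join k l)"
    using tri_pqf assms by (simp add: pqf_def qf_bd_def)
  then show ?thesis
    using assms by (cases k; cases l) (auto simp: trib_def tri_mod_def)
qed

text \<open>
  Parallel modifications are equal as soon as their components agree, so the relations between
  squares may be checked after evaluation at each object.
\<close>

lemma tri_qf: "qf A B (Dbl_hop C X) tri_cell"
proof -
  let ?D = "Dbl_hop C X" and ?P = "tensor_pres A B"
  have D: "double_category ?D" by (rule double_category_hop[OF C X])
  have qb: "qf_bd A B ?D tri_cell" using tri_pqf by (simp add: pqf_def)
  have G: "gen_model ?P ?D (tfam tri_cell)" using qb by (simp add: gen_model_qf_bd[OF A B D])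
  have "teval ?D (tfam tri_cell) k s = teval ?D (tfam tri_cell) k t" if st: "t_rel A B k s t" for k s t
  proof (cases "k = Sq")
    case False
    then show ?thesis using tri_pqf st by (simp add: pqf_def)
  next
    case True
    note st = st[unfolded True]
    \<comment> \<open>The two sides are parallel by the relations between 1-cells alone, so there is
      no circularity.\<close>
    note bd = t_rel_bd[OF A B D tri_pqf st]
    have w: "twf ?P ?D (tfam tri_cell) Sq s" "twf ?P ?D (tfam tri_cell) Sq t" using bd by blast+
    from teval_cell[OF D G w(1)] obtain \<Theta> where \<Theta>: "teval ?D (tfam tri_cell) Sq s = ModC \<Theta>"
        "modification C X \<Theta>"
      by auto
    from teval_cell[OF D G w(2)] obtain \<Psi> where \<Psi>: "teval ?D (tfam tri_cell) Sq t = ModC \<Psi>"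
        "modification C X \<Psi>"
      by auto
    have "mmap \<Theta> c = mmap \<Psi> c" if c: "c \<in> cells C Ob" for c
    proof -
      note E = hop_eval_Dbl[OF C X c]
      let ?\<psi> = "tfam (\<lambda>k x l y. tri k x l y Ob c)"
      have e: "hop_eval C X c m (tfam tri_cell m g) = ?\<psi> m g" if "g \<in> pgen ?P m" for m g
        using that hop_eval_tri[OF _ _ _ c] by (cases g) (simp add: tensor_pgen)
      have ev: "teval X ?\<psi> Sq r = hop_eval C X c Sq (teval ?D (tfam tri_cell) Sq r)"
        if "twf ?P ?D (tfam tri_cell) Sq r" for r
        using gen_model_comp(1)[OF G D E that]
          twf_cong[of ?P "\<lambda>k g. hop_eval C X c k (tfam tri_cell k g)" ?\<psi>, OF e] by fastforce
      \<comment> \<open>After evaluation at \<open>c\<close> the relation is one for x \<otimes> y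
        \<otimes> c, where the third argument is an object.\<close>
      have "teval X ?\<psi> Sq s = teval X ?\<psi> Sq t"
        using tri_qf3[OF c] st by (simp add: qf_def)
      then show ?thesis using ev[OF w(1)] ev[OF w(2)] \<Theta> \<Psi> by simp
    qed
    then have "\<Theta> = \<Psi>"
      using bd \<Theta> \<Psi> by (intro modif_eqI[of _ _ "cells C Ob"]) (simp_all add: modificationD(9))
    then show ?thesis using \<Theta> \<Psi> True by simp
  qed
  then show ?thesis using qb unfolding qf_def by blast
qed

text \<open>Lifting \<open>tri_cell\<close> gives a double functor from \<open>A \<otimes> B\<close>
  to \<open>Dbl_hop C X\<close>, and untransposing it gives \<theta>; composite cells of
  \<open>A \<otimes> B\<close> are handled by the universal property.\<close>

lemma qf_assoc:
  obtains \<theta> where "qf (A \<otimes> B) C X \<theta>"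
    "\<And>k l m x y z. \<lbrakk>dim k + dim l + dim m \<le> 2; x \<in> cells A k; y \<in> cells B l; z \<in> cells C m\<rbrakk> \<Longrightarrow>
      \<theta> (join k l) (tcell A B k x l y) m z = \<phi> k x (join l m) (tcell B C l y m z)"
proof -
  let ?D = "Dbl_hop C X"
  have D: "double_category ?D" by (rule double_category_hop[OF C X])
  have AB: "double_category (A \<otimes> B)" by (rule double_category_tensor[OF A B])
  let ?G = "qlift A B ?D tri_cell"
  have G: "?G \<in> Dbl (A \<otimes> B) ?D" by (rule qlift_Dbl[OF A B D tri_qf])
  note q\<theta> = transpose_surj[OF AB C X G]
  show thesis
  proof (rule that[OF q\<theta>(1)])
    fix k l m x y z
    assume d: "dim k + dim l + dim m \<le> 2" and m: "x \<in> cells A k" "y \<in> cells B l" "z \<in> cells C m"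
    then have "?G (join k l) (tcell A B k x l y) = tri_cell k x l y"
      by (intro qlift_tcell[OF A B D tri_qf]) auto
    then show "untranspose ?G (join k l) (tcell A B k x l y) m z = \<phi> k x (join l m) (tcell B C l y m z)"
      using d m by (cases k; cases l; cases m) (simp_all add: untranspose_def tri_def trib_def
        tri_mod_def)
  qed
qed

end

section \<open>The monoidal structure\<close>

lemma join_assoc [simp]: "join (join k l) m = join k (join l m)"
  by (cases k; cases l; cases m) simp_all

lemma double_category_unit: "double_category unit_dbl"
  using generates_unit by (simp add: generates_def)

lemma tcell_mem:
  "\<lbrakk>double_category A; double_category B; j = join k l; dim k + dim l \<le> 2; x \<in> cells A k; y \<in> cells
    B l\<rbrakk> \<Longrightarrow>
    tcell A B k x l y \<in> cells (A \<otimes> B) j"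
  by (simp add: tcell_cell)

lemma unit_cell [simp]: "x \<in> cells unit_dbl k"
  by (simp add: unit_dbl_def)

text \<open>The definite description is resolved by \<open>qlift\<close> for existence and
  \<open>tensor_unique\<close> for uniqueness. The kind \<open>j\<close> is constrained by an
  equation so that the rule also rewrites where \<open>join k l\<close> has been simplified.\<close>

lemma tensor_map_props:
  assumes "double_category A" "double_category B" "double_category A'" "double_category B'"
    and F: "F \<in> Dbl A A'" and G: "G \<in> Dbl B B'"
  shows "tensor_map A A' B B' F G \<in> Dbl (A \<otimes> B) (A' \<otimes> B')" (is ?mem)
    and "\<And>j k l x y. \<lbrakk>j = join k l; dim k + dim l \<le> 2; x \<in> cells A k; y \<in> cells B l\<rbrakk> \<Longrightarrow>
      tensor_map A A' B B' F G j (tcell A B k x l y) = tcell A' B' k (F k x) l (G l y)"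
proof -
  let ?\<phi> = "\<lambda>k x l y. tcell A' B' k (F k x) l (G l y)"
  let ?H = "qlift A B (A' \<otimes> B') ?\<phi>"
  note AB = double_category_tensor[OF assms(3,4)]
  have q: "qf A B (A' \<otimes> B') ?\<phi>" by (rule qf_precomp[OF qf_tcell F G]) (use assms in simp_all)
  note h = qlift_Dbl[OF assms(1,2) AB q] and v = qlift_tcell[OF assms(1,2) AB q]
  have "tensor_map A A' B B' F G = ?H"
    unfolding tensor_map_def
    by (rule the_equality, use h v in blast, rule tensor_unique[OF assms(1,2) _ h]) (simp_all add: v)
  then show ?mem "\<And>j k l x y. \<lbrakk>j = join k l; dim k + dim l \<le> 2; x \<in> cells A k; y \<in> cells B l\<rbrakk> \<Longrightarrow>
      tensor_map A A' B B' F G j (tcell A B k x l y) = tcell A' B' k (F k x) l (G l y)"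
    using h v by simp_all
qed

lemma tensor_map_id:
  assumes A: "double_category A" and B: "double_category B"
  shows "tensor_map A A B B (dbl_id A) (dbl_id B) = dbl_id (A \<otimes> B)"
proof (rule tensor_unique[OF A B])
  note t = tensor_map_props[OF A B A B Dbl_id[OF A] Dbl_id[OF B]]
  show "tensor_map A A B B (dbl_id A) (dbl_id B) \<in> Dbl (A \<otimes> B) (A \<otimes> B)" by (rule t)
  show "dbl_id (A \<otimes> B) \<in> Dbl (A \<otimes> B) (A \<otimes> B)" by (rule Dbl_id[OF double_category_tensor[OF A B]])
qed (simp add: tensor_map_props(2)[OF A B A B Dbl_id[OF A] Dbl_id[OF B]] tcell_mem[OF A B])

lemma tensor_map_comp:
  assumes A: "double_category A" "double_category A'" "double_category A''"
    and B: "double_category B" "double_category B'" "double_category B''"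
    and F: "F \<in> Dbl A A'" "F' \<in> Dbl A' A''" and G: "G \<in> Dbl B B'" "G' \<in> Dbl B' B''"
  shows "tensor_map A A'' B B'' (dbl_comp A F' F) (dbl_comp B G' G)
    = dbl_comp (A \<otimes> B) (tensor_map A' A'' B' B'' F' G') (tensor_map A A' B B' F G)"
proof (rule tensor_unique[OF A(1) B(1)])
  note t = tensor_map_props[OF A(1) B(1) A(2) B(2) F(1) G(1)]
    tensor_map_props[OF A(2) B(2) A(3) B(3) F(2) G(2)]
    tensor_map_props[OF A(1) B(1) A(3) B(3) Dbl_comp[OF A(1) F] Dbl_comp[OF B(1) G]]
  show "tensor_map A A'' B B'' (dbl_comp A F' F) (dbl_comp B G' G) \<in> Dbl (A \<otimes> B) (A'' \<otimes> B'')" by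
      (rule t)
  show "dbl_comp (A \<otimes> B) (tensor_map A' A'' B' B'' F' G') (tensor_map A A' B B' F G) \<in> Dbl (A \<otimes> B)
      (A'' \<otimes> B'')"
    by (rule Dbl_comp[OF double_category_tensor[OF A(1) B(1)] t(1,3)])
  show "tensor_map A A'' B B'' (dbl_comp A F' F) (dbl_comp B G' G) (join k l) (tcell A B k x l y)
      = dbl_comp (A \<otimes> B) (tensor_map A' A'' B' B'' F' G') (tensor_map A A' B B' F G) (join k l)
        (tcell A B k x l y)"
    if "dim k + dim l \<le> 2" "x \<in> cells A k" "y \<in> cells B l" for k l x y
    using that by (simp add: t Dbl_cell[OF F(1)] Dbl_cell[OF G(1)] tcell_mem[OF A(1) B(1)])
qed

subsection \<open>Unit isomorphisms\<close>

lemma lunit_unique: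
  assumes A: "double_category A" and H: "H \<in> Dbl (unit_dbl \<otimes> A) X" "H' \<in> Dbl (unit_dbl \<otimes> A) X"
    and e: "\<And>k x. x \<in> cells A k \<Longrightarrow> H k (tcell unit_dbl A Ob () k x) = H' k (tcell unit_dbl A Ob () k x)"
  shows "H = H'"
  by (rule generates_unique[OF generates_tensor[OF generates_unit generates_cells[OF A]] H refl])
    (auto simp: tens_def e split: if_splits)

lemma runit_unique:
  assumes A: "double_category A" and H: "H \<in> Dbl (A \<otimes> unit_dbl) X" "H' \<in> Dbl (A \<otimes> unit_dbl) X"
    and e: "\<And>k x. x \<in> cells A k \<Longrightarrow> H k (tcell A unit_dbl k x Ob ()) = H' k (tcell A unit_dbl k x Ob ())"
  shows "H = H'"
  by (rule generates_unique[OF generates_tensor[OF generates_cells[OF A] generates_unit] H refl])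
    (auto simp: tens_def e split: if_splits)

lemma constant_Dbl:
  assumes X: "double_category X" and d: "d \<in> cells X Ob"
  shows "(\<lambda>k _. case k of Ob \<Rightarrow> d | Hor \<Rightarrow> hone X d | Ver \<Rightarrow> vone X d | Sq \<Rightarrow> idv X (hone X d)) \<in> Dbl
      unit_dbl X"
proof (rule DblI)
  show "(case k of Ob \<Rightarrow> d | Hor \<Rightarrow> hone X d | Ver \<Rightarrow> vone X d | Sq \<Rightarrow> idv X (hone X d)) \<in> cells X k" for k
    using d by (cases k) (simp_all add: dc[OF X])
qed (use d in \<open>simp_all add: dc[OF X] extensional_def\<close>)

text \<open>Under transposition the required quasi-functor is the constant double functor at the
  identity of \<open>A\<close> in \<open>Dbl_hop A A\<close>.\<close>

lemma lunit_qf: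
  assumes A: "double_category A"
  obtains \<phi> where "qf unit_dbl A A \<phi>" "\<And>k x. x \<in> cells A k \<Longrightarrow> \<phi> Ob () k x = x"
proof -
  have "FunC (dbl_id A) \<in> cells (Dbl_hop A A) Ob" using A by auto
  note K = constant_Dbl[OF double_category_hop[OF A A] this]
  note q = transpose_surj[OF double_category_unit A A K]
  show thesis
    by (rule that[OF q(1)]) (simp add: untranspose_def)
qed

text \<open>The unit double category is its own vertical dual, so \<open>qf_swap\<close> carries the
  left unit to the right one.\<close>

lemma runit_qf:
  assumes A: "double_category A"
  obtains \<phi> where "qf A unit_dbl A \<phi>" "\<And>k x. x \<in> cells A k \<Longrightarrow> \<phi> k x Ob () = x"
proof -
  obtain \<phi> where q: "qf unit_dbl (vop A) (vop A) \<phi>" "\<And>k x. x \<in> cells A k \<Longrightarrow> \<phi> Ob () k x = x"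
    using lunit_qf[of "vop A"] A by auto
  have "qf A unit_dbl A (\<lambda>k x l y. \<phi> l y k x)" using qf_swap[OF q(1)] by simp
  then show thesis by (rule that) (simp add: q)
qed

lemma dim_le [simp]: "dim k \<le> 2"
  by (cases k) simp_all

lemma dbl_lunit_props:
  assumes A: "double_category A"
  shows "dbl_lunit A \<in> Dbl (unit_dbl \<otimes> A) A"
    and "\<And>k x. x \<in> cells A k \<Longrightarrow> dbl_lunit A k (tcell unit_dbl A Ob () k x) = x"
proof -
  obtain \<phi> where q: "qf unit_dbl A A \<phi>" "\<And>k x. x \<in> cells A k \<Longrightarrow> \<phi> Ob () k x = x"
    using lunit_qf[OF A] by blast
  let ?H = "qlift unit_dbl A A \<phi>"
  note h = qlift_Dbl[OF double_category_unit A A q(1)]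
  have v: "?H k (tcell unit_dbl A Ob () k x) = x" if "x \<in> cells A k" for k x
    using qlift_tcell[OF double_category_unit A A q(1), of Ob k "()" x] that q(2) by simp
  have "dbl_lunit A = ?H"
    unfolding dbl_lunit_def
    by (rule the_equality, use h v in blast, rule lunit_unique[OF A _ h]) (simp_all add: v)
  then show "dbl_lunit A \<in> Dbl (unit_dbl \<otimes> A) A"
    "\<And>k x. x \<in> cells A k \<Longrightarrow> dbl_lunit A k (tcell unit_dbl A Ob () k x) = x"
    using h v by simp_all
qed

lemma dbl_runit_props:
  assumes A: "double_category A"
  shows "dbl_runit A \<in> Dbl (A \<otimes> unit_dbl) A"
    and "\<And>k x. x \<in> cells A k \<Longrightarrow> dbl_runit A k (tcell A unit_dbl k x Ob ()) = x"
proof -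
  obtain \<phi> where q: "qf A unit_dbl A \<phi>" "\<And>k x. x \<in> cells A k \<Longrightarrow> \<phi> k x Ob () = x"
    using runit_qf[OF A] by blast
  let ?H = "qlift A unit_dbl A \<phi>"
  note h = qlift_Dbl[OF A double_category_unit A q(1)]
  have v: "?H k (tcell A unit_dbl k x Ob ()) = x" if "x \<in> cells A k" for k x
    using qlift_tcell[OF A double_category_unit A q(1), of k Ob x "()"] that q(2) by simp
  have "dbl_runit A = ?H"
    unfolding dbl_runit_def
    by (rule the_equality, use h v in blast, rule runit_unique[OF A _ h]) (simp_all add: v)
  then show "dbl_runit A \<in> Dbl (A \<otimes> unit_dbl) A"
    "\<And>k x. x \<in> cells A k \<Longrightarrow> dbl_runit A k (tcell A unit_dbl k x Ob ()) = x"
    using h v by simp_all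
qed

lemma dbl_lunit_iso:
  assumes A: "double_category A"
  shows "dbl_iso (unit_dbl \<otimes> A) A (dbl_lunit A)"
proof -
  note U = double_category_unit and l = dbl_lunit_props[OF A]
  note UA = double_category_tensor[OF U A]
  let ?G = "slice_fun A (tcell unit_dbl A) ()"
  have G: "?G \<in> Dbl A (unit_dbl \<otimes> A)" by (rule slice_fun_Dbl[OF U A UA qf_tcell[OF U A]]) simp
  have 1: "dbl_comp A (dbl_lunit A) ?G = dbl_id A"
    by (rule Dbl_eqI[OF Dbl_comp[OF A G l(1)] Dbl_id[OF A]]) (simp add: l)
  have 2: "dbl_comp (unit_dbl \<otimes> A) ?G (dbl_lunit A) = dbl_id (unit_dbl \<otimes> A)"
    by (rule lunit_unique[OF A Dbl_comp[OF UA l(1) G] Dbl_id[OF UA]])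
      (simp add: l tcell_mem[OF U A])
  show ?thesis unfolding dbl_iso_def using l(1) G 1 2 by blast
qed

lemma dbl_runit_iso:
  assumes A: "double_category A"
  shows "dbl_iso (A \<otimes> unit_dbl) A (dbl_runit A)"
proof -
  note U = double_category_unit and l = dbl_runit_props[OF A]
  note UA = double_category_tensor[OF A U]
  let ?G = "\<lambda>k. \<lambda>x\<in>cells A k. tcell A unit_dbl k x Ob ()"
  have G: "?G \<in> Dbl A (A \<otimes> unit_dbl)" by (rule right_slice_Dbl[OF A U UA qf_tcell[OF A U]]) simp
  have 1: "dbl_comp A (dbl_runit A) ?G = dbl_id A"
    by (rule Dbl_eqI[OF Dbl_comp[OF A G l(1)] Dbl_id[OF A]]) (simp add: l)
  have 2: "dbl_comp (A \<otimes> unit_dbl) ?G (dbl_runit A) = dbl_id (A \<otimes> unit_dbl)"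
    by (rule runit_unique[OF A Dbl_comp[OF UA l(1) G] Dbl_id[OF UA]])
      (simp add: l tcell_mem[OF A U])
  show ?thesis unfolding dbl_iso_def using l(1) G 1 2 by blast
qed

lemma dbl_lunit_natural:
  assumes A: "double_category A" and A': "double_category A'" and F: "F \<in> Dbl A A'"
  shows "dbl_comp (unit_dbl \<otimes> A) (dbl_lunit A') (tensor_map unit_dbl unit_dbl A A' (dbl_id unit_dbl) F)
    = dbl_comp (unit_dbl \<otimes> A) F (dbl_lunit A)"
proof -
  note U = double_category_unit
  note UA = double_category_tensor[OF U A]
  note t = tensor_map_props[OF U A U A' Dbl_id[OF U] F] and l = dbl_lunit_props[OF A] and l' =
      dbl_lunit_props[OF A']
  show ?thesis
    by (rule lunit_unique[OF A Dbl_comp[OF UA t(1) l'(1)] Dbl_comp[OF UA l(1) F]])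
      (simp add: t l l' tcell_mem[OF U A] Dbl_cell[OF F])
qed

lemma dbl_runit_natural:
  assumes A: "double_category A" and A': "double_category A'" and F: "F \<in> Dbl A A'"
  shows "dbl_comp (A \<otimes> unit_dbl) (dbl_runit A') (tensor_map A A' unit_dbl unit_dbl F (dbl_id unit_dbl))
    = dbl_comp (A \<otimes> unit_dbl) F (dbl_runit A)"
proof -
  note U = double_category_unit
  note UA = double_category_tensor[OF A U]
  note t = tensor_map_props[OF A U A' U F Dbl_id[OF U]] and l = dbl_runit_props[OF A] and l' =
      dbl_runit_props[OF A']
  show ?thesis
    by (rule runit_unique[OF A Dbl_comp[OF UA t(1) l'(1)] Dbl_comp[OF UA l(1) F]])
      (simp add: t l l' tcell_mem[OF A U] Dbl_cell[OF F])
qed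

subsection \<open>Associativity isomorphism\<close>

text \<open>By \<open>dim_join\<close> the bound on nested pairs becomes the bound on the total
  dimension, so no cube has to be compared.\<close>

lemma unique3:
  assumes "double_category A" "double_category B" "double_category C"
    and H: "H \<in> Dbl (A \<otimes> B \<otimes> C) X" "H' \<in> Dbl (A \<otimes> B \<otimes> C) X"
    and e: "\<And>k l m x y z. \<lbrakk>dim k + dim l + dim m \<le> 2; x \<in> cells A k; y \<in> cells B l; z \<in> cells C m\<rbrakk> \<Longrightarrow>
      H (join k (join l m)) (tcell (A \<otimes> B) C (join k l) (tcell A B k x l y) m z)
      = H' (join k (join l m)) (tcell (A \<otimes> B) C (join k l) (tcell A B k x l y) m z)"
  shows "H = H'"
  by (rule generates_unique[OF generates_tensor[OF generates_tensor[OF generates_cells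
      generates_cells] generates_cells] H refl])
    (use assms(1-3) in \<open>auto simp: tens_def dim_join e\<close>)

lemma unique3':
  assumes "double_category A" "double_category B" "double_category C"
    and H: "H \<in> Dbl (A \<otimes> (B \<otimes> C)) X" "H' \<in> Dbl (A \<otimes> (B \<otimes> C)) X"
    and e: "\<And>k l m x y z. \<lbrakk>dim k + dim l + dim m \<le> 2; x \<in> cells A k; y \<in> cells B l; z \<in> cells C m\<rbrakk> \<Longrightarrow>
      H (join k (join l m)) (tcell A (B \<otimes> C) k x (join l m) (tcell B C l y m z))
      = H' (join k (join l m)) (tcell A (B \<otimes> C) k x (join l m) (tcell B C l y m z))"
  shows "H = H'"
  by (rule generates_unique[OF generates_tensor[OF generates_cells
      generates_tensor[OF generates_cells generates_cells]] H refl])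
    (use assms(1-3) in \<open>auto simp: tens_def dim_join e\<close>)

lemma unique4:
  assumes "double_category A" "double_category B" "double_category C" "double_category D"
    and H: "H \<in> Dbl (A \<otimes> B \<otimes> C \<otimes> D) X" "H' \<in> Dbl (A \<otimes> B \<otimes> C \<otimes> D) X"
    and e: "\<And>k l m n x y z t. \<lbrakk>dim k + dim l + dim m + dim n \<le> 2; x \<in> cells A k; y \<in> cells B l; z \<in>
        cells C m; t \<in> cells D n\<rbrakk> \<Longrightarrow>
      H (join k (join l (join m n))) (tcell (A \<otimes> B \<otimes> C) D (join k (join l m))
        (tcell (A \<otimes> B) C (join k l) (tcell A B k x l y) m z) n t)
      = H' (join k (join l (join m n))) (tcell (A \<otimes> B \<otimes> C) D (join k (join l m))
        (tcell (A \<otimes> B) C (join k l) (tcell A B k x l y) m z) n t)"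
  shows "H = H'"
  by (rule generates_unique[OF generates_tensor[OF
      generates_tensor[OF generates_tensor[OF generates_cells generates_cells] generates_cells]
        generates_cells] H refl])
    (use assms(1-4) in \<open>auto simp: tens_def dim_join e[folded join_assoc] simp flip: join_assoc\<close>)

text \<open>The form of \<open>qf_swap\<close> that acts on an argument which is itself a tensor
  product.\<close>

lemma tensor_swap:
  assumes B: "double_category B" and C: "double_category C"
  obtains \<tau> where "\<tau> \<in> Dbl (B \<otimes> C) (vop (vop C \<otimes> vop B))"
    "\<And>k l y z. \<lbrakk>dim k + dim l \<le> 2; y \<in> cells B k; z \<in> cells C l\<rbrakk> \<Longrightarrow>
      \<tau> (join k l) (tcell B C k y l z) = tcell (vop C) (vop B) l z k y"
proof -
  let ?\<phi> = "\<lambda>k y l z. tcell (vop C) (vop B) l z k y"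
  have v: "double_category (vop C)" "double_category (vop B)" using B C by simp_all
  have q: "qf B C (vop (vop C \<otimes> vop B)) ?\<phi>"
    using qf_swap[OF qf_tcell[OF v]] by simp
  have D: "double_category (vop (vop C \<otimes> vop B))" using double_category_tensor[OF v] by simp
  show thesis
    by (rule that[OF qlift_Dbl[OF B C D q]]) (rule qlift_tcell[OF B C D q])
qed

text \<open>The converse of \<open>qf_assoc\<close> is its image under the vertical duality.\<close>

lemma qf_assoc':
  assumes A: "double_category A" and B: "double_category B" and C: "double_category C" and X:
      "double_category X"
    and q: "qf (A \<otimes> B) C X \<phi>"
  obtains \<theta> where "qf A (B \<otimes> C) X \<theta>"
    "\<And>k l m x y z. \<lbrakk>dim k + dim l + dim m \<le> 2; x \<in> cells A k; y \<in> cells B l; z \<in> cells C m\<rbrakk> \<Longrightarrow>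
      \<theta> k x (join l m) (tcell B C l y m z) = \<phi> (join k l) (tcell A B k x l y) m z"
proof -
  have v: "double_category (vop A)" "double_category (vop B)" "double_category (vop C)"
      "double_category (vop X)"
    using A B C X by simp_all
  obtain \<sigma> where s: "\<sigma> \<in> Dbl (vop B \<otimes> vop A) (vop (A \<otimes> B))"
    "\<And>l k y x. \<lbrakk>dim l + dim k \<le> 2; y \<in> cells B l; x \<in> cells A k\<rbrakk> \<Longrightarrow>
      \<sigma> (join l k) (tcell (vop B) (vop A) l y k x) = tcell A B k x l y"
    using tensor_swap[OF v(2,1)] by auto
  obtain \<tau> where t: "\<tau> \<in> Dbl (B \<otimes> C) (vop (vop C \<otimes> vop B))"
    "\<And>k l y z. \<lbrakk>dim k + dim l \<le> 2; y \<in> cells B k; z \<in> cells C l\<rbrakk> \<Longrightarrow>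
      \<tau> (join k l) (tcell B C k y l z) = tcell (vop C) (vop B) l z k y"
    using tensor_swap[OF B C] by blast
  \<comment> \<open>Exchanging the arguments and precomposing with \<sigma> brings \<phi> into the
    shape required by \<open>qf_assoc\<close> for the reversed triple \<open>vop C\<close>,
    \<open>vop B\<close>, \<open>vop A\<close>; afterwards \<tau> and a second exchange restore the
    order.\<close>
  have q2: "qf (vop C) (vop B \<otimes> vop A) (vop X) (\<lambda>m z j w. \<phi> j (\<sigma> j w) m (dbl_id (vop C) m z))"
    by (rule qf_precomp[OF qf_swap[OF q] Dbl_id[OF v(3)] s(1) v(3) double_category_tensor[OF v(2,1)]])
  obtain \<theta> where h: "qf (vop C \<otimes> vop B) (vop A) (vop X) \<theta>"
    "\<And>m l k z y x. \<lbrakk>dim m + dim l + dim k \<le> 2; z \<in> cells (vop C) m; y \<in> cells (vop B) l; x \<in> cells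
      (vop A) k\<rbrakk> \<Longrightarrow>
      \<theta> (join m l) (tcell (vop C) (vop B) m z l y) k x
      = \<phi> (join l k) (\<sigma> (join l k) (tcell (vop B) (vop A) l y k x)) m (dbl_id (vop C) m z)"
    using qf_assoc[OF v(3,2,1,4) q2] by metis
  have q3: "qf A (vop (vop C \<otimes> vop B)) X (\<lambda>k x j w. \<theta> j w k x)"
    using qf_swap[OF h(1)] by simp
  have q4: "qf A (B \<otimes> C) X (\<lambda>k x j w. \<theta> j (\<tau> j w) k (dbl_id A k x))"
    by (rule qf_precomp[OF q3 Dbl_id[OF A] t(1) A double_category_tensor[OF B C]])
  show thesis
  proof (rule that[OF q4])
    fix k l m x y z
    assume d: "dim k + dim l + dim m \<le> 2" and c: "x \<in> cells A k" "y \<in> cells B l" "z \<in> cells C m"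
    then have "\<theta> (join l m) (\<tau> (join l m) (tcell B C l y m z)) k (dbl_id A k x)
        = \<theta> (join m l) (tcell (vop C) (vop B) m z l y) k x"
      using t(2)[of l m y z] join_comm[of l m] by simp
    also have "\<dots> = \<phi> (join k l) (tcell A B k x l y) m z"
      using h(2)[of m l k z y x] s(2)[of l k y x] d c join_comm[of l k] by simp
    finally show "\<theta> (join l m) (\<tau> (join l m) (tcell B C l y m z)) k (dbl_id A k x)
        = \<phi> (join k l) (tcell A B k x l y) m z" .
  qed
qed

context
  fixes A :: "'a dblcat" and B :: "'b dblcat" and C :: "'c dblcat"
  assumes A: "double_category A" and B: "double_category B" and C: "double_category C"
begin

text \<open>The free kinds \<open>i\<close> and \<open>j\<close> serve the same purpose as in
  \<open>tensor_map_props\<close>: nested kinds are normalised by \<open>join_assoc\<close> before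
  the rule is applied.\<close>

lemma dbl_assoc_props:
  shows "dbl_assoc A B C \<in> Dbl (A \<otimes> B \<otimes> C) (A \<otimes> (B \<otimes> C))" (is ?mem)
    and "\<And>i j k l m x y z. \<lbrakk>j = join k (join l m); i = join k l; dim k + dim l + dim m \<le> 2; x \<in>
        cells A k; y \<in> cells B l; z \<in> cells C m\<rbrakk> \<Longrightarrow>
      dbl_assoc A B C j (tcell (A \<otimes> B) C i (tcell A B k x l y) m z)
      = tcell A (B \<otimes> C) k x (join l m) (tcell B C l y m z)"
proof -
  note AB = double_category_tensor[OF A B] and BC = double_category_tensor[OF B C]
  note R = double_category_tensor[OF A BC]
  obtain \<theta> where q: "qf (A \<otimes> B) C (A \<otimes> (B \<otimes> C)) \<theta>"
    and e: "\<And>k l m x y z. \<lbrakk>dim k + dim l + dim m \<le> 2; x \<in> cells A k; y \<in> cells B l; z \<in> cells C m\<rbrakk> \<Longrightarrow>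
      \<theta> (join k l) (tcell A B k x l y) m z = tcell A (B \<otimes> C) k x (join l m) (tcell B C l y m z)"
    using qf_assoc[OF A B C R qf_tcell[OF A BC]] by blast
  let ?H = "qlift (A \<otimes> B) C (A \<otimes> (B \<otimes> C)) \<theta>"
  note h = qlift_Dbl[OF AB C R q]
  have v: "?H (join k (join l m)) (tcell (A \<otimes> B) C (join k l) (tcell A B k x l y) m z)
      = tcell A (B \<otimes> C) k x (join l m) (tcell B C l y m z)"
    if "dim k + dim l + dim m \<le> 2" "x \<in> cells A k" "y \<in> cells B l" "z \<in> cells C m" for k l m x y z
    using qlift_tcell[OF AB C R q, of "join k l" m "tcell A B k x l y" z] that e[OF that]
    by (simp add: dim_join tcell_mem[OF A B])
  have "dbl_assoc A B C = ?H"
    unfolding dbl_assoc_def join_assoc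
    by (rule the_equality, use h v in blast, rule unique3[OF A B C _ h]) (simp_all add: v)
  then show ?mem "\<And>i j k l m x y z. \<lbrakk>j = join k (join l m); i = join k l; dim k + dim l + dim m \<le> 2;
      x \<in> cells A k; y \<in> cells B l; z \<in> cells C m\<rbrakk> \<Longrightarrow>
      dbl_assoc A B C j (tcell (A \<otimes> B) C i (tcell A B k x l y) m z)
      = tcell A (B \<otimes> C) k x (join l m) (tcell B C l y m z)"
    using h v by simp_all
qed

lemma dbl_assoc_iso: "dbl_iso (A \<otimes> B \<otimes> C) (A \<otimes> (B \<otimes> C)) (dbl_assoc A B C)"
proof -
  note AB = double_category_tensor[OF A B] and BC = double_category_tensor[OF B C]
  note R = double_category_tensor[OF A BC] and L = double_category_tensor[OF AB C]
  note a = dbl_assoc_props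
  obtain \<theta> where q: "qf A (B \<otimes> C) (A \<otimes> B \<otimes> C) \<theta>"
    and e: "\<And>k l m x y z. \<lbrakk>dim k + dim l + dim m \<le> 2; x \<in> cells A k; y \<in> cells B l; z \<in> cells C m\<rbrakk> \<Longrightarrow>
      \<theta> k x (join l m) (tcell B C l y m z) = tcell (A \<otimes> B) C (join k l) (tcell A B k x l y) m z"
    using qf_assoc'[OF A B C L qf_tcell[OF AB C]] by blast
  let ?G = "qlift A (B \<otimes> C) (A \<otimes> B \<otimes> C) \<theta>"
  note g = qlift_Dbl[OF A BC L q]
  have v: "?G (join k (join l m)) (tcell A (B \<otimes> C) k x (join l m) (tcell B C l y m z))
      = tcell (A \<otimes> B) C (join k l) (tcell A B k x l y) m z"
    if "dim k + dim l + dim m \<le> 2" "x \<in> cells A k" "y \<in> cells B l" "z \<in> cells C m" for k l m x y z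
    using qlift_tcell[OF A BC L q, of k "join l m" x "tcell B C l y m z"] that e[OF that]
    by (simp add: dim_join tcell_mem[OF B C])
  \<comment> \<open>The two double functors come from the two universal properties separately; they
    are inverse because they only rebracket generating triples.\<close>
  have 1: "dbl_comp (A \<otimes> B \<otimes> C) ?G (dbl_assoc A B C) = dbl_id (A \<otimes> B \<otimes> C)"
    by (rule unique3[OF A B C Dbl_comp[OF L a(1) g] Dbl_id[OF L]])
      (simp add: a v tcell_mem[OF AB C] tcell_mem[OF A B] dim_join)
  have 2: "dbl_comp (A \<otimes> (B \<otimes> C)) (dbl_assoc A B C) ?G = dbl_id (A \<otimes> (B \<otimes> C))"
    by (rule unique3'[OF A B C Dbl_comp[OF R g a(1)] Dbl_id[OF R]])
      (simp add: a v tcell_mem[OF A BC] tcell_mem[OF B C] dim_join)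
  show ?thesis unfolding dbl_iso_def using a(1) g 1 2 by blast
qed

lemma dbl_assoc_natural:
  assumes A': "double_category A'" and B': "double_category B'" and C': "double_category C'"
    and F: "F \<in> Dbl A A'" and G: "G \<in> Dbl B B'" and H: "H \<in> Dbl C C'"
  shows "dbl_comp (A \<otimes> B \<otimes> C) (dbl_assoc A' B' C')
      (tensor_map (A \<otimes> B) (A' \<otimes> B') C C' (tensor_map A A' B B' F G) H)
    = dbl_comp (A \<otimes> B \<otimes> C)
        (tensor_map A A' (B \<otimes> C) (B' \<otimes> C') F (tensor_map B B' C C' G H)) (dbl_assoc A B C)"
proof -
  note AB = double_category_tensor[OF A B] and BC = double_category_tensor[OF B C]
  note AB' = double_category_tensor[OF A' B'] and BC' = double_category_tensor[OF B' C']
  note R = double_category_tensor[OF A BC] and L = double_category_tensor[OF AB C]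
  note a = dbl_assoc_props and a' = Submission.dbl_assoc_props[OF A' B' C']
  note FG = tensor_map_props[OF A B A' B' F G] and GH = tensor_map_props[OF B C B' C' G H]
  note FG_H = tensor_map_props[OF AB C AB' C' FG(1) H] and F_GH = tensor_map_props[OF A BC A' BC' F
      GH(1)]
  show ?thesis
    by (rule unique3[OF A B C Dbl_comp[OF L FG_H(1) a'(1)] Dbl_comp[OF L a(1) F_GH(1)]])
      (simp add: a a' FG GH FG_H F_GH tcell_mem[OF AB C] tcell_mem[OF A B] tcell_mem[OF B C] dim_join
        Dbl_cell[OF F] Dbl_cell[OF G] Dbl_cell[OF H])
qed

end

section \<open>Coherence\<close>

lemma pentagon:
  assumes A: "double_category A" and B: "double_category B" and C: "double_category C" and D:
      "double_category D"
  shows "dbl_comp (A \<otimes> B \<otimes> C \<otimes> D) (dbl_assoc A B (C \<otimes> D)) (dbl_assoc (A \<otimes> B) C D)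
     = dbl_comp (A \<otimes> B \<otimes> C \<otimes> D)
         (tensor_map A A (B \<otimes> C \<otimes> D) (B \<otimes> (C \<otimes> D)) (dbl_id A) (dbl_assoc B C D))
         (dbl_comp (A \<otimes> B \<otimes> C \<otimes> D) (dbl_assoc A (B \<otimes> C) D)
           (tensor_map (A \<otimes> B \<otimes> C) (A \<otimes> (B \<otimes> C)) D D (dbl_assoc A B C) (dbl_id D)))"
proof -
  note AB = double_category_tensor[OF A B] and BC = double_category_tensor[OF B C]
    and CD = double_category_tensor[OF C D]
  note ABC = double_category_tensor[OF AB C] and A_BC = double_category_tensor[OF A BC]
    and BCD = double_category_tensor[OF BC D] and B_CD = double_category_tensor[OF B CD]
  note L = double_category_tensor[OF ABC D]
  note a1 = dbl_assoc_props[OF A B CD] and a2 = dbl_assoc_props[OF AB C D] and a3 =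
      dbl_assoc_props[OF B C D]
    and a4 = dbl_assoc_props[OF A BC D] and a5 = dbl_assoc_props[OF A B C]
  note t1 = tensor_map_props[OF A BCD A B_CD Dbl_id[OF A] a3(1)]
    and t2 = tensor_map_props[OF ABC D A_BC D a5(1) Dbl_id[OF D]]
  show ?thesis
    by (rule unique4[OF A B C D Dbl_comp[OF L a2(1) a1(1)] Dbl_comp[OF L Dbl_comp[OF L t2(1) a4(1)]
        t1(1)]])
      (simp add: a1 a2 a3 a4 a5 t1 t2 dim_join tcell_mem[OF A B] tcell_mem[OF B C] tcell_mem[OF C D]
        tcell_mem[OF AB C] tcell_mem[OF ABC D] tcell_mem[OF A BC] tcell_mem[OF BC D] tcell_mem[OF B CD])
qed

text \<open>The middle argument has to be tested only at the object of the unit, and there both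
  sides send (x \<otimes> ()) \<otimes> z to x \<otimes> z.\<close>

lemma triangle:
  assumes A: "double_category A" and B: "double_category B"
  shows "dbl_comp (A \<otimes> unit_dbl \<otimes> B)
       (tensor_map A A (unit_dbl \<otimes> B) B (dbl_id A) (dbl_lunit B)) (dbl_assoc A unit_dbl B)
     = tensor_map (A \<otimes> unit_dbl) A B B (dbl_runit A) (dbl_id B)" (is "?H = ?H'")
proof -
  note U = double_category_unit
  note AU = double_category_tensor[OF A U] and UB = double_category_tensor[OF U B]
  note L = double_category_tensor[OF AU B]
  note a = dbl_assoc_props[OF A U B] and l = dbl_lunit_props[OF B] and r = dbl_runit_props[OF A]
  note t1 = tensor_map_props[OF A UB A B Dbl_id[OF A] l(1)] and t2 = tensor_map_props[OF AU B A B
      r(1) Dbl_id[OF B]]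
  have e: "?H (join k m) (tcell (A \<otimes> unit_dbl) B k (tcell A unit_dbl k x Ob ()) m z)
      = ?H' (join k m) (tcell (A \<otimes> unit_dbl) B k (tcell A unit_dbl k x Ob ()) m z)"
    if "dim k + dim m \<le> 2" "x \<in> cells A k" "z \<in> cells B m" for k m x z
    using that a(2)[of "join k m" k Ob m k x "()" z]
    by (simp add: l r t1 t2 tcell_mem[OF A U] tcell_mem[OF U B] tcell_mem[OF AU B])
  show ?thesis
    by (rule generates_unique[OF generates_tensor[OF generates_tensor[OF generates_cells[OF A]
        generates_unit]
            generates_cells[OF B]] Dbl_comp[OF L a(1) t1(1)] t2(1) refl])
      (auto simp: tens_def e split: if_splits)
qed

section \<open>Naturality of the two adjunctions\<close>

lemma hop_transpose_natural:
  assumes A: "double_category A" "double_category A'" and B: "double_category B"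
    and C: "double_category C"
    and P: "P \<in> Dbl A' A" and H: "H \<in> Dbl (A \<otimes> B) C" and Q: "Q \<in> Dbl C C'"
  shows "hop_transpose A' B
      (dbl_comp (A' \<otimes> B) Q (dbl_comp (A' \<otimes> B) H (tensor_map A' A B B P (dbl_id B))))
    = dbl_comp A' (Dbl_hop_map B C Q) (dbl_comp A' (hop_transpose A B H) P)"
proof -
  note t = tensor_map_props[OF A(2) B A(1) B P Dbl_id[OF B]]
  have "hop_transpose A' B (dbl_comp (A' \<otimes> B) Q
      (dbl_comp (A' \<otimes> B) H (tensor_map A' A B B P (dbl_id B))))
      = transpose A' B (\<lambda>k x l y. Q (join k l) (H (join k l) (tcell A B k (P k x) l y)))"
    unfolding hop_transpose_def
    by (rule transpose_cong[OF A(2)]) (simp add: t tcell_mem[OF A(2) B])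
  also have "\<dots> = dbl_comp A' (Dbl_hop_map B C Q) (dbl_comp A' (hop_transpose A B H) P)"
    unfolding hop_transpose_def
    by (rule transpose_natural[OF A(2,1) B C P Dbl_qf[OF A(1) B H C] Q])
  finally show ?thesis .
qed

lemma hlx_transpose_natural:
  assumes A: "double_category A" "double_category A'" and B: "double_category B"
    and C: "double_category C"
    and P: "P \<in> Dbl A' A" and H: "H \<in> Dbl (B \<otimes> A) C" and Q: "Q \<in> Dbl C C'"
  shows "hlx_transpose A' B
      (dbl_comp (B \<otimes> A') Q (dbl_comp (B \<otimes> A') H (tensor_map B B A' A (dbl_id B) P)))
    = dbl_comp A' (Dbl_hlx_map B C Q) (dbl_comp A' (hlx_transpose A B H) P)"
proof -
  note t = tensor_map_props[OF B A(2) B A(1) Dbl_id[OF B] P]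
  have v: "double_category (vop A)" "double_category (vop A')" "double_category (vop B)"
      "double_category (vop C)"
    using A B C by simp_all
  have PQ: "P \<in> Dbl (vop A') (vop A)" "Q \<in> Dbl (vop C) (vop C')" using P Q by simp_all
  have "hlx_transpose A' B (dbl_comp (B \<otimes> A') Q (dbl_comp (B \<otimes> A') H (tensor_map B B A' A (dbl_id B)
      P)))
      = transpose (vop A') (vop B) (\<lambda>k x l y. Q (join k l) (H (join l k) (tcell B A l y k (P k x))))"
    unfolding hlx_transpose_def
    by (rule transpose_cong[OF v(2)]) (simp add: t tcell_mem[OF B A(2)] join_comm add.commute)
  also have "\<dots> = dbl_comp (vop A') (Dbl_hop_map (vop B) (vop C) Q)
      (dbl_comp (vop A') (hlx_transpose A B H) P)"
    unfolding hlx_transpose_def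
    by (rule transpose_natural[OF v(2,1,3,4) PQ(1) qf_swap[OF Dbl_qf[OF B A(1) H C]] PQ(2)])
  finally show ?thesis by (simp add: Dbl_hlx_map_def)
qed

theorem theorem4p2:
  fixes A :: "'a dblcat" and A' :: "'a1 dblcat" and A'' :: "'a2 dblcat"
    and B :: "'b dblcat" and B' :: "'b1 dblcat" and B'' :: "'b2 dblcat"
    and C :: "'c dblcat" and C' :: "'c1 dblcat" and C'' :: "'c2 dblcat"
    and D :: "'d dblcat"
  assumes "double_category A" "double_category A'" "double_category A''"
    and "double_category B" "double_category B'" "double_category B''"
    and "double_category C" "double_category C'" "double_category C''"
    and "double_category D"
  shows
    "\<comment> \<open>double categories and strict double functors form a category\<close>
     dbl_id A \<in> Dbl A A \<and>
     (\<forall>F\<in>Dbl A B. \<forall>G\<in>Dbl B C. dbl_comp A G F \<in> Dbl A C) \<and>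
     (\<forall>F\<in>Dbl A B. dbl_comp A F (dbl_id A) = F \<and> dbl_comp A (dbl_id B) F = F) \<and>
     (\<forall>F\<in>Dbl A B. \<forall>G\<in>Dbl B C. \<forall>H\<in>Dbl C D.
        dbl_comp A H (dbl_comp A G F) = dbl_comp A (dbl_comp B H G) F) \<and>

     \<comment> \<open>the tensor product is a functor of two variables\<close>
     double_category (A \<otimes> B) \<and>
     (\<forall>F\<in>Dbl A A'. \<forall>G\<in>Dbl B B'.
        tensor_map A A' B B' F G \<in> Dbl (A \<otimes> B) (A' \<otimes> B') \<and>
        (\<forall>k l. dim k + dim l \<le> 2 \<longrightarrow> (\<forall>x\<in>cells A k. \<forall>y\<in>cells B l.
           tensor_map A A' B B' F G (join k l) (tcell A B k x l y)
           = tcell A' B' k (F k x) l (G l y)))) \<and>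
     tensor_map A A B B (dbl_id A) (dbl_id B) = dbl_id (A \<otimes> B) \<and>
     (\<forall>F\<in>Dbl A A'. \<forall>F'\<in>Dbl A' A''. \<forall>G\<in>Dbl B B'. \<forall>G'\<in>Dbl B' B''.
        tensor_map A A'' B B'' (dbl_comp A F' F) (dbl_comp B G' G)
        = dbl_comp (A \<otimes> B) (tensor_map A' A'' B' B'' F' G') (tensor_map A A' B B' F G)) \<and>

     \<comment> \<open>the unit object, and natural associativity and unit isomorphisms\<close>
     double_category unit_dbl \<and>
     dbl_iso (A \<otimes> B \<otimes> C) (A \<otimes> (B \<otimes> C)) (dbl_assoc A B C) \<and>
     dbl_iso (unit_dbl \<otimes> A) A (dbl_lunit A) \<and>
     dbl_iso (A \<otimes> unit_dbl) A (dbl_runit A) \<and>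
     (\<forall>F\<in>Dbl A A'. \<forall>G\<in>Dbl B B'. \<forall>H\<in>Dbl C C'.
        dbl_comp (A \<otimes> B \<otimes> C) (dbl_assoc A' B' C')
          (tensor_map (A \<otimes> B) (A' \<otimes> B') C C' (tensor_map A A' B B' F G) H)
        = dbl_comp (A \<otimes> B \<otimes> C)
            (tensor_map A A' (B \<otimes> C) (B' \<otimes> C') F (tensor_map B B' C C' G H)) (dbl_assoc A B C)) \<and>
     (\<forall>F\<in>Dbl A A'.
        dbl_comp (unit_dbl \<otimes> A) (dbl_lunit A')
          (tensor_map unit_dbl unit_dbl A A' (dbl_id unit_dbl) F)
        = dbl_comp (unit_dbl \<otimes> A) F (dbl_lunit A)) \<and>
     (\<forall>F\<in>Dbl A A'.
        dbl_comp (A \<otimes> unit_dbl) (dbl_runit A')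
          (tensor_map A A' unit_dbl unit_dbl F (dbl_id unit_dbl))
        = dbl_comp (A \<otimes> unit_dbl) F (dbl_runit A)) \<and>

     \<comment> \<open>the pentagon and triangle axioms\<close>
     dbl_comp (A \<otimes> B \<otimes> C \<otimes> D) (dbl_assoc A B (C \<otimes> D)) (dbl_assoc (A \<otimes> B) C D)
     = dbl_comp (A \<otimes> B \<otimes> C \<otimes> D)
         (tensor_map A A (B \<otimes> C \<otimes> D) (B \<otimes> (C \<otimes> D)) (dbl_id A) (dbl_assoc B C D))
         (dbl_comp (A \<otimes> B \<otimes> C \<otimes> D) (dbl_assoc A (B \<otimes> C) D)
           (tensor_map (A \<otimes> B \<otimes> C) (A \<otimes> (B \<otimes> C)) D D (dbl_assoc A B C) (dbl_id D))) \<and>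
     dbl_comp (A \<otimes> unit_dbl \<otimes> B)
       (tensor_map A A (unit_dbl \<otimes> B) B (dbl_id A) (dbl_lunit B)) (dbl_assoc A unit_dbl B)
     = tensor_map (A \<otimes> unit_dbl) A B B (dbl_runit A) (dbl_id B) \<and>

     \<comment> \<open>Dbl_hop B is a functor, and it is right adjoint to tensoring with B on the right\<close>
     double_category (Dbl_hop B C) \<and>
     (\<forall>Q\<in>Dbl C C'. Dbl_hop_map B C Q \<in> Dbl (Dbl_hop B C) (Dbl_hop B C')) \<and>
     Dbl_hop_map B C (dbl_id C) = dbl_id (Dbl_hop B C) \<and>
     (\<forall>Q\<in>Dbl C C'. \<forall>Q'\<in>Dbl C' C''.
        Dbl_hop_map B C (dbl_comp C Q' Q)
        = dbl_comp (Dbl_hop B C) (Dbl_hop_map B C' Q') (Dbl_hop_map B C Q)) \<and>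
     bij_betw (hop_transpose A B) (Dbl (A \<otimes> B) C) (Dbl A (Dbl_hop B C)) \<and>
     (\<forall>P\<in>Dbl A' A. \<forall>H\<in>Dbl (A \<otimes> B) C. \<forall>Q\<in>Dbl C C'.
        hop_transpose A' B
          (dbl_comp (A' \<otimes> B) Q (dbl_comp (A' \<otimes> B) H (tensor_map A' A B B P (dbl_id B))))
        = dbl_comp A' (Dbl_hop_map B C Q) (dbl_comp A' (hop_transpose A B H) P)) \<and>

     \<comment> \<open>Dbl_hlx B is a functor, and it is right adjoint to tensoring with B on the left\<close>
     double_category (Dbl_hlx B C) \<and>
     (\<forall>Q\<in>Dbl C C'. Dbl_hlx_map B C Q \<in> Dbl (Dbl_hlx B C) (Dbl_hlx B C')) \<and>
     Dbl_hlx_map B C (dbl_id C) = dbl_id (Dbl_hlx B C) \<and>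
     (\<forall>Q\<in>Dbl C C'. \<forall>Q'\<in>Dbl C' C''.
        Dbl_hlx_map B C (dbl_comp C Q' Q)
        = dbl_comp (Dbl_hlx B C) (Dbl_hlx_map B C' Q') (Dbl_hlx_map B C Q)) \<and>
     bij_betw (hlx_transpose A B) (Dbl (B \<otimes> A) C) (Dbl A (Dbl_hlx B C)) \<and>
     (\<forall>P\<in>Dbl A' A. \<forall>H\<in>Dbl (B \<otimes> A) C. \<forall>Q\<in>Dbl C C'.
        hlx_transpose A' B
          (dbl_comp (B \<otimes> A') Q (dbl_comp (B \<otimes> A') H (tensor_map B B A' A (dbl_id B) P)))
        = dbl_comp A' (Dbl_hlx_map B C Q) (dbl_comp A' (hlx_transpose A B H) P))"
proof -
  \<comment> \<open>The facts about \<open>Dbl_hlx\<close> are those about \<open>Dbl_hop\<close>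
    for the vertical duals; a \<open>vop\<close> on both domain and codomain leaves the strict
    double functors unchanged.\<close>
  have hlx: "double_category (Dbl_hlx B C)"
    using double_category_hop[of "vop B" "vop C"] assms(4,7) by (simp add: Dbl_hlx_def)
  have hlx_map: "Dbl_hlx_map B C Q \<in> Dbl (Dbl_hlx B C) (Dbl_hlx B C')" if "Q \<in> Dbl C C'" for Q
    using Dbl_hop_map_Dbl[of "vop B" "vop C" Q "vop C'"] assms(4,7) that by (simp add: Dbl_hlx_def Dbl_hlx_map_def)
  have hlx_id: "Dbl_hlx_map B C (dbl_id C) = dbl_id (Dbl_hlx B C)"
    using Dbl_hop_map_id[of "vop B" "vop C"] assms(4) by (simp add: Dbl_hlx_def Dbl_hlx_map_def)
  have hlx_comp: "Dbl_hlx_map B C (dbl_comp C Q' Q)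
      = dbl_comp (Dbl_hlx B C) (Dbl_hlx_map B C' Q') (Dbl_hlx_map B C Q)" if "Q \<in> Dbl C C'" for Q Q'
    using Dbl_hop_map_comp[of "vop B" "vop C" Q "vop C'" Q'] assms(4,7) that
    by (simp add: Dbl_hlx_def Dbl_hlx_map_def)
  show ?thesis
    by (intro conjI ballI allI impI)
      (assumption | rule assms Dbl_id Dbl_comp dbl_comp_id dbl_comp_assoc double_category_tensor tensor_map_props refl
          tensor_map_id tensor_map_comp double_category_unit dbl_assoc_iso dbl_lunit_iso dbl_runit_iso
          dbl_assoc_natural dbl_lunit_natural dbl_runit_natural pentagon triangle double_category_hop
          Dbl_hop_map_Dbl Dbl_hop_map_id Dbl_hop_map_comp hop_transpose_bij hop_transpose_natural
          hlx hlx_map hlx_id hlx_comp hlx_transpose_bij hlx_transpose_natural)+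
qed

end
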